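(* Let $\mathcal{A}\subseteq L^2(\mathcal{X})$ be a (finite or) countable set, let $V=S_\sigma^\Gamma(\mathcal{A})$, let $J(\alpha)=\overline{\mathrm{span}}\{Z_\sigma[\phi](\alpha):\phi\in\mathcal{A}\}\subseteq L^2(C)$ (for a.e. $\alpha\in\widehat{\Gamma}$) be the measurable range function associated to $V$, and let $0<A\le B<+\infty$. The following two conditions are equivalent: (i) $E_\sigma^\Gamma(\mathcal{A})=\{\Pi_\sigma(\gamma)\phi\}_{\gamma\in\Gamma,\phi\in\mathcal{A}}$ is a frame for $V$ with frame bounds $A,B$. (ii) For almost every $\alpha\in\widehat{\Gamma}$, the system $\{Z_\sigma[\phi](\alpha)\}_{\phi\in\mathcal{A}}$ is a frame for $J(\alpha)$ with (uniform) frame bounds $A,B$.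
   Context: Setting. $\Gamma$ is a countable discrete abelian group (written additively, identity $e$), $\widehat{\Gamma}$ is its (compact) dual group with Haar measure $m_{\widehat{\Gamma}}$ normalized by $m_{\widehat{\Gamma}}(\widehat{\Gamma})=1$, and $(\gamma,\alpha)$ denotes the value of the character $\alpha\in\widehat{\Gamma}$ at $\gamma\in\Gamma$. $(\mathcal{X},\mu)$ is a $\sigma$-finite measure space with $L^2(\mathcal{X})=L^2(\mathcal{X},\mu)$ separable. $\sigma:\Gamma\times\mathcal{X}\to\mathcal{X}$ is an action: each $\sigma_\gamma:=\sigma(\gamma,\cdot)$ is measurable, $\sigma_\gamma\circ\sigma_{\gamma'}=\sigma_{\gamma+\gamma'}$, and $\sigma_e$ is the identity. The action is quasi-$\Gamma$-invariant: there is a measurable function $J_\sigma:\Gamma\times\mathcal{X}\to(0,\infty)$ (the Jacobian) with $d\mu(\sigma_\gamma(x))=J_\sigma(\gamma,x)\,d\mu(x)$, i.e. $\mu(\sigma_\gamma(E))=\int_E J_\sigma(\gamma,x)\,d\mu(x)$ for measurable $E$. The action has the tiling property with tiling set $C$: $C\subseteq\mathcal{X}$ is measurable, $\mu(\sigma_\gamma(C)\cap\sigma_{\gamma'}(C))=0$ for $\gamma\ne\gamma'$, and $\mu(\mathcal{X}\setminus\bigcup_{\gamma\in\Gamma}\sigma_\gamma(C))=0$. $L^2(C)$ is taken with respect to $\mu|_C$. The associated unitary representation of $\Gamma$ on $L^2(\mathcal{X})$ is $\Pi_\sigma(\gamma)\psi(x)=J_\sigma(-\gamma,x)^{1/2}\psi(\sigma_{-\gamma}(x))$,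 and $S_\sigma^\Gamma(\mathcal{A})=\overline{\mathrm{span}}\{\Pi_\sigma(\gamma)\phi:\phi\in\mathcal{A},\gamma\in\Gamma\}$. The generalized Zak transform is the isometric isomorphism $Z_\sigma:L^2(\mathcal{X})\to L^2(\widehat{\Gamma},L^2(C))$, $Z_\sigma[\psi](\alpha)(x)=\sum_{\gamma\in\Gamma}[(\Pi_\sigma(\gamma)\psi)(x)]\,(-\gamma,\alpha)$, the sum being the $\ell^2(\Gamma)\to L^2(\widehat\Gamma)$ Fourier transform of the sequence $\{(\Pi_\sigma(\gamma)\psi)(x)\}_{\gamma\in\Gamma}$, which is in $\ell^2(\Gamma)$ for a.e. $x$. A finite or countable family $\{f_i\}_{i\in I}$ in a separable Hilbert space $\mathcal{H}$ is a frame for $\mathcal{H}$ with frame bounds $0<A\le B<\infty$ if $A\|f\|^2\le\sum_{i\in I}|\langle f,f_i\rangle|^2\le B\|f\|^2$ for all $f\in\mathcal{H}$. *)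

theory Defs
  imports "HOL-Analysis.Analysis" "HOL-Library.Function_Algebras"
begin

text \<open>
  Elements of complex \<open>L\<^sup>2\<close>-spaces are handled through representatives: functions that agree almost everywhere
  stand for the same element, and every notion below is insensitive to the representative.
\<close>

definition L2 :: "'a measure \<Rightarrow> ('a \<Rightarrow> complex) set" where
  "L2 M = {f \<in> borel_measurable M. integrable M (\<lambda>x. (cmod (f x))\<^sup>2)}"

definition L2_inner :: "'a measure \<Rightarrow> ('a \<Rightarrow> complex) \<Rightarrow> ('a \<Rightarrow> complex) \<Rightarrow> complex" where
  "L2_inner M f g = (\<integral>x. f x * cnj (g x) \<partial>M)"

definition L2_norm :: "'a measure \<Rightarrow> ('a \<Rightarrow> complex) \<Rightarrow> real" where
  "L2_norm M f = sqrt (\<integral>x. (cmod (f x))\<^sup>2 \<partial>M)"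

definition L2_separable :: "'a measure \<Rightarrow> bool" where
  "L2_separable M \<longleftrightarrow>
    (\<exists>D. countable D \<and> D \<subseteq> L2 M \<and>
      (\<forall>f\<in>L2 M. \<forall>\<epsilon>>0. \<exists>d\<in>D. L2_norm M (\<lambda>x. f x - d x) < \<epsilon>))"

abbreviation cspan :: "('a \<Rightarrow> complex) set \<Rightarrow> ('a \<Rightarrow> complex) set" where
  "cspan \<equiv> module.span (\<lambda>(c::complex) f x. c * f x)"

definition L2_closed_span :: "'a measure \<Rightarrow> ('a \<Rightarrow> complex) set \<Rightarrow> ('a \<Rightarrow> complex) set" where
  "L2_closed_span M S =
    {f \<in> L2 M. \<forall>\<epsilon>>0. \<exists>g\<in>cspan S. L2_norm M (\<lambda>x. f x - g x) < \<epsilon>}"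

text \<open>
  Here \<open>H\<close> is meant to be a closed subspace of \<open>L2 M\<close>. The middle sum is taken in \<open>[0, \<infinity>]\<close>, so that the
  upper bound includes its convergence.
\<close>

definition L2_frame ::
  "'a measure \<Rightarrow> ('a \<Rightarrow> complex) set \<Rightarrow> 'i set \<Rightarrow> ('i \<Rightarrow> 'a \<Rightarrow> complex) \<Rightarrow> real \<Rightarrow> real \<Rightarrow> bool" where
  "L2_frame M H I F A B \<longleftrightarrow>
    countable I \<and> 0 < A \<and> A \<le> B \<and> (\<forall>i\<in>I. F i \<in> H) \<and>
    (\<forall>f\<in>H. ennreal (A * (L2_norm M f)\<^sup>2)
              \<le> (\<Sum>\<^sub>\<infinity>i\<in>I. ennreal ((cmod (L2_inner M f (F i)))\<^sup>2)) \<and>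
            (\<Sum>\<^sub>\<infinity>i\<in>I. ennreal ((cmod (L2_inner M f (F i)))\<^sup>2))
              \<le> ennreal (B * (L2_norm M f)\<^sup>2))"

text \<open>
  \<open>\<Gamma>\<close> is the type \<open>'g\<close>, carrying the discrete topology. The topology of \<open>'g \<Rightarrow> complex\<close> is that of
  pointwise convergence, whose restriction is the usual topology of the dual. For countable \<open>\<Gamma>\<close> the dual is
  compact and metrizable, so Borel probability measures on it are automatically regular.
\<close>

definition dual_group :: "('g::ab_group_add \<Rightarrow> complex) set" where
  "dual_group = {\<alpha>. (\<forall>\<gamma>. cmod (\<alpha> \<gamma>) = 1) \<and> (\<forall>\<gamma> \<gamma>'. \<alpha> (\<gamma> + \<gamma>') = \<alpha> \<gamma> * \<alpha> \<gamma>')}"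

definition normalized_haar_dual :: "('g::ab_group_add \<Rightarrow> complex) measure \<Rightarrow> bool" where
  "normalized_haar_dual m \<longleftrightarrow>
    sets m = sets (restrict_space borel dual_group) \<and>
    emeasure m dual_group = 1 \<and>
    (\<forall>\<beta>\<in>dual_group. \<forall>E\<in>sets m. emeasure m ((\<lambda>\<alpha> \<gamma>. \<beta> \<gamma> * \<alpha> \<gamma>) ` E) = emeasure m E)"

text \<open>
  The Fourier transform from \<open>\<ell>\<^sup>2(\<Gamma>)\<close> to \<open>L\<^sup>2\<close> of the dual: \<open>g\<close> is the sum of
  \<open>a(\<gamma>) (-\<gamma>, \<alpha>)\<close> over \<open>\<gamma>\<close>, converging unconditionally in \<open>L\<^sup>2\<close>.
\<close>

definition is_fourier_transform ::
  "('g::ab_group_add \<Rightarrow> complex) measure \<Rightarrow> ('g \<Rightarrow> complex) \<Rightarrow> (('g \<Rightarrow> complex) \<Rightarrow> complex) \<Rightarrow> bool"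
where
  "is_fourier_transform m a g \<longleftrightarrow>
    g \<in> L2 m \<and>
    ((\<lambda>F. L2_norm m (\<lambda>\<alpha>. g \<alpha> - (\<Sum>\<gamma>\<in>F. a \<gamma> * \<alpha> (- \<gamma>)))) \<longlongrightarrow> 0) (finite_subsets_at_top UNIV)"

definition measurable_action :: "'x measure \<Rightarrow> ('g::ab_group_add \<Rightarrow> 'x \<Rightarrow> 'x) \<Rightarrow> bool" where
  "measurable_action M \<sigma> \<longleftrightarrow>
    (\<forall>\<gamma>. \<sigma> \<gamma> \<in> measurable M M) \<and>
    (\<forall>\<gamma> \<gamma>'. \<forall>x\<in>space M. \<sigma> \<gamma> (\<sigma> \<gamma>' x) = \<sigma> (\<gamma> + \<gamma>') x) \<and>
    (\<forall>x\<in>space M. \<sigma> 0 x = x)"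

definition is_jacobian ::
  "'x measure \<Rightarrow> ('g::ab_group_add \<Rightarrow> 'x \<Rightarrow> 'x) \<Rightarrow> ('g \<Rightarrow> 'x \<Rightarrow> real) \<Rightarrow> bool" where
  "is_jacobian M \<sigma> J \<longleftrightarrow>
    (\<lambda>(\<gamma>, x). J \<gamma> x) \<in> borel_measurable (count_space UNIV \<Otimes>\<^sub>M M) \<and>
    (\<forall>\<gamma>. \<forall>x\<in>space M. 0 < J \<gamma> x) \<and>
    (\<forall>\<gamma>. \<forall>E\<in>sets M. emeasure M (\<sigma> \<gamma> ` E) = (\<integral>\<^sup>+x\<in>E. ennreal (J \<gamma> x) \<partial>M))"

definition tiling_set :: "'x measure \<Rightarrow> ('g::ab_group_add \<Rightarrow> 'x \<Rightarrow> 'x) \<Rightarrow> 'x set \<Rightarrow> bool" where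
  "tiling_set M \<sigma> C \<longleftrightarrow>
    C \<in> sets M \<and>
    (\<forall>\<gamma> \<gamma>'. \<gamma> \<noteq> \<gamma>' \<longrightarrow> emeasure M (\<sigma> \<gamma> ` C \<inter> \<sigma> \<gamma>' ` C) = 0) \<and>
    emeasure M (space M - (\<Union>\<gamma>. \<sigma> \<gamma> ` C)) = 0"

definition action_rep ::
  "('g::ab_group_add \<Rightarrow> 'x \<Rightarrow> 'x) \<Rightarrow> ('g \<Rightarrow> 'x \<Rightarrow> real) \<Rightarrow> 'g \<Rightarrow> ('x \<Rightarrow> complex) \<Rightarrow> 'x \<Rightarrow> complex" where
  "action_rep \<sigma> J \<gamma> \<psi> x = complex_of_real (sqrt (J (- \<gamma>) x)) * \<psi> (\<sigma> (- \<gamma>) x)"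

definition invariant_space ::
  "'x measure \<Rightarrow> ('g::ab_group_add \<Rightarrow> 'x \<Rightarrow> 'x) \<Rightarrow> ('g \<Rightarrow> 'x \<Rightarrow> real) \<Rightarrow>
    ('x \<Rightarrow> complex) set \<Rightarrow> ('x \<Rightarrow> complex) set" where
  "invariant_space M \<sigma> J \<A> =
    L2_closed_span M {action_rep \<sigma> J \<gamma> \<phi> |\<gamma> \<phi>. \<phi> \<in> \<A>}"

text \<open>
  An element of \<open>L\<^sup>2\<close> of the dual with values in \<open>L\<^sup>2(C)\<close> is represented by a jointly measurable
  function of \<open>(\<alpha>, x)\<close> that is square integrable for the product measure. For \<open>\<psi>\<close> in \<open>L2 M\<close> the
  condition determines the function up to a null set of the product, hence, for almost every \<open>\<alpha>\<close>,
  its value at \<open>\<alpha>\<close> as an element of \<open>L\<^sup>2(C)\<close>.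
\<close>

definition zak_transform ::
  "'x measure \<Rightarrow> ('g::ab_group_add \<Rightarrow> complex) measure \<Rightarrow> ('g \<Rightarrow> 'x \<Rightarrow> 'x) \<Rightarrow> ('g \<Rightarrow> 'x \<Rightarrow> real) \<Rightarrow> 'x set \<Rightarrow>
    ('x \<Rightarrow> complex) \<Rightarrow> ('g \<Rightarrow> complex) \<Rightarrow> 'x \<Rightarrow> complex" where
  "zak_transform M m \<sigma> J C \<psi> =
    (SOME Z. (\<lambda>(\<alpha>, x). Z \<alpha> x) \<in> L2 (m \<Otimes>\<^sub>M restrict_space M C) \<and>
      (AE x in restrict_space M C.
        is_fourier_transform m (\<lambda>\<gamma>. action_rep \<sigma> J \<gamma> \<psi> x) (\<lambda>\<alpha>. Z \<alpha> x)))"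

definition range_function ::
  "'x measure \<Rightarrow> ('g::ab_group_add \<Rightarrow> complex) measure \<Rightarrow> ('g \<Rightarrow> 'x \<Rightarrow> 'x) \<Rightarrow> ('g \<Rightarrow> 'x \<Rightarrow> real) \<Rightarrow> 'x set \<Rightarrow>
    ('x \<Rightarrow> complex) set \<Rightarrow> ('g \<Rightarrow> complex) \<Rightarrow> ('x \<Rightarrow> complex) set" where
  "range_function M m \<sigma> J C \<A> \<alpha> =
    L2_closed_span (restrict_space M C) ((\<lambda>\<phi>. zak_transform M m \<sigma> J C \<phi> \<alpha>) ` \<A>)"

end

(* The fiberwise picture rests on one identity: if h is the integrable function alpha |-> <Zf(alpha), Z phi(alpha)>,
   then <f, Pi(gamma) phi> is a Fourier coefficient of h, so that Plancherel (valued in [0, infinity], since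
   h is only integrable) gives
     sum_gamma |<f, Pi(gamma) phi>|^2 = integral of |<Zf(alpha), Z phi(alpha)>|^2 over alpha.
   Integrating the inequalities of (ii) over alpha therefore gives (i), because Zf(alpha) lies in J(alpha) for
   almost every alpha when f is in V. Conversely, fix a finite combination d of elements of A. Translates of d give
   functions with Zak transform p(alpha) Zd(alpha) for every trigonometric polynomial p, so (i) says
     A int |p|^2 ||Zd||^2 <= int |p|^2 sum_phi |<Zd, Z phi>|^2 <= B int |p|^2 ||Zd||^2,
   and by Stone-Weierstrass these integrated inequalities hold pointwise almost everywhere. Letting d range
   over the combinations with coefficients in a countable dense set gives (ii); surjectivity of Z is never needed. *)

theory Submission
  imports Defs
begin

subsection \<open>Square-integrable functions\<close>

text \<open>\<open>zak_transform\<close> is a choice made separately for each function, so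
  identities between chosen values hold only almost everywhere. The relation \<open>zak_rel\<close>
  replaces it: it admits every valid representative, and those of combinations and translates are
  then given by exact formulas at each \<open>\<alpha>\<close>. A jointly measurable representative
  exists because one exhaustion of the group serves almost all \<open>x\<close> at once.

  Since h is merely integrable, Plancherel requires that Fourier coefficients determine integrable
  functions. This and the passage to pointwise inequalities both rest on
  \<open>trig_domination\<close>, which climbs from trigonometric polynomials to continuous weights,
  closed sets and Borel sets. Orthogonality of characters comes from invariance of Haar measure,
  provided that characters separate the elements of the group; these are built by Zorn's lemma.

  The lower frame bound does not pass to limits by itself, since infinitely many coefficients are
  involved; the upper bound is used to control the frame sum of the approximation error.\<close>

definition nsq :: "'a measure \<Rightarrow> ('a \<Rightarrow> complex) \<Rightarrow> ennreal" where
  "nsq M f = (\<integral>\<^sup>+x. ennreal ((cmod (f x))\<^sup>2) \<partial>M)"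

lemma L2_iff: "f \<in> L2 M \<longleftrightarrow> f \<in> borel_measurable M \<and> nsq M f < \<infinity>"
  unfolding L2_def nsq_def by (auto simp: integrable_iff_bounded)

text \<open>A Bochner integral is 0 for a nonintegrable function, so \<open>L2_norm\<close> cannot
  detect membership in \<open>L2\<close>. The extended value \<open>nsq\<close> can, and it combines
  with Tonelli and Fatou without side conditions.\<close>

lemma nsq_eq_norm: "f \<in> L2 M \<Longrightarrow> nsq M f = ennreal ((L2_norm M f)\<^sup>2)"
  unfolding nsq_def L2_norm_def L2_def by (auto simp: nn_integral_eq_integral)

lemma L2_norm_nonneg [simp]: "0 \<le> L2_norm M f"
  by (simp add: L2_norm_def)

lemma L2_norm_zero [simp]: "L2_norm M (\<lambda>x. 0) = 0"
  by (simp add: L2_norm_def)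

lemma L2_measurable [measurable_dest]: "f \<in> L2 M \<Longrightarrow> f \<in> borel_measurable M"
  by (simp add: L2_def)

lemma L2_integrable_sq: "f \<in> L2 M \<Longrightarrow> integrable M (\<lambda>x. (cmod (f x))\<^sup>2)"
  by (simp add: L2_def)

lemma L2_zero [simp]: "(\<lambda>x. 0) \<in> L2 M"
  by (simp add: L2_def)

lemma L2_scale: "f \<in> L2 M \<Longrightarrow> (\<lambda>x. c * f x) \<in> L2 M"
  by (auto simp: L2_def norm_mult power_mult_distrib)

lemma L2_uminus: "f \<in> L2 M \<Longrightarrow> (\<lambda>x. - f x) \<in> L2 M"
  by (auto simp: L2_def)

lemma L2_norm_scale: "L2_norm M (\<lambda>x. c * f x) = cmod c * L2_norm M f"
  by (simp add: L2_norm_def norm_mult power_mult_distrib real_sqrt_mult)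

lemma L2_norm_minus_commute: "L2_norm M (\<lambda>x. f x - g x) = L2_norm M (\<lambda>x. g x - f x)"
  by (simp add: L2_norm_def norm_minus_commute)

text \<open>The free weight \<open>t\<close> matters when a sharp constant must survive: letting
  \<open>t\<close> tend to 0 costs nothing on the first summand if the second one can be made
  negligible beforehand.\<close>

lemma norm_add_sq_le_weighted:
  fixes a b :: "'a::real_normed_vector"
  assumes "0 < t"
  shows "(norm (a + b))\<^sup>2 \<le> (1 + t) * (norm a)\<^sup>2 + (1 + 1/t) * (norm b)\<^sup>2"
proof -
  have "(norm (a + b))\<^sup>2 \<le> (norm a + norm b)\<^sup>2"
    by (intro power_mono norm_triangle_ineq) auto
  also have "\<dots> = (norm a)\<^sup>2 + (norm b)\<^sup>2 + 2 * (norm a * norm b)"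
    by (simp add: power2_sum)
  also have "2 * (norm a * norm b) \<le> t * (norm a)\<^sup>2 + (norm b)\<^sup>2 / t"
  proof -
    have "0 \<le> (t * norm a - norm b)\<^sup>2 / t" using assms by simp
    also have "\<dots> = t * (norm a)\<^sup>2 + (norm b)\<^sup>2 / t - 2 * (norm a * norm b)"
      using assms by (simp add: field_simps power2_eq_square)
    finally show ?thesis by simp
  qed
  finally show ?thesis by (simp add: algebra_simps)
qed

lemma L2_add: assumes "f \<in> L2 M" "g \<in> L2 M" shows "(\<lambda>x. f x + g x) \<in> L2 M"
proof -
  have [measurable]: "f \<in> borel_measurable M" "g \<in> borel_measurable M" using assms by (auto simp: L2_def)
  have "integrable M (\<lambda>x. 2 * (cmod (f x))\<^sup>2 + 2 * (cmod (g x))\<^sup>2)"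
    using assms by (auto simp: L2_def)
  then have "integrable M (\<lambda>x. (cmod (f x + g x))\<^sup>2)"
    by (rule Bochner_Integration.integrable_bound) (use norm_add_sq_le_weighted[of 1 "f _" "g _"] in auto)
  then show ?thesis by (simp add: L2_def)
qed

lemma L2_diff: "f \<in> L2 M \<Longrightarrow> g \<in> L2 M \<Longrightarrow> (\<lambda>x. f x - g x) \<in> L2 M"
  using L2_add[of f M "\<lambda>x. - g x"] L2_uminus[of g M] by simp

lemma L2_sum: "(\<And>i. i \<in> F \<Longrightarrow> f i \<in> L2 M) \<Longrightarrow> (\<lambda>x. \<Sum>i\<in>F. f i x) \<in> L2 M"
  by (induction F rule: infinite_finite_induct) (auto intro: L2_add)

lemma L2_integrable_norm_mult:
  assumes "f \<in> L2 M" "g \<in> L2 M" shows "integrable M (\<lambda>x. cmod (f x) * cmod (g x))"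
proof -
  have [measurable]: "f \<in> borel_measurable M" "g \<in> borel_measurable M" using assms by (auto simp: L2_def)
  have "integrable M (\<lambda>x. (cmod (f x))\<^sup>2 + (cmod (g x))\<^sup>2)"
    using assms by (auto simp: L2_def)
  then show ?thesis
  proof (rule Bochner_Integration.integrable_bound)
    have "a * b \<le> a\<^sup>2 + b\<^sup>2" if "0 \<le> a" "0 \<le> b" for a b :: real
      using sum_squares_bound[of a b] that mult_nonneg_nonneg[OF that] by linarith
    then show "AE x in M. norm (cmod (f x) * cmod (g x)) \<le> norm ((cmod (f x))\<^sup>2 + (cmod (g x))\<^sup>2)" by auto
  qed auto
qed

lemma borel_measurable_cnj [measurable]: "cnj \<in> borel_measurable borel"
  by (intro borel_measurable_continuous_onI continuous_intros)

lemma L2_integrable_inner: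
  assumes "f \<in> L2 M" "g \<in> L2 M" shows "integrable M (\<lambda>x. f x * cnj (g x))"
proof (rule Bochner_Integration.integrable_bound[OF L2_integrable_norm_mult[OF assms]])
  show "(\<lambda>x. f x * cnj (g x)) \<in> borel_measurable M"
    using assms by (auto simp: L2_def intro!: borel_measurable_times measurable_compose[OF _ borel_measurable_cnj])
qed (simp add: norm_mult)

text \<open>The integral of \<open>(t * cmod (f x) - cmod (g x))\<^sup>2\<close> is nonnegative for
  every real \<open>t\<close>, which bounds the discriminant of a quadratic in
  \<open>t\<close>.\<close>

lemma L2_cauchy_schwarz:
  assumes f: "f \<in> L2 M" and g: "g \<in> L2 M"
  shows "(\<integral>x. cmod (f x) * cmod (g x) \<partial>M) \<le> L2_norm M f * L2_norm M g"
proof -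
  define X where "X = (\<integral>x. cmod (f x) * cmod (g x) \<partial>M)"
  define a where "a = (\<integral>x. (cmod (f x))\<^sup>2 \<partial>M)"
  define b where "b = (\<integral>x. (cmod (g x))\<^sup>2 \<partial>M)"
  have nn: "0 \<le> X" "0 \<le> a" "0 \<le> b" unfolding X_def a_def b_def by auto
  note int = L2_integrable_norm_mult[OF f g] L2_integrable_sq[OF f] L2_integrable_sq[OF g]
  have q: "2 * t * X \<le> t\<^sup>2 * a + b" for t
  proof -
    have "0 \<le> (\<integral>x. (t * cmod (f x) - cmod (g x))\<^sup>2 \<partial>M)" by simp
    also have "\<dots> = (\<integral>x. t\<^sup>2 * (cmod (f x))\<^sup>2 + (cmod (g x))\<^sup>2 - 2 * t * (cmod (f x) * cmod (g x)) \<partial>M)"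
      by (simp add: power2_diff power_mult_distrib mult.assoc)
    also have "\<dots> = t\<^sup>2 * a + b - 2 * t * X" using int by (simp add: X_def a_def b_def)
    finally show ?thesis by simp
  qed
  have "X\<^sup>2 \<le> a * b"
  proof (cases "a = 0")
    case True
    have "X = 0"
    proof (rule ccontr)
      assume "X \<noteq> 0"
      \<comment> \<open>With \<open>a = 0\<close> the inequality is linear in \<open>t\<close>; this
        \<open>t\<close> makes its left side \<open>b + 1\<close>, above its right side
        \<open>b\<close>.\<close>
      then show False using q[of "(b+1)/(2*X)"] True by simp
    qed
    then show ?thesis using nn by simp
  next
    case False
    \<comment> \<open>\<open>X/a\<close> is where the quadratic in \<open>t\<close> attains its
      minimum.\<close>
    then show ?thesis using q[of "X/a"] nn by (simp add: field_simps power2_eq_square)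
  qed
  then have "X \<le> sqrt (a * b)" by (rule real_le_rsqrt)
  then show ?thesis by (simp add: L2_norm_def X_def a_def b_def real_sqrt_mult)
qed

lemma L2_inner_le:
  assumes f: "f \<in> L2 M" and g: "g \<in> L2 M"
  shows "cmod (L2_inner M f g) \<le> L2_norm M f * L2_norm M g"
proof -
  have "cmod (L2_inner M f g) \<le> (\<integral>x. cmod (f x * cnj (g x)) \<partial>M)"
    unfolding L2_inner_def by (rule integral_norm_bound)
  then show ?thesis using L2_cauchy_schwarz[OF f g] by (simp add: norm_mult)
qed

lemma L2_norm_triangle:
  assumes f: "f \<in> L2 M" and g: "g \<in> L2 M"
  shows "L2_norm M (\<lambda>x. f x + g x) \<le> L2_norm M f + L2_norm M g"
proof -
  have "(L2_norm M (\<lambda>x. f x + g x))\<^sup>2 = (\<integral>x. (cmod (f x + g x))\<^sup>2 \<partial>M)"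
    by (simp add: L2_norm_def)
  also have "\<dots> \<le> (\<integral>x. (cmod (f x))\<^sup>2 + (cmod (g x))\<^sup>2 + 2 * (cmod (f x) * cmod (g x)) \<partial>M)"
  proof (rule integral_mono)
    show "integrable M (\<lambda>x. (cmod (f x + g x))\<^sup>2)" using L2_add[OF f g] by (simp add: L2_def)
    show "integrable M (\<lambda>x. (cmod (f x))\<^sup>2 + (cmod (g x))\<^sup>2 + 2 * (cmod (f x) * cmod (g x)))"
      using L2_integrable_norm_mult[OF f g] f g by (auto simp: L2_def)
    fix x
    show "(cmod (f x + g x))\<^sup>2 \<le> (cmod (f x))\<^sup>2 + (cmod (g x))\<^sup>2 + 2 * (cmod (f x) * cmod (g x))"
      using power_mono[OF norm_triangle_ineq[of "f x" "g x"], of 2] by (simp add: power2_sum)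
  qed
  also have "\<dots> = (L2_norm M f)\<^sup>2 + (L2_norm M g)\<^sup>2 + 2 * (\<integral>x. cmod (f x) * cmod (g x) \<partial>M)"
    using L2_integrable_norm_mult[OF f g] f g by (auto simp: L2_def L2_norm_def)
  also have "\<dots> \<le> (L2_norm M f + L2_norm M g)\<^sup>2"
    using L2_cauchy_schwarz[OF f g] by (simp add: power2_sum)
  finally show ?thesis by (rule power2_le_imp_le) simp
qed

lemma L2_norm_triangle_diff:
  assumes "f \<in> L2 M" "g \<in> L2 M" "h \<in> L2 M"
  shows "L2_norm M (\<lambda>x. f x - h x) \<le> L2_norm M (\<lambda>x. f x - g x) + L2_norm M (\<lambda>x. g x - h x)"
  using L2_norm_triangle[OF L2_diff[OF assms(1,2)] L2_diff[OF assms(2,3)]] by simp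

lemma L2_norm_diff_abs:
  assumes "f \<in> L2 M" "g \<in> L2 M"
  shows "\<bar>L2_norm M f - L2_norm M g\<bar> \<le> L2_norm M (\<lambda>x. f x - g x)"
  using L2_norm_triangle_diff[OF assms L2_zero] L2_norm_triangle_diff[OF assms(2,1) L2_zero]
    L2_norm_minus_commute[of M f g] by simp

lemma L2_inner_diff_left:
  "f \<in> L2 M \<Longrightarrow> g \<in> L2 M \<Longrightarrow> h \<in> L2 M \<Longrightarrow>
    L2_inner M (\<lambda>x. f x - g x) h = L2_inner M f h - L2_inner M g h"
  unfolding L2_inner_def by (simp add: L2_integrable_inner left_diff_distrib)

text \<open>This turns the norm identity of the Zak transform into an inner product identity. The
  scalars are kept as factors of \<open>g\<close>, so that the terms are norms of combinations
  \<open>f + c g\<close>, on which the transform acts linearly.\<close>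

lemma L2_inner_polarization:
  assumes f: "f \<in> L2 M" and g: "g \<in> L2 M"
  shows "4 * L2_inner M f g =
    of_real ((L2_norm M (\<lambda>x. f x + g x))\<^sup>2) - of_real ((L2_norm M (\<lambda>x. f x + (-1) * g x))\<^sup>2)
    + \<i> * of_real ((L2_norm M (\<lambda>x. f x + \<i> * g x))\<^sup>2) - \<i> * of_real ((L2_norm M (\<lambda>x. f x + (- \<i>) * g x))\<^sup>2)"
proof -
  have i: "integrable M (\<lambda>x. complex_of_real ((cmod (f x + c * g x))\<^sup>2))" for c
    using L2_add[OF f L2_scale[OF g, of c]] unfolding L2_def by (intro integrable_of_real) auto
  have n: "of_real ((L2_norm M (\<lambda>x. f x + c * g x))\<^sup>2) = (\<integral>x. complex_of_real ((cmod (f x + c * g x))\<^sup>2) \<partial>M)" for c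
    unfolding integral_complex_of_real by (simp add: L2_norm_def)
  have pw: "4 * (a * cnj b) = of_real ((cmod (a + 1 * b))\<^sup>2) - of_real ((cmod (a + (-1) * b))\<^sup>2)
    + \<i> * of_real ((cmod (a + \<i> * b))\<^sup>2) - \<i> * of_real ((cmod (a + (- \<i>) * b))\<^sup>2)" for a b
    unfolding complex_norm_square by (simp add: algebra_simps)
  have "4 * L2_inner M f g = (\<integral>x. 4 * (f x * cnj (g x)) \<partial>M)" by (simp add: L2_inner_def)
  also have "\<dots> = (\<integral>x. complex_of_real ((cmod (f x + 1 * g x))\<^sup>2) - of_real ((cmod (f x + (-1) * g x))\<^sup>2)
    + \<i> * of_real ((cmod (f x + \<i> * g x))\<^sup>2) - \<i> * of_real ((cmod (f x + (- \<i>) * g x))\<^sup>2) \<partial>M)"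
    unfolding pw ..
  also have "\<dots> = (\<integral>x. complex_of_real ((cmod (f x + 1 * g x))\<^sup>2) \<partial>M) - (\<integral>x. of_real ((cmod (f x + (-1) * g x))\<^sup>2) \<partial>M)
    + \<i> * (\<integral>x. of_real ((cmod (f x + \<i> * g x))\<^sup>2) \<partial>M) - \<i> * (\<integral>x. of_real ((cmod (f x + (- \<i>) * g x))\<^sup>2) \<partial>M)"
    using i[of 1] i[of "-1"] i[of "\<i>"] i[of "-\<i>"]
    by (simp only: Bochner_Integration.integral_diff Bochner_Integration.integral_add integral_mult_right_zero
       Bochner_Integration.integrable_diff Bochner_Integration.integrable_add integrable_mult_right simp_thms)
  finally show ?thesis unfolding n[symmetric] by (simp only: mult_1)
qed

section \<open>Complex linear spans of functions\<close>

lemma module_fun: "module (\<lambda>(c::complex) (f::'a \<Rightarrow> complex) x. c * f x)"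
  by standard (auto simp: fun_eq_iff algebra_simps)

lemmas cspan_base = module.span_base[OF module_fun]
lemmas cspan_zero = module.span_zero[OF module_fun]
lemmas cspan_add = module.span_add[OF module_fun]
lemmas cspan_diff = module.span_diff[OF module_fun]
lemmas cspan_scale = module.span_scale[OF module_fun]
lemmas cspan_induct_alt = module.span_induct_alt[OF module_fun, consumes 1, case_names base step]

lemma cspan_subset_L2: assumes "S \<subseteq> L2 M" shows "cspan S \<subseteq> L2 M"
proof
  fix f assume "f \<in> cspan S"
  then show "f \<in> L2 M"
  proof (induction rule: cspan_induct_alt)
    case base
    then show ?case by (simp add: zero_fun_def)
  next
    case (step c x y)
    then show ?case using L2_add[OF L2_scale[of x M c], of y] assms by (auto simp: plus_fun_def)
  qed
qed

lemma cspan_subset_closed_span: assumes "S \<subseteq> L2 M" shows "cspan S \<subseteq> L2_closed_span M S"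
  using cspan_subset_L2[OF assms] by (auto simp: L2_closed_span_def intro!: bexI[where P="\<lambda>g. L2_norm M (\<lambda>x. _ x - g x) < _"])

lemma L2_inner_self: "f \<in> L2 M \<Longrightarrow> L2_inner M f f = of_real ((L2_norm M f)\<^sup>2)"
  unfolding L2_inner_def L2_norm_def by (simp only: complex_norm_square[symmetric] integral_complex_of_real) simp

lemma nsq_scale: "nsq N (\<lambda>x. c * f x) = ennreal ((cmod c)\<^sup>2) * nsq N f" if "f \<in> borel_measurable N" for N :: "'b measure"
  using that unfolding nsq_def by (simp add: norm_mult power_mult_distrib ennreal_mult nn_integral_cmult)

subsection \<open>Countable sums and limits of integrals\<close>

text \<open>Makes Tonelli available for the sums in \<open>L2_frame\<close>. For the harder
  inequality, a simple function below \<open>f\<close> either has finite support, where its integral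
  is a finite sum, or takes some nonzero value infinitely often, and then the sum over
  \<open>I\<close> is already infinite.\<close>

lemma infsum_ennreal_eq_nn_integral:
  fixes f :: "'i \<Rightarrow> ennreal"
  shows "(\<Sum>\<^sub>\<infinity>i\<in>I. f i) = (\<integral>\<^sup>+i. f i \<partial>count_space I)"
proof (rule antisym)
  show "(\<Sum>\<^sub>\<infinity>i\<in>I. f i) \<le> (\<integral>\<^sup>+i. f i \<partial>count_space I)"
    unfolding nonneg_infsum_complete[OF zero_le]
  proof (rule SUP_least, clarsimp)
    fix F assume F: "finite F" "F \<subseteq> I"
    have "sum f F = (\<Sum>i\<in>F. f i * indicator F i)" by (intro sum.cong) auto
    also have "\<dots> = (\<integral>\<^sup>+i. f i * indicator F i \<partial>count_space I)"
      using F by (intro nn_integral_count_space'[symmetric]) auto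
    also have "\<dots> \<le> (\<integral>\<^sup>+i. f i \<partial>count_space I)"
      by (intro nn_integral_mono) (auto simp: indicator_def)
    finally show "sum f F \<le> (\<integral>\<^sup>+i. f i \<partial>count_space I)" .
  qed
  show "(\<integral>\<^sup>+i. f i \<partial>count_space I) \<le> (\<Sum>\<^sub>\<infinity>i\<in>I. f i)"
    unfolding nn_integral_def
  proof (rule SUP_least)
    fix g :: "'i \<Rightarrow> ennreal"
    assume "g \<in> {g. simple_function (count_space I) g \<and> g \<le> f}"
    then have sf: "finite (g ` I)" and le: "g \<le> f" by auto
    have "(\<integral>\<^sup>+i. g i \<partial>count_space I) = integral\<^sup>S (count_space I) g"
      using sf by (intro nn_integral_eq_simple_integral) auto
    show "integral\<^sup>S (count_space I) g \<le> (\<Sum>\<^sub>\<infinity>i\<in>I. f i)"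
    proof (cases "finite {i\<in>I. g i \<noteq> 0}")
      case True
      have "integral\<^sup>S (count_space I) g = (\<integral>\<^sup>+i. g i \<partial>count_space I)"
        using \<open>(\<integral>\<^sup>+i. g i \<partial>count_space I) = integral\<^sup>S (count_space I) g\<close> by simp
      also have "\<dots> = sum g {i\<in>I. g i \<noteq> 0}"
        using True by (intro nn_integral_count_space') auto
      also have "\<dots> \<le> sum f {i\<in>I. g i \<noteq> 0}" using le by (auto intro!: sum_mono simp: le_fun_def)
      also have "\<dots> = infsum f {i\<in>I. g i \<noteq> 0}" using True by simp
      also have "\<dots> \<le> infsum f I" by (rule infsum_mono_neutral) (auto intro: nonneg_summable_on_complete)
      finally show ?thesis .
    next
      case False
      have "\<exists>c\<in>g ` I - {0}. infinite {i\<in>I. g i = c}"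
      proof (rule ccontr)
        assume "\<not> ?thesis"
        then have "finite (\<Union>c\<in>g ` I - {0}. {i\<in>I. g i = c})" using sf by auto
        moreover have "{i\<in>I. g i \<noteq> 0} = (\<Union>c\<in>g ` I - {0}. {i\<in>I. g i = c})" by auto
        ultimately show False using False by simp
      qed
      then obtain c where c: "c \<noteq> 0" "infinite {i\<in>I. g i = c}" by auto
      have "infsum f {i\<in>I. g i = c} = \<infinity>"
        using c le by (intro infsum_superconst_infinite_ennreal[where b=c])
          (auto simp: le_fun_def zero_less_iff_neq_zero)
      moreover have "infsum f {i\<in>I. g i = c} \<le> infsum f I" by (rule infsum_mono_neutral) (auto intro: nonneg_summable_on_complete)
      ultimately show ?thesis by (simp add: top_unique)
    qed
  qed
qed

lemma ennreal_finiteE: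
  fixes x :: ennreal
  assumes "x < \<infinity>" obtains K where "0 \<le> K" "x = ennreal K"
  using assms by (cases x) auto

lemma nn_integral_count_space_summable:
  fixes f :: "'i \<Rightarrow> real"
  assumes nn: "\<And>i. 0 \<le> f i" and s: "f summable_on I"
  shows "(\<integral>\<^sup>+i. ennreal (f i) \<partial>count_space I) = ennreal (infsum f I)"
proof -
  have "ennreal (infsum f I) = (SUP F\<in>{F. finite F \<and> F \<subseteq> I}. ennreal (sum f F))"
    by (rule infsum_nonneg_is_SUPREMUM_ennreal[OF s nn])
  also have "\<dots> = (SUP F\<in>{F. finite F \<and> F \<subseteq> I}. (\<Sum>i\<in>F. ennreal (f i)))"
    using nn by (simp add: sum_ennreal)
  also have "\<dots> = (\<Sum>\<^sub>\<infinity>i\<in>I. ennreal (f i))"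
    by (rule nonneg_infsum_complete[OF zero_le, symmetric])
  finally show ?thesis by (simp add: infsum_ennreal_eq_nn_integral)
qed

lemma summable_on_if_nn_integral_finite:
  fixes f :: "'i \<Rightarrow> real"
  assumes nn: "\<And>i. 0 \<le> f i" and fin: "(\<integral>\<^sup>+i. ennreal (f i) \<partial>count_space I) < \<infinity>"
  shows "f summable_on I"
proof (rule nonneg_bdd_above_summable_on)
  obtain K where K: "0 \<le> K" "(\<integral>\<^sup>+i. ennreal (f i) \<partial>count_space I) = ennreal K"
    by (rule ennreal_finiteE[OF fin])
  show "bdd_above (sum f ` {F. F \<subseteq> I \<and> finite F})"
  proof (rule bdd_aboveI2)
    fix F assume F: "F \<in> {F. F \<subseteq> I \<and> finite F}"
    have "ennreal (sum f F) = (\<Sum>i\<in>F. ennreal (f i))" using nn by (simp add: sum_ennreal)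
    also have "\<dots> \<le> (SUP F\<in>{F. finite F \<and> F \<subseteq> I}. (\<Sum>i\<in>F. ennreal (f i)))"
      using F by (intro SUP_upper) auto
    also have "\<dots> = (\<Sum>\<^sub>\<infinity>i\<in>I. ennreal (f i))"
      by (rule nonneg_infsum_complete[OF zero_le, symmetric])
    also have "\<dots> = ennreal K" by (simp add: infsum_ennreal_eq_nn_integral K)
    finally show "sum f F \<le> K" using K(1) by simp
  qed
qed (use nn in auto)

lemma sqrt_half_power_sq: "((sqrt (1/2)) ^ n)\<^sup>2 = (1/2::real) ^ n"
  by (simp flip: power_mult add: mult.commute[of n] ) (simp add: power_mult)

text \<open>Each term of the series is at most the finite total, which forces geometric decay of the
  increments. For partial Fourier sums this converts a weighted sum of squared L2 distances into
  convergence almost everywhere.\<close>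

lemma convergent_if_weighted_sq_summable:
  fixes s :: "nat \<Rightarrow> complex"
  assumes "(\<Sum>n. ennreal (2 ^ n * (cmod (s (Suc n) - s n))\<^sup>2)) < \<infinity>"
  shows "convergent s"
proof -
  obtain K where K: "0 \<le> K" "(\<Sum>n. ennreal (2 ^ n * (cmod (s (Suc n) - s n))\<^sup>2)) = ennreal K"
    by (rule ennreal_finiteE[OF assms])
  have "cmod (s (Suc n) - s n) \<le> sqrt K * sqrt (1/2) ^ n" for n
  proof -
    define d where "d n = 2 ^ n * (cmod (s (Suc n) - s n))\<^sup>2" for n
    have "ennreal (d n) \<le> ennreal K"
      unfolding K(2)[folded d_def, symmetric]
      using sum_le_suminf[of "\<lambda>n. ennreal (d n)" "{n}"] by simp
    then have "d n \<le> K" using K(1) by simp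
    then have "(cmod (s (Suc n) - s n))\<^sup>2 \<le> K * (1/2) ^ n"
      by (simp add: d_def field_simps power_divide)
    also have "\<dots> = (sqrt K * sqrt (1/2) ^ n)\<^sup>2"
      using K(1) by (simp only: power_mult_distrib sqrt_half_power_sq real_sqrt_pow2)
    finally show ?thesis by (rule power2_le_imp_le) (use K(1) in auto)
  qed
  moreover have "summable (\<lambda>n. sqrt K * sqrt (1/2) ^ n)"
    by (intro summable_mult summable_geometric) (auto simp: real_sqrt_divide)
  ultimately have "summable (\<lambda>n. s (Suc n) - s n)"
    by (rule_tac summable_comparison_test'[of "\<lambda>n. sqrt K * sqrt (1/2) ^ n" 0]) simp_all
  then have "convergent (\<lambda>n. \<Sum>i<n. s (Suc i) - s i)"
    by (simp only: summable_iff_convergent)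
  then have "convergent (\<lambda>n. (\<Sum>i<n. s (Suc i) - s i) + s 0)"
    by (rule convergent_add[OF _ convergent_const])
  then show ?thesis by (simp only: sum_lessThan_telescope diff_add_cancel)
qed

lemma nn_integral_count_space_Times:
  assumes "countable I" "countable K"
  shows "(\<integral>\<^sup>+p. f p \<partial>count_space (I \<times> K)) = (\<integral>\<^sup>+k. \<integral>\<^sup>+i. f (i, k) \<partial>count_space I \<partial>count_space K)"
proof -
  interpret pair_sigma_finite "count_space I" "count_space K"
    using assms by (intro pair_sigma_finite.intro sigma_finite_measure_count_space_countable)
  have eq: "count_space I \<Otimes>\<^sub>M count_space K = count_space (I \<times> K)"
    by (rule pair_measure_countable[OF assms])
  show ?thesis
    unfolding eq[symmetric] by (rule nn_integral_snd[symmetric]) (simp add: eq)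
qed

lemma borel_measurable_nn_integral_count_space:
  fixes f :: "'i \<Rightarrow> 'a \<Rightarrow> ennreal"
  assumes I: "countable I" and [measurable]: "\<And>i. i \<in> I \<Longrightarrow> f i \<in> borel_measurable M"
  shows "(\<lambda>x. \<integral>\<^sup>+i. f i x \<partial>count_space I) \<in> borel_measurable M"
proof -
  interpret sigma_finite_measure "count_space I"
    by (rule sigma_finite_measure_count_space_countable[OF I])
  have "(\<lambda>(x, i). f i x) \<in> borel_measurable (M \<Otimes>\<^sub>M count_space I)"
    unfolding split_beta'
    by (rule measurable_compose_countable'[where f = "\<lambda>i p. f i (fst p)" and g = snd and I = I])
       (use I in auto)
  then show ?thesis by (rule borel_measurable_nn_integral)
qed

text \<open>Fatou. The bound is asked only from \<open>n0\<close> on because it will hold once an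
  increasing sequence of sets has absorbed a given finite set.\<close>

lemma nn_integral_le_of_LIMSEQ:
  assumes [measurable]: "\<And>n. f n \<in> borel_measurable M"
    and lim: "AE x in M. (\<lambda>n. f n x) \<longlonglongrightarrow> g x"
    and bnd: "\<And>n. n0 \<le> n \<Longrightarrow> (\<integral>\<^sup>+x. f n x \<partial>M) \<le> B"
  shows "(\<integral>\<^sup>+x. g x \<partial>M) \<le> (B::ennreal)"
proof -
  have "(\<integral>\<^sup>+x. g x \<partial>M) = (\<integral>\<^sup>+x. liminf (\<lambda>n. f n x) \<partial>M)"
    by (intro nn_integral_cong_AE, use lim in eventually_elim) (simp add: lim_imp_Liminf)
  also have "\<dots> \<le> liminf (\<lambda>n. \<integral>\<^sup>+x. f n x \<partial>M)" by (rule nn_integral_liminf) simp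
  also have "\<dots> \<le> limsup (\<lambda>n. \<integral>\<^sup>+x. f n x \<partial>M)" by (rule Liminf_le_Limsup) simp
  also have "\<dots> \<le> B"
    by (rule Limsup_bounded) (use bnd in \<open>auto simp: eventually_sequentially\<close>)
  finally show ?thesis .
qed

subsection \<open>Characters of a discrete abelian group\<close>

primrec nmul :: "nat \<Rightarrow> 'g::ab_group_add \<Rightarrow> 'g" where
  "nmul 0 g = 0"
| "nmul (Suc n) g = g + nmul n g"

lemma nmul_add: "nmul (a + b) g = nmul a g + nmul b g"
  by (induction a) (auto simp: add.assoc)

lemma nmul_mult: "nmul (a * b) g = nmul a (nmul b g)"
  by (induction a) (auto simp: nmul_add)

text \<open>Graphs of characters of subgroups.\<close>

definition partial_char :: "('g::ab_group_add \<times> complex) set \<Rightarrow> bool" where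
  "partial_char R \<longleftrightarrow>
    (0, 1) \<in> R \<and>
    (\<forall>h w. (h, w) \<in> R \<longrightarrow> cmod w = 1 \<and> (- h, cnj w) \<in> R) \<and>
    (\<forall>h w h' w'. (h, w) \<in> R \<longrightarrow> (h', w') \<in> R \<longrightarrow> (h + h', w * w') \<in> R) \<and>
    (\<forall>w. (0, w) \<in> R \<longrightarrow> w = 1)"

lemma partial_charD:
  assumes "partial_char R"
  shows "(0, 1) \<in> R" "(h, w) \<in> R \<Longrightarrow> cmod w = 1" "(h, w) \<in> R \<Longrightarrow> (- h, cnj w) \<in> R"
    "(h, w) \<in> R \<Longrightarrow> (h', w') \<in> R \<Longrightarrow> (h + h', w * w') \<in> R"
    "(0, w) \<in> R \<Longrightarrow> w = 1"
  using assms unfolding partial_char_def by blast+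

lemma mult_cnj_unit: "cmod z = 1 \<Longrightarrow> z * cnj z = 1"
  using complex_norm_square[of z] by simp

lemma partial_char_unique:
  assumes R: "partial_char R" and "(h, w) \<in> R" "(h, w') \<in> R" shows "w = w'"
proof -
  have "(h + - h, w * cnj w') \<in> R" using assms partial_charD by metis
  then have 1: "w * cnj w' = 1" using partial_charD(5)[OF R] by simp
  have "w = w * (cnj w' * w')"
    using mult_cnj_unit[OF partial_charD(2)[OF R assms(3)]] by (simp add: mult.commute)
  also have "\<dots> = w'" using 1 by (simp flip: mult.assoc)
  finally show ?thesis .
qed

lemma partial_char_nmul:
  assumes R: "partial_char R" and "(h, w) \<in> R" shows "(nmul n h, w ^ n) \<in> R"
  by (induction n) (auto simp: assms partial_charD)

text \<open>The only obstruction to sending \<open>g\<close> to \<open>z\<close> is a multiple of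
  \<open>g\<close> already in the domain of \<open>R\<close>, and \<open>compat\<close> says that
  the two values agree there. Natural multiples suffice, since negatives follow by
  conjugation.\<close>

lemma partial_char_extend:
  assumes R: "partial_char R" and z: "cmod z = 1"
    and compat: "\<And>n w. (nmul n g, w) \<in> R \<Longrightarrow> z ^ n = w"
  shows "\<exists>R'. partial_char R' \<and> R \<subseteq> R' \<and> (g, z) \<in> R'"
proof -
  \<comment> \<open>An integer multiple of \<open>g\<close> is written as a difference of natural
    multiples, and the inverse of \<open>z\<close> as its conjugate. Different pairs
    \<open>a\<close>, \<open>b\<close> may describe the same element.\<close>
  define R' where "R' = {(h + nmul a g - nmul b g, w * z ^ a * cnj z ^ b) | h w a b. (h, w) \<in> R}"
  have R'I: "(h + nmul a g - nmul b g, w * z ^ a * cnj z ^ b) \<in> R'" if "(h, w) \<in> R" for h w a b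
    using that unfolding R'_def by blast
  have zz: "z ^ n * cnj z ^ n = 1" for n
    by (simp add: mult_cnj_unit[OF z] flip: power_mult_distrib)
  have "R \<subseteq> R'"
  proof clarify
    fix h w assume "(h, w) \<in> R" then show "(h, w) \<in> R'" using R'I[of h w 0 0] by simp
  qed
  moreover have "(g, z) \<in> R'" using R'I[OF partial_charD(1)[OF R], of 1 0] by simp
  moreover have "partial_char R'"
    unfolding partial_char_def
  proof (intro conjI allI impI)
    show "(0, 1) \<in> R'" using R'I[OF partial_charD(1)[OF R], of 0 0] by simp
    fix h w assume hw: "(h, w) \<in> R'"
    then obtain h0 w0 a b where 0: "(h0, w0) \<in> R" "h = h0 + nmul a g - nmul b g"
      "w = w0 * z ^ a * cnj z ^ b" unfolding R'_def by blast
    show "cmod w = 1" using 0 z partial_charD(2)[OF R] by (simp add: norm_mult norm_power)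
    show "(- h, cnj w) \<in> R'"
    proof -
      have "- h = - h0 + nmul b g - nmul a g" using 0(2) by simp
      moreover have "cnj w = cnj w0 * z ^ b * cnj z ^ a" using 0(3) by simp
      ultimately show ?thesis using R'I[OF partial_charD(3)[OF R 0(1)], of b a] by (simp only:)
    qed
    fix h' w' assume hw': "(h', w') \<in> R'"
    then obtain h1 w1 c d where 1: "(h1, w1) \<in> R" "h' = h1 + nmul c g - nmul d g"
      "w' = w1 * z ^ c * cnj z ^ d" unfolding R'_def by blast
    have "h + h' = h0 + h1 + nmul (a + c) g - nmul (b + d) g"
      unfolding 0(2) 1(2) by (simp add: nmul_add algebra_simps)
    moreover have "w * w' = w0 * w1 * z ^ (a + c) * cnj z ^ (b + d)"
      unfolding 0(3) 1(3) by (simp add: power_add)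
    ultimately show "(h + h', w * w') \<in> R'"
      using R'I[OF partial_charD(4)[OF R 0(1) 1(1)], of "a + c" "b + d"] by (simp only:)
  next
    fix w assume "(0, w) \<in> R'"
    then obtain h0 w0 a b where 0: "(h0, w0) \<in> R" "0 = h0 + nmul a g - nmul b g"
      "w = w0 * z ^ a * cnj z ^ b" unfolding R'_def by blast
    show "w = 1"
    \<comment> \<open>The relation \<open>0 = h0 + nmul a g - nmul b g\<close> puts a natural
      multiple of \<open>g\<close> into the domain of \<open>R\<close>: it is \<open>h0\<close> or
      \<open>- h0\<close> according to the sign of \<open>a - b\<close>, and \<open>compat\<close>
      evaluates it.\<close>
    proof (cases "a \<le> b")
      case True
      then have "nmul b g = nmul (b - a) g + nmul a g" by (simp flip: nmul_add)
      then have "nmul (b - a) g = h0" using 0 by (simp add: algebra_simps)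
      then have w: "w0 = z ^ (b - a)" using compat 0(1) by metis
      have "w = z ^ (b - a + a) * cnj z ^ b" unfolding 0(3) w power_add ..
      then show ?thesis using zz True by simp
    next
      case False
      then have "nmul a g = nmul (a - b) g + nmul b g" by (simp flip: nmul_add)
      then have "nmul (a - b) g = - h0" using 0 by (simp add: algebra_simps eq_neg_iff_add_eq_0)
      then have w: "z ^ (a - b) = cnj w0" using compat partial_charD(3)[OF R 0(1)] by metis
      have "z ^ a = z ^ (a - b) * z ^ b" using False by (simp flip: power_add)
      then have "w = (w0 * cnj w0) * (z ^ b * cnj z ^ b)" unfolding 0(3) w by simp
      then show ?thesis using zz mult_cnj_unit[OF partial_charD(2)[OF R 0(1)]] by simp
    qed
  qed
  ultimately show ?thesis by blast
qed

text \<open>If no positive multiple of \<open>g\<close> lies in the domain, \<open>-1\<close> is an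
  admissible value. Otherwise take the least positive \<open>n\<close> with \<open>nmul n g\<close>
  in the domain and an n-th root of the value there; \<open>n\<close> is at least 2, so a root other
  than 1 exists even when that value is 1.\<close>

lemma partial_char_extend_nontrivial:
  assumes R: "partial_char R" and g: "g \<notin> Domain R"
  shows "\<exists>R' z. partial_char R' \<and> R \<subseteq> R' \<and> (g, z) \<in> R' \<and> z \<noteq> 1"
proof (cases "\<exists>n. 0 < n \<and> nmul n g \<in> Domain R")
  case False
  have "\<exists>R'. partial_char R' \<and> R \<subseteq> R' \<and> (g, -1) \<in> R'"
  proof (rule partial_char_extend[OF R])
    fix n w assume nw: "(nmul n g, w) \<in> R"
    then have "n = 0" using False by auto
    then show "(- 1) ^ n = w" using nw partial_charD(5)[OF R] by simp
  qed simp
  then show ?thesis by (metis one_neq_neg_one)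
next
  case True
  define n where "n = (LEAST n. 0 < n \<and> nmul n g \<in> Domain R)"
  have n: "0 < n" "nmul n g \<in> Domain R" using LeastI_ex[OF True] unfolding n_def by auto
  have least: "n \<le> k" if "0 < k" "nmul k g \<in> Domain R" for k
    using that unfolding n_def by (intro Least_le) auto
  have n2: "2 \<le> n"
  proof (rule ccontr)
    assume "\<not> ?thesis" then have "n = 1" using n by simp
    then show False using n(2) g by simp
  qed
  obtain w0 where w0: "(nmul n g, w0) \<in> R" using n(2) by auto
  \<comment> \<open>The principal argument of 1 is 0 and would produce the root 1, so a full turn
    replaces it.\<close>
  define \<theta> where "\<theta> = (if w0 = 1 then 2 * pi else Arg w0)"
  have "cmod w0 = 1" by (rule partial_charD(2)[OF R w0])
  then have "w0 \<noteq> 0" "sgn w0 = w0" by (auto simp: sgn_div_norm)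
  then have "cis \<theta> = w0" using cis_Arg[of w0] by (simp add: \<theta>_def)
  define z where "z = cis (\<theta> / n)"
  have zn: "z ^ n = w0" unfolding z_def Complex.DeMoivre using \<open>cis \<theta> = w0\<close> n(1) by simp
  have "z \<noteq> 1"
  proof
    assume "z = 1"
    then have "w0 = 1" using zn by simp
    then have "\<theta> / n = 2 * (pi / n)" by (simp add: \<theta>_def)
    moreover have "cos (\<theta> / n) = 1" using \<open>z = 1\<close> by (simp add: z_def complex_eq_iff)
    ultimately have "cos (2 * (pi / n)) = 1" by (simp only:)
    then have "sin (pi / n) = 0" unfolding cos_double_sin by simp
    moreover have "0 < sin (pi / n)" using n2 by (intro sin_gt_zero) (auto simp: field_simps)
    ultimately show False by simp
  qed
  have "\<exists>R'. partial_char R' \<and> R \<subseteq> R' \<and> (g, z) \<in> R'"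
  proof (rule partial_char_extend[OF R])
    show "cmod z = 1" by (simp add: z_def)
    fix k w assume kw: "(nmul k g, w) \<in> R"
    have q: "(nmul (k div n * n) g, w0 ^ (k div n)) \<in> R"
      using partial_char_nmul[OF R w0] by (simp add: nmul_mult)
    have "nmul k g = nmul (k div n * n) g + nmul (k mod n) g" by (simp flip: nmul_add)
    then have "nmul (k mod n) g = nmul k g + - nmul (k div n * n) g" by simp
    \<comment> \<open>By minimality of \<open>n\<close> the remainder must be 0, so \<open>n\<close>
      divides \<open>k\<close> and the value at \<open>nmul k g\<close> is a power of
      \<open>w0\<close>.\<close>
    then have "nmul (k mod n) g \<in> Domain R"
      using partial_charD(4)[OF R kw partial_charD(3)[OF R q]] by auto
    then have "k mod n = 0" using least[of "k mod n"] n(1) by (meson mod_less_divisor not_le not_gr_zero)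
    then have k: "k div n * n = k" by auto
    then have "w = w0 ^ (k div n)" using partial_char_unique[OF R kw] q by simp
    also have "\<dots> = z ^ (n * (k div n))" by (simp add: zn power_mult)
    finally show "z ^ k = w" using k by (simp add: mult.commute)
  qed
  then show ?thesis using \<open>z \<noteq> 1\<close> by blast
qed

text \<open>Zorn's lemma on graphs ordered by inclusion, starting from a partial character that is
  already nontrivial at \<open>g\<close>. A maximal graph has full domain, since a missing element
  could still be adjoined.\<close>

lemma dual_group_separates:
  fixes g :: "'g::ab_group_add"
  assumes "g \<noteq> 0" shows "\<exists>\<beta>\<in>dual_group. \<beta> g \<noteq> 1"
proof -
  have "partial_char {(0::'g, 1)}" by (auto simp: partial_char_def)
  then obtain R0 z where R0: "partial_char R0" "(g, z) \<in> R0" "z \<noteq> 1"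
    using partial_char_extend_nontrivial[of "{(0::'g, 1)}" g] assms by auto
  define P where "P = {R. partial_char R \<and> R0 \<subseteq> R}"
  have "\<exists>R\<in>P. \<forall>X\<in>P. R \<subseteq> X \<longrightarrow> X = R"
  proof (rule subset_Zorn_nonempty)
    show "P \<noteq> {}" using R0 by (auto simp: P_def)
    fix \<C> assume ne: "\<C> \<noteq> {}" and ch: "subset.chain P \<C>"
    have pc: "partial_char R" "R0 \<subseteq> R" if "R \<in> \<C>" for R
      using ch that unfolding subset_chain_def P_def by auto
    have "partial_char (\<Union>\<C>)"
      unfolding partial_char_def
    proof (intro conjI allI impI)
      show "(0, 1) \<in> \<Union>\<C>" using ne pc partial_charD(1) by blast
      show "w = 1" if "(0, w) \<in> \<Union>\<C>" for w using that pc partial_charD(5) by blast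
      fix h w assume hw: "(h, w) \<in> \<Union>\<C>"
      show "cmod w = 1" "(- h, cnj w) \<in> \<Union>\<C>" using hw pc partial_charD(2,3) by blast+
      fix h' w' assume hw': "(h', w') \<in> \<Union>\<C>"
      obtain R R' where R: "R \<in> \<C>" "(h, w) \<in> R" "R' \<in> \<C>" "(h', w') \<in> R'" using hw hw' by auto
      moreover have "R \<subseteq> R' \<or> R' \<subseteq> R" using ch R unfolding subset_chain_def by auto
      ultimately obtain R'' where "R'' \<in> \<C>" "(h, w) \<in> R''" "(h', w') \<in> R''" by auto
      then show "(h + h', w * w') \<in> \<Union>\<C>" using partial_charD(4)[OF pc(1)] by blast
    qed
    then show "\<Union>\<C> \<in> P" using ne pc(2) by (auto simp: P_def)
  qed
  then obtain R where R: "partial_char R" "R0 \<subseteq> R" and max: "\<And>X. partial_char X \<Longrightarrow> R \<subseteq> X \<Longrightarrow> X = R"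
    unfolding P_def by (auto dest: subset_trans)
  have dom: "\<exists>w. (h, w) \<in> R" for h
  proof (rule ccontr)
    assume "\<nexists>w. (h, w) \<in> R"
    then have "h \<notin> Domain R" by auto
    from partial_char_extend_nontrivial[OF R(1) this] show False
      using max \<open>h \<notin> Domain R\<close> by (metis Domain.DomainI)
  qed
  define \<beta> where "\<beta> h = (SOME w. (h, w) \<in> R)" for h
  have \<beta>: "(h, \<beta> h) \<in> R" for h unfolding \<beta>_def by (rule someI_ex[OF dom])
  have "\<beta> \<in> dual_group"
    unfolding dual_group_def
    using \<beta> partial_charD(2)[OF R(1)] partial_char_unique[OF R(1)] partial_charD(4)[OF R(1)] by blast
  moreover have "\<beta> g = z" using partial_char_unique[OF R(1) \<beta>] R0 R(2) by blast
  ultimately show ?thesis using R0(3) by blast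
qed

section \<open>Identities and compactness of the dual group\<close>

lemma dual_groupD:
  assumes "\<alpha> \<in> dual_group"
  shows "cmod (\<alpha> g) = 1" "\<alpha> (g + h) = \<alpha> g * \<alpha> h" "\<alpha> 0 = 1" "\<alpha> (- g) = cnj (\<alpha> g)"
    "\<alpha> g * cnj (\<alpha> g) = 1"
proof -
  show 1: "cmod (\<alpha> g) = 1" for g using assms by (auto simp: dual_group_def)
  show 2: "\<alpha> (g + h) = \<alpha> g * \<alpha> h" for g h using assms by (auto simp: dual_group_def)
  have "\<alpha> 0 = \<alpha> 0 * \<alpha> 0" using 2[of 0 0] by simp
  then show 3: "\<alpha> 0 = 1" using 1[of 0] by (metis mult_cancel_left1 norm_zero zero_neq_one)
  show 5: "\<alpha> g * cnj (\<alpha> g) = 1" by (rule mult_cnj_unit[OF 1])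
  have "\<alpha> g * \<alpha> (- g) = \<alpha> g * cnj (\<alpha> g)" unfolding 5 using 2[of g "- g"] 3 by simp
  then show "\<alpha> (- g) = cnj (\<alpha> g)" using 1[of g] by auto
qed

lemma dual_group_diff: "\<alpha> \<in> dual_group \<Longrightarrow> \<alpha> (g - h) = \<alpha> g * cnj (\<alpha> h)"
  using dual_groupD(2)[of \<alpha> g "- h"] dual_groupD(4)[of \<alpha> h] by simp

text \<open>Multiplicativity cuts out a closed subset of a product of circles, which is compact by
  Tychonoff.\<close>

lemma compact_dual_group: "compact (dual_group :: ('g::ab_group_add \<Rightarrow> complex) set)"
proof -
  have "compactin (product_topology (\<lambda>_. euclidean) UNIV) (PiE UNIV (\<lambda>_::'g. sphere (0::complex) 1))"
    unfolding compactin_PiE by auto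
  then have 1: "compact (PiE UNIV (\<lambda>_::'g. sphere (0::complex) 1))"
    unfolding euclidean_product_topology by simp
  have c: "continuous_on UNIV (\<lambda>\<alpha>::'g \<Rightarrow> complex. \<alpha> g)" for g by simp
  have cl: "closed {\<alpha>::'g \<Rightarrow> complex. \<forall>g h. \<alpha> (g + h) = \<alpha> g * \<alpha> h}"
    by (intro closed_Collect_all closed_Collect_eq continuous_intros c)
  have eq: "dual_group = PiE UNIV (\<lambda>_::'g. sphere (0::complex) 1) \<inter> {\<alpha>. \<forall>g h. \<alpha> (g + h) = \<alpha> g * \<alpha> h}"
    by (auto simp: dual_group_def)
  show ?thesis unfolding eq by (rule compact_Int_closed[OF 1 cl])
qed

subsection \<open>Trigonometric polynomials on the dual group\<close>

text \<open>Members are functions on all of \<open>'g \<Rightarrow> complex\<close>, but products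
  and conjugates of coordinate evaluations are again such evaluations only on
  \<open>dual_group\<close>. Closure under these operations is therefore stated up to agreement
  there.\<close>

inductive_set trig :: "(('g::ab_group_add \<Rightarrow> complex) \<Rightarrow> complex) set" where
  trig_char: "(\<lambda>\<alpha>. c * \<alpha> \<gamma>) \<in> trig"
| trig_add: "p \<in> trig \<Longrightarrow> q \<in> trig \<Longrightarrow> (\<lambda>\<alpha>. p \<alpha> + q \<alpha>) \<in> trig"

lemma trig_continuous: "p \<in> trig \<Longrightarrow> continuous_on S p"
  by (induction rule: trig.induct)
     (auto intro!: continuous_intros intro: continuous_on_subset[OF continuous_on_product_coordinates])

lemma trig_const: "\<exists>p\<in>trig. \<forall>\<alpha>\<in>dual_group. p \<alpha> = c"
  by (rule bexI[OF _ trig_char[of c 0]]) (auto simp: dual_groupD)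

lemma trig_mult_char:
  "p \<in> trig \<Longrightarrow> \<exists>q\<in>trig. \<forall>\<alpha>\<in>dual_group. q \<alpha> = c * \<alpha> \<gamma> * p \<alpha>"
proof (induction rule: trig.induct)
  case (trig_char d \<delta>)
  show ?case
    by (rule bexI[OF _ trig.trig_char[of "c * d" "\<gamma> + \<delta>"]]) (auto simp: dual_groupD)
next
  case (trig_add p q)
  then obtain p' q' where "p' \<in> trig" "\<forall>\<alpha>\<in>dual_group. p' \<alpha> = c * \<alpha> \<gamma> * p \<alpha>"
    "q' \<in> trig" "\<forall>\<alpha>\<in>dual_group. q' \<alpha> = c * \<alpha> \<gamma> * q \<alpha>" by blast
  then show ?case
    by (intro bexI[OF _ trig.trig_add[of p' q']]) (auto simp: algebra_simps)
qed

lemma trig_mult: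
  assumes "p \<in> trig" "q \<in> trig" shows "\<exists>r\<in>trig. \<forall>\<alpha>\<in>dual_group. r \<alpha> = p \<alpha> * q \<alpha>"
  using assms(1)
proof (induction rule: trig.induct)
  case (trig_char c \<gamma>)
  then show ?case using trig_mult_char[OF assms(2)] by simp
next
  case (trig_add p p')
  then obtain r r' where "r \<in> trig" "\<forall>\<alpha>\<in>dual_group. r \<alpha> = p \<alpha> * q \<alpha>"
    "r' \<in> trig" "\<forall>\<alpha>\<in>dual_group. r' \<alpha> = p' \<alpha> * q \<alpha>" by blast
  then show ?case
    by (intro bexI[OF _ trig.trig_add[of r r']]) (auto simp: algebra_simps)
qed

lemma trig_cnj:
  assumes "p \<in> trig" shows "\<exists>r\<in>trig. \<forall>\<alpha>\<in>dual_group. r \<alpha> = cnj (p \<alpha>)"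
  using assms
proof (induction rule: trig.induct)
  case (trig_char c \<gamma>)
  show ?case by (rule bexI[OF _ trig.trig_char[of "cnj c" "- \<gamma>"]]) (auto simp: dual_groupD)
next
  case (trig_add p q)
  then obtain r r' where "r \<in> trig" "\<forall>\<alpha>\<in>dual_group. r \<alpha> = cnj (p \<alpha>)"
    "r' \<in> trig" "\<forall>\<alpha>\<in>dual_group. r' \<alpha> = cnj (q \<alpha>)" by blast
  then show ?case by (intro bexI[OF _ trig.trig_add[of r r']]) auto
qed

text \<open>The real Stone-Weierstrass theorem is applied to the real functions that agree on
  \<open>dual_group\<close> with a trigonometric polynomial. Distinct characters differ in the real
  or the imaginary part of a coordinate, and \<open>Re (- \<i> * z)\<close> is
  \<open>Im z\<close>.\<close>

lemma trig_dense:
  fixes f :: "('g::{ab_group_add, countable} \<Rightarrow> complex) \<Rightarrow> real"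
  assumes f: "continuous_on dual_group f" and e: "0 < e"
  shows "\<exists>p\<in>trig. \<forall>\<alpha>\<in>dual_group. cmod (of_real (f \<alpha>) - p \<alpha>) < e"
proof -
  define R :: "(('g \<Rightarrow> complex) \<Rightarrow> real) set" where
    "R = {f. \<exists>p\<in>trig. \<forall>\<alpha>\<in>dual_group. p \<alpha> = of_real (f \<alpha>)}"
  have reR: "(\<lambda>\<alpha>. Re (c * \<alpha> \<gamma>)) \<in> R" for c \<gamma>
  proof -
    \<comment> \<open>The conjugate of a character value is its value at \<open>- \<gamma>\<close>,
      so a real part is half the sum of two monomials.\<close>
    have "of_real (Re (c * \<alpha> \<gamma>)) = (c/2) * \<alpha> \<gamma> + (cnj c / 2) * \<alpha> (- \<gamma>)" if "\<alpha> \<in> dual_group" for \<alpha>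
      using complex_add_cnj[of "c * \<alpha> \<gamma>"] by (simp add: dual_groupD[OF that] field_simps)
    then show ?thesis unfolding R_def
      by (intro CollectI bexI[OF _ trig_add[OF trig_char[of "c/2" \<gamma>] trig_char[of "cnj c / 2" "- \<gamma>"]]]) auto
  qed
  interpret function_ring_on R dual_group
  proof
    show "compact (dual_group :: ('g \<Rightarrow> complex) set)" by (rule compact_dual_group)
    fix f g assume f: "f \<in> R"
    then obtain p where p: "p \<in> trig" "\<And>\<alpha>. \<alpha> \<in> dual_group \<Longrightarrow> p \<alpha> = of_real (f \<alpha>)" by (auto simp: R_def)
    have "continuous_on dual_group (\<lambda>\<alpha>. Re (p \<alpha>))"
      by (intro continuous_intros trig_continuous p)
    then show "continuous_on dual_group f"
      by (rule continuous_on_eq) (simp add: p)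
    assume g: "g \<in> R"
    then obtain q where q: "q \<in> trig" "\<And>\<alpha>. \<alpha> \<in> dual_group \<Longrightarrow> q \<alpha> = of_real (g \<alpha>)" by (auto simp: R_def)
    show "(\<lambda>x. f x + g x) \<in> R"
      unfolding R_def using p q by (auto intro!: bexI[OF _ trig_add[OF p(1) q(1)]])
    show "(\<lambda>x. f x * g x) \<in> R"
      unfolding R_def using trig_mult[OF p(1) q(1)] p q by auto
  next
    show "(\<lambda>_. c) \<in> R" for c unfolding R_def using trig_const[of "of_real c"] by auto
    fix \<alpha> \<beta> :: "'g \<Rightarrow> complex" assume "\<alpha> \<in> dual_group" "\<beta> \<in> dual_group" "\<alpha> \<noteq> \<beta>"
    then obtain \<gamma> where "\<alpha> \<gamma> \<noteq> \<beta> \<gamma>" by auto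
    then have "Re (1 * \<alpha> \<gamma>) \<noteq> Re (1 * \<beta> \<gamma>) \<or> Re (- \<i> * \<alpha> \<gamma>) \<noteq> Re (- \<i> * \<beta> \<gamma>)"
      by (auto simp: complex_eq_iff)
    then show "\<exists>f\<in>R. f \<alpha> \<noteq> f \<beta>" 
      by (elim disjE) (rule bexI[OF _ reR], assumption)+
  qed
  obtain g where g: "g \<in> R" "\<forall>x\<in>dual_group. \<bar>f x - g x\<bar> < e"
    using Stone_Weierstrass_basic[OF f e] by auto
  then obtain p where p: "p \<in> trig" "\<And>\<alpha>. \<alpha> \<in> dual_group \<Longrightarrow> p \<alpha> = of_real (g \<alpha>)" by (auto simp: R_def)
  then show ?thesis using g(2)
    by (intro bexI[OF _ p(1)]) (auto simp: p(2) simp flip: of_real_diff)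
qed

subsection \<open>Haar measure and Fourier sums\<close>

locale haar_dual =
  fixes m :: "('g::{ab_group_add, countable} \<Rightarrow> complex) measure"
  assumes haar: "normalized_haar_dual m"
begin

lemma sets_m: "sets m = sets (restrict_space borel dual_group)"
  using haar by (simp add: normalized_haar_dual_def)

lemma space_m [simp]: "space m = dual_group"
  using sets_eq_imp_space_eq[OF sets_m] by (simp add: space_restrict_space)

lemma emeasure_dual [simp]: "emeasure m dual_group = 1"
  using haar by (simp add: normalized_haar_dual_def)

sublocale finite_measure m
  by (rule finite_measureI) simp

lemma continuous_measurable_m: "continuous_on dual_group f \<Longrightarrow> f \<in> borel_measurable m"
  unfolding measurable_cong_sets[OF sets_m refl]
  by (rule borel_measurable_continuous_on_restrict)

lemma trig_measurable: "p \<in> trig \<Longrightarrow> p \<in> borel_measurable m"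
  by (intro continuous_measurable_m trig_continuous)

lemma eval_measurable [measurable]: "(\<lambda>\<alpha>. \<alpha> \<gamma>) \<in> borel_measurable m"
  using trig_measurable[OF trig_char[of 1 \<gamma>]] by simp

text \<open>Invariance is given for direct images, whereas a push-forward uses preimages; the
  preimage under multiplication by \<open>\<beta>\<close> is the image under multiplication by its
  conjugate, again a character.\<close>

lemma distr_translate:
  assumes \<beta>: "\<beta> \<in> dual_group"
  shows "(\<lambda>\<alpha> \<gamma>. \<beta> \<gamma> * \<alpha> \<gamma>) \<in> measurable m m" "distr m m (\<lambda>\<alpha> \<gamma>. \<beta> \<gamma> * \<alpha> \<gamma>) = m"
proof -
  let ?T = "\<lambda>\<beta> \<alpha> (\<gamma>::'g). (\<beta> \<gamma> * \<alpha> \<gamma> :: complex)"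
  have mem: "?T \<beta> \<alpha> \<in> dual_group" if "\<alpha> \<in> dual_group" "\<beta> \<in> dual_group" for \<alpha> \<beta>
    using that by (auto simp: dual_group_def norm_mult)
  have cont: "continuous_on dual_group (?T \<beta>)"
    by (intro continuous_on_coordinatewise_then_product continuous_intros
        continuous_on_subset[OF continuous_on_product_coordinates]) auto
  show T: "?T \<beta> \<in> measurable m m"
    unfolding measurable_cong_sets[OF sets_m sets_m]
    by (rule measurable_restrict_space2) (use mem[OF _ \<beta>] borel_measurable_continuous_on_restrict[OF cont] in \<open>auto simp: space_restrict_space\<close>)
  have cb: "(\<lambda>\<gamma>. cnj (\<beta> \<gamma>)) \<in> dual_group" using \<beta> by (auto simp: dual_group_def)
  show "distr m m (?T \<beta>) = m"
  proof (rule measure_eqI)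
    fix E assume "E \<in> sets (distr m m (?T \<beta>))"
    then have E: "E \<in> sets m" by simp
    then have Es: "E \<subseteq> dual_group" using sets.sets_into_space[of E m] by simp
    have "?T \<beta> -` E \<inter> dual_group = ?T (\<lambda>\<gamma>. cnj (\<beta> \<gamma>)) ` E"
    proof (intro equalityI subsetI)
      fix \<alpha> assume \<alpha>: "\<alpha> \<in> ?T \<beta> -` E \<inter> dual_group"
      have eq: "\<alpha> = ?T (\<lambda>\<gamma>. cnj (\<beta> \<gamma>)) (?T \<beta> \<alpha>)"
        using dual_groupD(5)[OF \<beta>] by (simp add: mult.commute[of "cnj _"] flip: mult.assoc)
      show "\<alpha> \<in> ?T (\<lambda>\<gamma>. cnj (\<beta> \<gamma>)) ` E"
        by (rule image_eqI[where x = "?T \<beta> \<alpha>"], rule eq) (use \<alpha> in auto)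
    next
      fix \<alpha> assume "\<alpha> \<in> ?T (\<lambda>\<gamma>. cnj (\<beta> \<gamma>)) ` E"
      then obtain \<alpha>' where \<alpha>': "\<alpha>' \<in> E" "\<alpha> = ?T (\<lambda>\<gamma>. cnj (\<beta> \<gamma>)) \<alpha>'" by blast
      have "?T \<beta> \<alpha> = \<alpha>'"
        using dual_groupD(5)[OF \<beta>] by (simp add: \<alpha>' flip: mult.assoc)
      then show "\<alpha> \<in> ?T \<beta> -` E \<inter> dual_group" using \<alpha>' Es mem[OF _ cb] by auto
    qed
    then show "emeasure (distr m m (?T \<beta>)) E = emeasure m E"
      using haar cb E by (simp add: emeasure_distr[OF T] normalized_haar_dual_def)
  qed simp
qed

lemma integrable_bounded_m:
  fixes f :: "_ \<Rightarrow> 'b::{banach, second_countable_topology}"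
  assumes "f \<in> borel_measurable m" "\<And>\<alpha>. \<alpha> \<in> dual_group \<Longrightarrow> norm (f \<alpha>) \<le> K"
  shows "integrable m f"
  using assms by (intro integrable_const_bound[of f K]) auto

text \<open>For nonzero \<open>\<gamma>\<close> some character has
  \<open>\<beta> \<gamma> \<noteq> 1\<close>. Translation by it preserves the integral and also
  multiplies it by \<open>\<beta> \<gamma>\<close>, so the integral vanishes.\<close>

lemma integral_char: "(\<integral>\<alpha>. \<alpha> \<gamma> \<partial>m) = (if \<gamma> = 0 then 1 else 0)"
proof (cases "\<gamma> = 0")
  case True
  have "(\<integral>\<alpha>. \<alpha> \<gamma> \<partial>m) = (\<integral>\<alpha>. 1 \<partial>m)"
    using True by (intro Bochner_Integration.integral_cong) (auto simp: dual_groupD)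
  then show ?thesis using True by (simp add: measure_def)
next
  case False
  obtain \<beta> where \<beta>: "\<beta> \<in> dual_group" "\<beta> \<gamma> \<noteq> 1" using dual_group_separates[OF False] by auto
  have "(\<integral>\<alpha>. \<alpha> \<gamma> \<partial>m) = (\<integral>\<alpha>. \<alpha> \<gamma> \<partial>distr m m (\<lambda>\<alpha> \<gamma>. \<beta> \<gamma> * \<alpha> \<gamma>))"
    by (simp add: distr_translate[OF \<beta>(1)])
  also have "\<dots> = (\<integral>\<alpha>. \<beta> \<gamma> * \<alpha> \<gamma> \<partial>m)"
    by (subst integral_distr[OF distr_translate(1)[OF \<beta>(1)]]) auto
  also have "\<dots> = \<beta> \<gamma> * (\<integral>\<alpha>. \<alpha> \<gamma> \<partial>m)" by simp
  finally show ?thesis using \<beta>(2) False by simp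
qed

lemma char_L2: "(\<lambda>\<alpha>. \<alpha> \<gamma>) \<in> L2 m"
  unfolding L2_def
  by (auto intro!: integrable_bounded_m[of _ 1] simp: dual_groupD)

lemma L2_norm_char: "L2_norm m (\<lambda>\<alpha>. \<alpha> \<gamma>) = 1"
proof -
  have "(\<integral>\<alpha>. (cmod (\<alpha> \<gamma>))\<^sup>2 \<partial>m) = (\<integral>\<alpha>. 1 \<partial>m)"
    by (intro Bochner_Integration.integral_cong) (auto simp: dual_groupD)
  then show ?thesis by (simp add: L2_norm_def measure_def)
qed

text \<open>The sign follows \<open>is_fourier_transform\<close>, so a coefficient is recovered by
  integrating against \<open>\<alpha> \<gamma>\<close> without conjugation.\<close>

definition fsum :: "('g \<Rightarrow> complex) \<Rightarrow> 'g set \<Rightarrow> ('g \<Rightarrow> complex) \<Rightarrow> complex" where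
  "fsum a F \<alpha> = (\<Sum>\<gamma>\<in>F. a \<gamma> * \<alpha> (- \<gamma>))"

lemma fsum_L2: "fsum a F \<in> L2 m"
  unfolding fsum_def[abs_def] by (intro L2_sum L2_scale char_L2)

lemma integral_fsum_char:
  assumes "finite F"
  shows "(\<integral>\<alpha>. fsum a F \<alpha> * \<alpha> \<gamma> \<partial>m) = (if \<gamma> \<in> F then a \<gamma> else 0)"
proof -
  have i: "integrable m (\<lambda>\<alpha>. \<alpha> \<gamma>)" for \<gamma>
    by (rule integrable_bounded_m[of _ 1]) (auto simp: dual_groupD)
  have "(\<integral>\<alpha>. fsum a F \<alpha> * \<alpha> \<gamma> \<partial>m) = (\<integral>\<alpha>. (\<Sum>\<delta>\<in>F. a \<delta> * \<alpha> (\<gamma> - \<delta>)) \<partial>m)"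
    unfolding fsum_def sum_distrib_right
    by (intro Bochner_Integration.integral_cong sum.cong) (auto simp: dual_groupD dual_group_diff)
  also have "\<dots> = (\<Sum>\<delta>\<in>F. a \<delta> * (\<integral>\<alpha>. \<alpha> (\<gamma> - \<delta>) \<partial>m))"
    by (subst Bochner_Integration.integral_sum) (auto intro!: integrable_mult_right i)
  also have "\<dots> = (\<Sum>\<delta>\<in>F. if \<gamma> = \<delta> then a \<delta> else 0)"
    unfolding integral_char by (intro sum.cong) auto
  also have "\<dots> = (if \<gamma> \<in> F then a \<gamma> else 0)" using assms by simp
  finally show ?thesis .
qed

lemma L2_integrable_char:
  assumes h: "h \<in> L2 m" shows "integrable m (\<lambda>\<alpha>. h \<alpha> * \<alpha> \<gamma>)"
proof -
  have "integrable m (\<lambda>\<alpha>. h \<alpha> * cnj (\<alpha> (- \<gamma>)))" by (rule L2_integrable_inner[OF h char_L2])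
  then show ?thesis
    by (rule Bochner_Integration.integrable_cong[OF refl, THEN iffD1, rotated]) (auto simp: dual_groupD)
qed

lemma L2_integrable: "h \<in> L2 m \<Longrightarrow> integrable m h"
  by (rule Bochner_Integration.integrable_cong[OF refl, THEN iffD1, rotated, OF L2_integrable_char[of h 0]])
     (auto simp: dual_groupD)

lemma inner_fsum:
  assumes h: "h \<in> L2 m"
  shows "L2_inner m h (fsum a F) = (\<Sum>\<gamma>\<in>F. cnj (a \<gamma>) * (\<integral>\<alpha>. h \<alpha> * \<alpha> \<gamma> \<partial>m))"
proof -
  note i = L2_integrable_char[OF h]
  have "L2_inner m h (fsum a F) = (\<integral>\<alpha>. (\<Sum>\<gamma>\<in>F. cnj (a \<gamma>) * (h \<alpha> * \<alpha> \<gamma>)) \<partial>m)"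
    unfolding L2_inner_def fsum_def cnj_sum sum_distrib_left
    by (intro Bochner_Integration.integral_cong sum.cong) (auto simp: dual_groupD)
  also have "\<dots> = (\<Sum>\<gamma>\<in>F. cnj (a \<gamma>) * (\<integral>\<alpha>. h \<alpha> * \<alpha> \<gamma> \<partial>m))"
    by (subst Bochner_Integration.integral_sum) (auto intro!: integrable_mult_right i)
  finally show ?thesis .
qed

lemma norm_fsum:
  assumes "finite F"
  shows "(L2_norm m (fsum a F))\<^sup>2 = (\<Sum>\<gamma>\<in>F. (cmod (a \<gamma>))\<^sup>2)"
proof -
  have "complex_of_real ((L2_norm m (fsum a F))\<^sup>2) = (\<Sum>\<gamma>\<in>F. cnj (a \<gamma>) * a \<gamma>)"
    unfolding L2_inner_self[OF fsum_L2, symmetric] inner_fsum[OF fsum_L2] integral_fsum_char[OF assms]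
    by (intro sum.cong) auto
  also have "\<dots> = of_real (\<Sum>\<gamma>\<in>F. (cmod (a \<gamma>))\<^sup>2)"
    by (simp add: complex_norm_square mult.commute flip: of_real_power)
  finally show ?thesis by (simp only: of_real_eq_iff)
qed

text \<open>Testing \<open>h\<close> against the partial sum of its own coefficients gives
  \<open>s \<le> L2_norm m h * sqrt s\<close>, where \<open>s\<close> is the sum on the left;
  dividing by \<open>sqrt s\<close> finishes.\<close>

lemma bessel:
  assumes h: "h \<in> L2 m" and F: "finite F"
  shows "(\<Sum>\<gamma>\<in>F. (cmod (\<integral>\<alpha>. h \<alpha> * \<alpha> \<gamma> \<partial>m))\<^sup>2) \<le> (L2_norm m h)\<^sup>2"
proof -
  define c where "c \<gamma> = (\<integral>\<alpha>. h \<alpha> * \<alpha> \<gamma> \<partial>m)" for \<gamma>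
  define s where "s = (\<Sum>\<gamma>\<in>F. (cmod (c \<gamma>))\<^sup>2)"
  have "L2_inner m h (fsum c F) = (\<Sum>\<gamma>\<in>F. cnj (c \<gamma>) * c \<gamma>)"
    unfolding inner_fsum[OF h] c_def ..
  also have "\<dots> = of_real s"
    by (simp add: s_def complex_norm_square mult.commute flip: of_real_power)
  finally have "cmod (L2_inner m h (fsum c F)) = \<bar>s\<bar>" by (simp only: norm_of_real)
  moreover have "0 \<le> s" by (simp add: s_def sum_nonneg)
  ultimately have "s = cmod (L2_inner m h (fsum c F))" by simp
  also have "\<dots> \<le> L2_norm m h * sqrt s"
    using L2_inner_le[OF h fsum_L2, of c F] norm_fsum[OF F, of c]
    by (metis L2_norm_nonneg real_sqrt_unique s_def)
  finally have 1: "s \<le> L2_norm m h * sqrt s" .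
  have "0 \<le> s" by (simp add: s_def sum_nonneg)
  then have "sqrt s \<le> L2_norm m h"
  proof (cases "s = 0")
    case False
    then have "sqrt s * sqrt s \<le> L2_norm m h * sqrt s" "0 < sqrt s" using 1 \<open>0 \<le> s\<close> by auto
    then show ?thesis by (rule mult_right_le_imp_le)
  qed simp
  then have "s \<le> (L2_norm m h)\<^sup>2" using \<open>0 \<le> s\<close> by (simp add: sqrt_le_D)
  then show ?thesis by (simp add: s_def c_def)
qed

subsection \<open>Uniqueness of Fourier coefficients\<close>

text \<open>The available weights are squared moduli of trigonometric polynomials, so the uniform
  approximation is applied to the square root of \<open>k\<close>. Finiteness of the two integrals
  supplies the dominating functions for the limit.\<close>

lemma trig_domination_continuous:
  assumes [measurable]: "u \<in> borel_measurable m" "v \<in> borel_measurable m"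
    and fu: "(\<integral>\<^sup>+\<alpha>. u \<alpha> \<partial>m) < \<infinity>" and fv: "(\<integral>\<^sup>+\<alpha>. v \<alpha> \<partial>m) < \<infinity>"
    and dom: "\<And>p. p \<in> trig \<Longrightarrow>
      (\<integral>\<^sup>+\<alpha>. ennreal ((cmod (p \<alpha>))\<^sup>2) * u \<alpha> \<partial>m) \<le> (\<integral>\<^sup>+\<alpha>. ennreal ((cmod (p \<alpha>))\<^sup>2) * v \<alpha> \<partial>m)"
    and k: "continuous_on dual_group k" and k0: "\<And>\<alpha>. 0 \<le> k \<alpha>"
  shows "(\<integral>\<^sup>+\<alpha>. ennreal (k \<alpha>) * u \<alpha> \<partial>m) \<le> (\<integral>\<^sup>+\<alpha>. ennreal (k \<alpha>) * v \<alpha> \<partial>m)"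
proof -
  have ck: "continuous_on dual_group (\<lambda>\<alpha>. sqrt (k \<alpha>))"
    by (intro continuous_intros k)
  have [measurable]: "k \<in> borel_measurable m" by (rule continuous_measurable_m[OF k])
  obtain K where K: "\<And>\<alpha>. \<alpha> \<in> dual_group \<Longrightarrow> sqrt (k \<alpha>) \<le> K"
    using compact_imp_bounded[OF compact_continuous_image[OF ck compact_dual_group]]
    unfolding bounded_iff by (force simp: abs_le_iff)
  have "\<exists>p\<in>trig. \<forall>\<alpha>\<in>dual_group. cmod (of_real (sqrt (k \<alpha>)) - p \<alpha>) < 1 / Suc n" for n
    by (rule trig_dense[OF ck]) auto
  then obtain p where p: "\<And>n. p n \<in> trig"
    "\<And>n \<alpha>. \<alpha> \<in> dual_group \<Longrightarrow> cmod (of_real (sqrt (k \<alpha>)) - p n \<alpha>) < 1 / Suc n"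
    by metis
  have [measurable]: "p n \<in> borel_measurable m" for n by (rule trig_measurable[OF p(1)])
  have tend: "(\<lambda>n. (cmod (p n \<alpha>))\<^sup>2) \<longlonglongrightarrow> k \<alpha>" if "\<alpha> \<in> dual_group" for \<alpha>
  proof -
    have "(\<lambda>n. of_real (sqrt (k \<alpha>)) - p n \<alpha>) \<longlonglongrightarrow> 0"
      using p(2)[OF that] by (intro Lim_null_comparison[OF _ LIMSEQ_inverse_real_of_nat])
        (auto intro!: always_eventually less_imp_le simp: inverse_eq_divide)
    then have "(\<lambda>n. of_real (sqrt (k \<alpha>)) - (of_real (sqrt (k \<alpha>)) - p n \<alpha>)) \<longlonglongrightarrow> of_real (sqrt (k \<alpha>)) - 0"
      by (intro tendsto_intros)
    then have "(\<lambda>n. (cmod (p n \<alpha>))\<^sup>2) \<longlonglongrightarrow> (cmod (of_real (sqrt (k \<alpha>))))\<^sup>2"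
      by (intro tendsto_intros) simp
    then show ?thesis using k0 by simp
  qed
  \<comment> \<open>\<open>K\<close> bounds the square root of \<open>k\<close>, and the
    approximation error is at most 1.\<close>
  have bnd: "(cmod (p n \<alpha>))\<^sup>2 \<le> (K + 1)\<^sup>2" if "\<alpha> \<in> dual_group" for n \<alpha>
  proof (rule power_mono)
    have "cmod (p n \<alpha>) \<le> cmod (of_real (sqrt (k \<alpha>)) - p n \<alpha>) + cmod (of_real (sqrt (k \<alpha>)))"
      by (metis norm_minus_commute norm_triangle_sub add.commute)
    also have "cmod (of_real (sqrt (k \<alpha>)) - p n \<alpha>) \<le> 1"
      by (rule order_trans[OF less_imp_le[OF p(2)[OF that, of n]]]) simp
    finally show "cmod (p n \<alpha>) \<le> K + 1" using K[OF that] k0[of \<alpha>] by simp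
  qed simp
  have lim: "(\<lambda>n. \<integral>\<^sup>+\<alpha>. ennreal ((cmod (p n \<alpha>))\<^sup>2) * w \<alpha> \<partial>m) \<longlonglongrightarrow> (\<integral>\<^sup>+\<alpha>. ennreal (k \<alpha>) * w \<alpha> \<partial>m)"
    if [measurable]: "w \<in> borel_measurable m" and fw: "(\<integral>\<^sup>+\<alpha>. w \<alpha> \<partial>m) < \<infinity>" for w
  proof (rule nn_integral_dominated_convergence[where w = "\<lambda>\<alpha>. ennreal ((K + 1)\<^sup>2) * w \<alpha>"])
    show "AE \<alpha> in m. ennreal ((cmod (p n \<alpha>))\<^sup>2) * w \<alpha> \<le> ennreal ((K + 1)\<^sup>2) * w \<alpha>" for n
      using bnd by (intro AE_I2 mult_right_mono ennreal_leI) auto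
    show "(\<integral>\<^sup>+\<alpha>. ennreal ((K + 1)\<^sup>2) * w \<alpha> \<partial>m) < \<infinity>"
      using fw by (simp add: nn_integral_cmult ennreal_mult_less_top)
    have "AE \<alpha> in m. w \<alpha> \<noteq> \<infinity>" using fw by (intro nn_integral_PInf_AE) auto
    then show "AE \<alpha> in m. (\<lambda>n. ennreal ((cmod (p n \<alpha>))\<^sup>2) * w \<alpha>) \<longlonglongrightarrow> ennreal (k \<alpha>) * w \<alpha>"
    proof (rule AE_mp, intro AE_I2 impI)
      fix \<alpha> assume "\<alpha> \<in> space m" "w \<alpha> \<noteq> \<infinity>"
      then show "(\<lambda>n. ennreal ((cmod (p n \<alpha>))\<^sup>2) * w \<alpha>) \<longlonglongrightarrow> ennreal (k \<alpha>) * w \<alpha>"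
        unfolding mult.commute[of _ "w \<alpha>"]
        by (intro ennreal_tendsto_cmult tendsto_ennrealI tend) (auto simp: less_top)
    qed
  qed auto
  show ?thesis
    by (rule LIMSEQ_le[OF lim[OF _ fu] lim[OF _ fv]]) (use dom p(1) in auto)
qed

text \<open>Truncated multiples of the distance to \<open>F\<close> give continuous weights between
  0 and 1 that converge to the indicator, because a point at distance 0 from a nonempty closed set
  belongs to it.\<close>

lemma trig_domination_closed:
  assumes [measurable]: "u \<in> borel_measurable m" "v \<in> borel_measurable m"
    and fu: "(\<integral>\<^sup>+\<alpha>. u \<alpha> \<partial>m) < \<infinity>" and fv: "(\<integral>\<^sup>+\<alpha>. v \<alpha> \<partial>m) < \<infinity>"
    and dom: "\<And>p. p \<in> trig \<Longrightarrow>
      (\<integral>\<^sup>+\<alpha>. ennreal ((cmod (p \<alpha>))\<^sup>2) * u \<alpha> \<partial>m) \<le> (\<integral>\<^sup>+\<alpha>. ennreal ((cmod (p \<alpha>))\<^sup>2) * v \<alpha> \<partial>m)"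
    and F: "closed F"
  shows "(\<integral>\<^sup>+\<alpha>. indicator F \<alpha> * u \<alpha> \<partial>m) \<le> (\<integral>\<^sup>+\<alpha>. indicator F \<alpha> * v \<alpha> \<partial>m)"
\<comment> \<open>\<open>infdist\<close> to the empty set is 0, so the cutoffs would converge to 1
  instead of the indicator; this case is trivial by itself.\<close>
proof (cases "F = {}")
  case False
  define k where "k n \<alpha> = max 0 (1 - real n * infdist \<alpha> F)" for n and \<alpha> :: "'g \<Rightarrow> complex"
  have ck: "continuous_on dual_group (k n)" for n
    unfolding k_def[abs_def] by (intro continuous_intros)
  have [measurable]: "k n \<in> borel_measurable m" for n by (rule continuous_measurable_m[OF ck])
  have [measurable]: "Measurable.pred m (\<lambda>\<alpha>. \<alpha> \<in> F)"
  proof -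
    have "F \<inter> dual_group \<in> sets m"
      using F unfolding sets_m by (auto simp: sets_restrict_space)
    then show ?thesis by (simp add: pred_def Int_commute Collect_conj_eq[symmetric] Int_def conj_commute)
  qed
  have tend: "(\<lambda>n. k n \<alpha>) \<longlonglongrightarrow> indicator F \<alpha>" for \<alpha>
  proof (cases "\<alpha> \<in> F")
    case True
    then show ?thesis by (simp add: k_def)
  next
    case False
    then have pos: "0 < infdist \<alpha> F" using F \<open>F \<noteq> {}\<close> by (simp add: infdist_pos_not_in_closed)
    obtain N where N: "1 < real N * infdist \<alpha> F" using reals_Archimedean3[OF pos] by auto
    have "k n \<alpha> = 0" if "N \<le> n" for n
    proof -
      have "real N * infdist \<alpha> F \<le> real n * infdist \<alpha> F" using that pos by (intro mult_right_mono) auto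
      then show ?thesis using N by (simp add: k_def)
    qed
    then show ?thesis using False
      by (intro tendsto_eventually) (auto simp: eventually_sequentially)
  qed
  have lim: "(\<lambda>n. \<integral>\<^sup>+\<alpha>. ennreal (k n \<alpha>) * w \<alpha> \<partial>m) \<longlonglongrightarrow> (\<integral>\<^sup>+\<alpha>. indicator F \<alpha> * w \<alpha> \<partial>m)"
    if [measurable]: "w \<in> borel_measurable m" and fw: "(\<integral>\<^sup>+\<alpha>. w \<alpha> \<partial>m) < \<infinity>" for w
  proof (rule nn_integral_dominated_convergence[where w = w])
    have "k n \<alpha> \<le> 1" for n \<alpha> by (simp add: k_def infdist_nonneg)
    then have "ennreal (k n \<alpha>) * w \<alpha> \<le> 1 * w \<alpha>" for n \<alpha>
      by (intro mult_right_mono) auto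
    then show "AE \<alpha> in m. ennreal (k n \<alpha>) * w \<alpha> \<le> w \<alpha>" for n by simp
    have "AE \<alpha> in m. w \<alpha> \<noteq> \<infinity>" using fw by (intro nn_integral_PInf_AE) auto
    then show "AE \<alpha> in m. (\<lambda>n. ennreal (k n \<alpha>) * w \<alpha>) \<longlonglongrightarrow> indicator F \<alpha> * w \<alpha>"
    proof (rule AE_mp, intro AE_I2 impI)
      fix \<alpha> assume "\<alpha> \<in> space m" "w \<alpha> \<noteq> \<infinity>"
      then show "(\<lambda>n. ennreal (k n \<alpha>) * w \<alpha>) \<longlonglongrightarrow> indicator F \<alpha> * w \<alpha>"
        unfolding mult.commute[of _ "w \<alpha>"] ennreal_indicator[symmetric]
        by (intro ennreal_tendsto_cmult tendsto_ennrealI tend) (auto simp: less_top)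
    qed
  qed (use fw in auto)
  have "(\<integral>\<^sup>+\<alpha>. ennreal (k n \<alpha>) * u \<alpha> \<partial>m) \<le> (\<integral>\<^sup>+\<alpha>. ennreal (k n \<alpha>) * v \<alpha> \<partial>m)" for n
    by (rule trig_domination_continuous[OF _ _ fu fv dom ck]) (auto simp: k_def)
  then show ?thesis
    by (intro LIMSEQ_le[OF lim[OF _ fu] lim[OF _ fv]]) auto
qed simp

text \<open>Inner regularity passes from closed sets to the Borel set on which the inequality fails.\<close>

lemma trig_domination:
  assumes [measurable]: "u \<in> borel_measurable m" "v \<in> borel_measurable m"
    and fu: "(\<integral>\<^sup>+\<alpha>. u \<alpha> \<partial>m) < \<infinity>" and fv: "(\<integral>\<^sup>+\<alpha>. v \<alpha> \<partial>m) < \<infinity>"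
    and dom: "\<And>p. p \<in> trig \<Longrightarrow>
      (\<integral>\<^sup>+\<alpha>. ennreal ((cmod (p \<alpha>))\<^sup>2) * u \<alpha> \<partial>m) \<le> (\<integral>\<^sup>+\<alpha>. ennreal ((cmod (p \<alpha>))\<^sup>2) * v \<alpha> \<partial>m)"
  shows "AE \<alpha> in m. u \<alpha> \<le> v \<alpha>"
proof -
  have "{\<alpha>\<in>space m. v \<alpha> < u \<alpha>} \<in> sets m" by measurable
  then obtain E where E: "E \<in> sets borel" "{\<alpha>\<in>space m. v \<alpha> < u \<alpha>} = E \<inter> dual_group"
    unfolding sets_m by (auto simp: sets_restrict_space Int_commute)
  have idm: "(\<lambda>\<alpha>. \<alpha>) \<in> measurable m borel"
    unfolding measurable_cong_sets[OF sets_m refl] by (rule measurable_restrict_space1) simp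
  \<comment> \<open>The measure with density \<open>u\<close>, moved to the Borel sets of the whole
    function space, where every finite measure is inner regular with respect to compact
    sets.\<close>
  define K where "K = distr (density m u) borel (\<lambda>\<alpha>. \<alpha>)"
  have K: "emeasure K S = (\<integral>\<^sup>+\<alpha>. indicator S \<alpha> * u \<alpha> \<partial>m)" if S: "S \<in> sets borel" for S
  proof -
    have "S \<inter> dual_group \<in> sets m" using S unfolding sets_m by (auto simp: sets_restrict_space)
    then have "emeasure K S = (\<integral>\<^sup>+\<alpha>. u \<alpha> * indicator (S \<inter> dual_group) \<alpha> \<partial>m)"
      unfolding K_def using S idm by (subst emeasure_distr) (auto simp: emeasure_density)
    also have "\<dots> = (\<integral>\<^sup>+\<alpha>. indicator S \<alpha> * u \<alpha> \<partial>m)"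
      by (intro nn_integral_cong) (auto simp: indicator_def)
    finally show ?thesis .
  qed
  have fin: "emeasure K (space K) \<noteq> \<infinity>"
    using K[of UNIV] fu by (simp add: K_def)
  have "emeasure K E = (SUP C\<in>{C. C \<subseteq> E \<and> compact C}. emeasure K C)"
    by (rule inner_regular) (use fin E in \<open>auto simp: K_def\<close>)
  also have "\<dots> \<le> (\<integral>\<^sup>+\<alpha>. indicator E \<alpha> * v \<alpha> \<partial>m)"
  proof (rule SUP_least)
    fix C assume C: "C \<in> {C. C \<subseteq> E \<and> compact C}"
    then have cl: "closed C" by (simp add: compact_imp_closed)
    have "emeasure K C \<le> (\<integral>\<^sup>+\<alpha>. indicator C \<alpha> * v \<alpha> \<partial>m)"
      unfolding K[OF borel_closed[OF cl]]
      by (rule trig_domination_closed[OF _ _ fu fv dom cl]) auto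
    also have "\<dots> \<le> (\<integral>\<^sup>+\<alpha>. indicator E \<alpha> * v \<alpha> \<partial>m)"
      using C by (intro nn_integral_mono mult_right_mono) (auto simp: indicator_def)
    finally show "emeasure K C \<le> (\<integral>\<^sup>+\<alpha>. indicator E \<alpha> * v \<alpha> \<partial>m)" .
  qed
  finally have le: "(\<integral>\<^sup>+\<alpha>. indicator E \<alpha> * u \<alpha> \<partial>m) \<le> (\<integral>\<^sup>+\<alpha>. indicator E \<alpha> * v \<alpha> \<partial>m)"
    using K[OF E(1)] by simp
  \<comment> \<open>On the set where the inequality fails, \<open>v'\<close> lies below
    \<open>u'\<close> pointwise while the integrals compare the other way. Since the integral of
    \<open>v'\<close> is finite, subtraction is legitimate and \<open>u' - v'\<close> vanishes
    almost everywhere.\<close>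
  define u' where "u' \<alpha> = indicator {\<alpha>\<in>space m. v \<alpha> < u \<alpha>} \<alpha> * u \<alpha>" for \<alpha>
  define v' where "v' \<alpha> = indicator {\<alpha>\<in>space m. v \<alpha> < u \<alpha>} \<alpha> * v \<alpha>" for \<alpha>
  have [measurable]: "u' \<in> borel_measurable m" "v' \<in> borel_measurable m"
    unfolding u'_def[abs_def] v'_def[abs_def] by measurable
  have le': "(\<integral>\<^sup>+\<alpha>. u' \<alpha> \<partial>m) \<le> (\<integral>\<^sup>+\<alpha>. v' \<alpha> \<partial>m)"
  proof -
    have "(\<integral>\<^sup>+\<alpha>. u' \<alpha> \<partial>m) = (\<integral>\<^sup>+\<alpha>. indicator E \<alpha> * u \<alpha> \<partial>m)"
      unfolding u'_def E(2) by (intro nn_integral_cong) (auto simp: indicator_def)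
    moreover have "(\<integral>\<^sup>+\<alpha>. v' \<alpha> \<partial>m) = (\<integral>\<^sup>+\<alpha>. indicator E \<alpha> * v \<alpha> \<partial>m)"
      unfolding v'_def E(2) by (intro nn_integral_cong) (auto simp: indicator_def)
    ultimately show ?thesis using le by simp
  qed
  have "(\<integral>\<^sup>+\<alpha>. v' \<alpha> \<partial>m) \<le> (\<integral>\<^sup>+\<alpha>. v \<alpha> \<partial>m)"
    by (intro nn_integral_mono) (auto simp: v'_def indicator_def)
  then have fv': "(\<integral>\<^sup>+\<alpha>. v' \<alpha> \<partial>m) \<noteq> \<infinity>" using fv by auto
  have "(\<integral>\<^sup>+\<alpha>. u' \<alpha> - v' \<alpha> \<partial>m) = (\<integral>\<^sup>+\<alpha>. u' \<alpha> \<partial>m) - (\<integral>\<^sup>+\<alpha>. v' \<alpha> \<partial>m)"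
  proof (rule nn_integral_diff)
    show "AE \<alpha> in m. v' \<alpha> \<le> u' \<alpha>" by (auto simp: u'_def v'_def indicator_def)
    show "u' \<in> borel_measurable m" "v' \<in> borel_measurable m" by measurable
  qed (rule fv')
  also have "\<dots> = 0" using le' fv' by (intro diff_eq_0_ennreal) (auto simp: less_top)
  finally have "AE \<alpha> in m. u' \<alpha> - v' \<alpha> = 0" by (subst (asm) nn_integral_0_iff_AE) auto
  then show ?thesis
    using AE_space
  proof eventually_elim
    case (elim \<alpha>)
    show ?case
    proof (rule ccontr)
      assume "\<not> ?case"
      then have "v \<alpha> < u \<alpha>" by simp
      then show False using elim diff_gr0_ennreal[of "v \<alpha>" "u \<alpha>"]
        by (simp add: u'_def v'_def)
    qed
  qed
qed

lemma trig_cmod_sq: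
  assumes "p \<in> trig"
  shows "\<exists>q\<in>trig. \<forall>\<alpha>\<in>dual_group. q \<alpha> = of_real ((cmod (p \<alpha>))\<^sup>2)"
proof -
  obtain r where r: "r \<in> trig" "\<forall>\<alpha>\<in>dual_group. r \<alpha> = cnj (p \<alpha>)" using trig_cnj[OF assms] by auto
  obtain q where "q \<in> trig" "\<forall>\<alpha>\<in>dual_group. q \<alpha> = p \<alpha> * r \<alpha>" using trig_mult[OF assms r(1)] by auto
  then show ?thesis using r(2) unfolding complex_norm_square by auto
qed

lemma trig_bounded:
  assumes "p \<in> trig" obtains K where "\<And>\<alpha>. \<alpha> \<in> dual_group \<Longrightarrow> cmod (p \<alpha>) \<le> K"
  using compact_imp_bounded[OF compact_continuous_image[OF trig_continuous[OF assms] compact_dual_group]]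
  unfolding bounded_iff by blast

lemma integrable_trig_mult:
  assumes h: "integrable m h" and p: "p \<in> trig"
  shows "integrable m (\<lambda>\<alpha>. h \<alpha> * p \<alpha>)"
proof -
  obtain K where K: "\<And>\<alpha>. \<alpha> \<in> dual_group \<Longrightarrow> cmod (p \<alpha>) \<le> K" using trig_bounded[OF p] by blast
  have [measurable]: "p \<in> borel_measurable m" "h \<in> borel_measurable m" using h trig_measurable[OF p] by auto
  have "integrable m (\<lambda>\<alpha>. of_real K * h \<alpha>)" using h by simp
  then show ?thesis
  proof (rule Bochner_Integration.integrable_bound)
    show "AE \<alpha> in m. norm (h \<alpha> * p \<alpha>) \<le> norm (of_real K * h \<alpha>)"
    proof (rule AE_I2)
      fix \<alpha> assume "\<alpha> \<in> space m"
      then have "cmod (p \<alpha>) \<le> \<bar>K\<bar>" using K[of \<alpha>] by simp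
      then have "cmod (p \<alpha>) * cmod (h \<alpha>) \<le> \<bar>K\<bar> * cmod (h \<alpha>)" by (rule mult_right_mono) simp
      then show "norm (h \<alpha> * p \<alpha>) \<le> norm (of_real K * h \<alpha>)" by (simp add: norm_mult mult.commute)
    qed
  qed measurable
qed

lemma integral_trig_zero:
  assumes h: "integrable m h" and z: "\<And>\<gamma>. (\<integral>\<alpha>. h \<alpha> * \<alpha> \<gamma> \<partial>m) = 0" and p: "p \<in> trig"
  shows "(\<integral>\<alpha>. h \<alpha> * p \<alpha> \<partial>m) = 0"
  using p
proof (induction rule: trig.induct)
  case (trig_char c \<gamma>)
  have "(\<integral>\<alpha>. h \<alpha> * (c * \<alpha> \<gamma>) \<partial>m) = c * (\<integral>\<alpha>. h \<alpha> * \<alpha> \<gamma> \<partial>m)"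
    by (subst integral_mult_right_zero[symmetric]) (simp only: mult_ac)
  then show ?case using z by simp
next
  case (trig_add p q)
  then show ?case
    using integrable_trig_mult[OF h] by (simp add: distrib_left)
qed

text \<open>\<open>ennreal\<close> truncates at 0, so \<open>ennreal (r \<alpha>)\<close> and
  \<open>ennreal (- r \<alpha>)\<close> are the positive and negative parts. Equal integrals against
  all weights give domination both ways; the parts then coincide, and at most one of them can be
  nonzero.\<close>

lemma real_L1_uniqueness:
  fixes r :: "_ \<Rightarrow> real"
  assumes r: "integrable m r"
    and z: "\<And>p. p \<in> trig \<Longrightarrow> (\<integral>\<alpha>. r \<alpha> * (cmod (p \<alpha>))\<^sup>2 \<partial>m) = 0"
  shows "AE \<alpha> in m. r \<alpha> = 0"
proof -
  have [measurable]: "r \<in> borel_measurable m" using r by simp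
  have fin: "(\<integral>\<^sup>+\<alpha>. ennreal (r \<alpha>) \<partial>m) < \<infinity>" "(\<integral>\<^sup>+\<alpha>. ennreal (- r \<alpha>) \<partial>m) < \<infinity>"
    using r by (auto simp: real_integrable_def less_top)
  have eq: "(\<integral>\<^sup>+\<alpha>. ennreal ((cmod (p \<alpha>))\<^sup>2) * ennreal (r \<alpha>) \<partial>m)
      = (\<integral>\<^sup>+\<alpha>. ennreal ((cmod (p \<alpha>))\<^sup>2) * ennreal (- r \<alpha>) \<partial>m)" if p: "p \<in> trig" for p
  proof -
    have [measurable]: "p \<in> borel_measurable m" by (rule trig_measurable[OF p])
    define f where "f \<alpha> = r \<alpha> * (cmod (p \<alpha>))\<^sup>2" for \<alpha>
    obtain q where q: "q \<in> trig" "\<forall>\<alpha>\<in>dual_group. q \<alpha> = of_real ((cmod (p \<alpha>))\<^sup>2)"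
      using trig_cmod_sq[OF p] by auto
    have "integrable m (\<lambda>\<alpha>. Re (of_real (r \<alpha>) * q \<alpha>))"
      by (intro integrable_Re integrable_trig_mult q integrable_of_real r)
    then have f: "integrable m f"
      by (rule Bochner_Integration.integrable_cong[OF refl, THEN iffD1, rotated]) (auto simp: q f_def)
    \<comment> \<open>The integral of \<open>f\<close> is 0 and equals the difference of these two
      numbers; finiteness lifts the equality to extended values.\<close>
    have "enn2real (\<integral>\<^sup>+\<alpha>. ennreal (f \<alpha>) \<partial>m) = enn2real (\<integral>\<^sup>+\<alpha>. ennreal (- f \<alpha>) \<partial>m)"
    proof -
      have "(\<integral>\<alpha>. f \<alpha> \<partial>m) = 0" using z[OF p] by (simp add: f_def)
      then show ?thesis using real_lebesgue_integral_def[OF f] by linarith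
    qed
    moreover have "(\<integral>\<^sup>+\<alpha>. ennreal (f \<alpha>) \<partial>m) < top" "(\<integral>\<^sup>+\<alpha>. ennreal (- f \<alpha>) \<partial>m) < top"
      using f by (auto simp: real_integrable_def less_top)
    ultimately have "(\<integral>\<^sup>+\<alpha>. ennreal (f \<alpha>) \<partial>m) = (\<integral>\<^sup>+\<alpha>. ennreal (- f \<alpha>) \<partial>m)"
      by (metis ennreal_enn2real)
    moreover have "ennreal ((cmod (p \<alpha>))\<^sup>2) * ennreal (r \<alpha>) = ennreal (f \<alpha>)" for \<alpha>
      by (subst ennreal_mult'[symmetric]) (simp_all add: f_def mult.commute)
    moreover have "ennreal ((cmod (p \<alpha>))\<^sup>2) * ennreal (- r \<alpha>) = ennreal (- f \<alpha>)" for \<alpha>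
      by (subst ennreal_mult'[symmetric]) (simp_all add: f_def mult.commute)
    ultimately show ?thesis by (simp only:)
  qed
  have 1: "AE \<alpha> in m. ennreal (r \<alpha>) \<le> ennreal (- r \<alpha>)"
    by (rule trig_domination[OF _ _ fin]) (auto simp: eq)
  have 2: "AE \<alpha> in m. ennreal (- r \<alpha>) \<le> ennreal (r \<alpha>)"
    by (rule trig_domination[OF _ _ fin(2,1)]) (auto simp: eq)
  show ?thesis
    using 1 2
  proof eventually_elim
    case (elim \<alpha>)
    then show ?case by (cases "r \<alpha>" "0::real" rule: linorder_cases) (auto simp: ennreal_le_iff2)
  qed
qed

text \<open>On \<open>dual_group\<close> the squared modulus of a trigonometric polynomial is itself
  one, so \<open>h\<close> integrates to 0 against it. This weight is real, so real and imaginary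
  parts can be treated separately.\<close>

lemma L1_uniqueness:
  assumes h: "integrable m h" and z: "\<And>\<gamma>. (\<integral>\<alpha>. h \<alpha> * \<alpha> \<gamma> \<partial>m) = 0"
  shows "AE \<alpha> in m. h \<alpha> = 0"
proof -
  have int: "integrable m (\<lambda>\<alpha>. h \<alpha> * of_real ((cmod (p \<alpha>))\<^sup>2))"
    and zero: "(\<integral>\<alpha>. h \<alpha> * of_real ((cmod (p \<alpha>))\<^sup>2) \<partial>m) = 0" if p: "p \<in> trig" for p
  proof -
    obtain q where q: "q \<in> trig" "\<forall>\<alpha>\<in>dual_group. q \<alpha> = of_real ((cmod (p \<alpha>))\<^sup>2)"
      using trig_cmod_sq[OF p] by auto
    have "(\<integral>\<alpha>. h \<alpha> * of_real ((cmod (p \<alpha>))\<^sup>2) \<partial>m) = (\<integral>\<alpha>. h \<alpha> * q \<alpha> \<partial>m)"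
      by (intro Bochner_Integration.integral_cong) (auto simp: q)
    then show "(\<integral>\<alpha>. h \<alpha> * of_real ((cmod (p \<alpha>))\<^sup>2) \<partial>m) = 0"
      using integral_trig_zero[OF h z q(1)] by simp
    show "integrable m (\<lambda>\<alpha>. h \<alpha> * of_real ((cmod (p \<alpha>))\<^sup>2))"
      by (rule Bochner_Integration.integrable_cong[OF refl, THEN iffD1, rotated, OF integrable_trig_mult[OF h q(1)]])
         (auto simp: q)
  qed
  have "AE \<alpha> in m. Re (h \<alpha>) = 0"
  proof (rule real_L1_uniqueness)
    fix p :: "('g \<Rightarrow> complex) \<Rightarrow> complex" assume p: "p \<in> trig"
    have "(\<integral>\<alpha>. Re (h \<alpha> * of_real ((cmod (p \<alpha>))\<^sup>2)) \<partial>m) = 0"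
      using integral_Re[OF int[OF p]] zero[OF p] by simp
    then show "(\<integral>\<alpha>. Re (h \<alpha>) * (cmod (p \<alpha>))\<^sup>2 \<partial>m) = 0" by (simp flip: of_real_power)
  qed (use h in auto)
  moreover have "AE \<alpha> in m. Im (h \<alpha>) = 0"
  proof (rule real_L1_uniqueness)
    fix p :: "('g \<Rightarrow> complex) \<Rightarrow> complex" assume p: "p \<in> trig"
    have "(\<integral>\<alpha>. Im (h \<alpha> * of_real ((cmod (p \<alpha>))\<^sup>2)) \<partial>m) = 0"
      using integral_Im[OF int[OF p]] zero[OF p] by simp
    then show "(\<integral>\<alpha>. Im (h \<alpha>) * (cmod (p \<alpha>))\<^sup>2 \<partial>m) = 0" by (simp flip: of_real_power)
  qed (use h in auto)
  ultimately show ?thesis by eventually_elim (simp add: complex_eq_iff)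
qed

subsection \<open>The Fourier transform of square-summable families\<close>

lemma fourier_transform_iff:
  "is_fourier_transform m a g \<longleftrightarrow>
    g \<in> L2 m \<and> ((\<lambda>F. L2_norm m (\<lambda>\<alpha>. g \<alpha> - fsum a F \<alpha>)) \<longlongrightarrow> 0) (finite_subsets_at_top UNIV)"
  by (simp add: is_fourier_transform_def fsum_def)

text \<open>The squared norm of a partial sum is the finite sum of squared moduli, so norm
  convergence along finite subsets is exactly a \<open>has_sum\<close> statement.\<close>

lemma fourier_transform_parseval:
  assumes ft: "is_fourier_transform m a g"
  shows "nsq m g = (\<integral>\<^sup>+\<gamma>. ennreal ((cmod (a \<gamma>))\<^sup>2) \<partial>count_space UNIV)"
proof -
  have g: "g \<in> L2 m" and lim: "((\<lambda>F. L2_norm m (\<lambda>\<alpha>. g \<alpha> - fsum a F \<alpha>)) \<longlongrightarrow> 0) (finite_subsets_at_top UNIV)"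
    using ft by (auto simp: fourier_transform_iff)
  have "((\<lambda>F. L2_norm m (fsum a F) - L2_norm m g) \<longlongrightarrow> 0) (finite_subsets_at_top UNIV)"
    using L2_norm_diff_abs[OF g fsum_L2]
    by (intro Lim_null_comparison[OF _ lim] always_eventually) (auto simp: abs_minus_commute)
  then have "((\<lambda>F. L2_norm m (fsum a F)) \<longlongrightarrow> L2_norm m g) (finite_subsets_at_top UNIV)"
    by (simp add: Lim_null[symmetric])
  then have "((\<lambda>F. (L2_norm m (fsum a F))\<^sup>2) \<longlongrightarrow> (L2_norm m g)\<^sup>2) (finite_subsets_at_top UNIV)"
    by (intro tendsto_intros)
  moreover have "\<forall>\<^sub>F F in finite_subsets_at_top UNIV.
      (L2_norm m (fsum a F))\<^sup>2 = (\<Sum>\<gamma>\<in>F. (cmod (a \<gamma>))\<^sup>2)"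
    by (rule eventually_finite_subsets_at_top_weakI) (simp add: norm_fsum)
  ultimately have "((\<lambda>F. \<Sum>\<gamma>\<in>F. (cmod (a \<gamma>))\<^sup>2) \<longlongrightarrow> (L2_norm m g)\<^sup>2) (finite_subsets_at_top UNIV)"
    by (rule Lim_transform_eventually)
  then have hs: "((\<lambda>\<gamma>. (cmod (a \<gamma>))\<^sup>2) has_sum (L2_norm m g)\<^sup>2) UNIV"
    by (simp add: has_sum_def)
  then show ?thesis
    using nn_integral_count_space_summable[of "\<lambda>\<gamma>. (cmod (a \<gamma>))\<^sup>2" UNIV]
    by (simp add: nsq_eq_norm[OF g] has_sum_imp_summable infsumI)
qed

text \<open>A partial sum has the exact coefficient as soon as \<open>\<gamma>\<close> belongs to
  \<open>F\<close>, and the remaining error is at most the L2 distance since characters have norm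
  1.\<close>

lemma fourier_transform_coeff:
  assumes ft: "is_fourier_transform m a g"
  shows "(\<integral>\<alpha>. g \<alpha> * \<alpha> \<gamma> \<partial>m) = a \<gamma>"
proof -
  have g: "g \<in> L2 m" and lim: "((\<lambda>F. L2_norm m (\<lambda>\<alpha>. g \<alpha> - fsum a F \<alpha>)) \<longlongrightarrow> 0) (finite_subsets_at_top UNIV)"
    using ft by (auto simp: fourier_transform_iff)
  have "cmod ((\<integral>\<alpha>. g \<alpha> * \<alpha> \<gamma> \<partial>m) - a \<gamma>) \<le> L2_norm m (\<lambda>\<alpha>. g \<alpha> - fsum a F \<alpha>)"
    if F: "finite F" "\<gamma> \<in> F" for F
  proof -
    have "(\<integral>\<alpha>. g \<alpha> * \<alpha> \<gamma> \<partial>m) - a \<gamma> = (\<integral>\<alpha>. g \<alpha> * \<alpha> \<gamma> \<partial>m) - (\<integral>\<alpha>. fsum a F \<alpha> * \<alpha> \<gamma> \<partial>m)"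
      using F by (simp add: integral_fsum_char)
    also have "\<dots> = (\<integral>\<alpha>. (g \<alpha> - fsum a F \<alpha>) * \<alpha> \<gamma> \<partial>m)"
      using L2_integrable_char[OF g] L2_integrable_char[OF fsum_L2]
      by (simp add: left_diff_distrib)
    also have "\<dots> = L2_inner m (\<lambda>\<alpha>. g \<alpha> - fsum a F \<alpha>) (\<lambda>\<alpha>. \<alpha> (- \<gamma>))"
      unfolding L2_inner_def by (intro Bochner_Integration.integral_cong) (auto simp: dual_groupD)
    finally show ?thesis
      using L2_inner_le[OF L2_diff[OF g fsum_L2] char_L2, of a F "- \<gamma>"] by (simp add: L2_norm_char)
  qed
  then have "\<forall>\<^sub>F F in finite_subsets_at_top UNIV. cmod ((\<integral>\<alpha>. g \<alpha> * \<alpha> \<gamma> \<partial>m) - a \<gamma>) \<le> L2_norm m (\<lambda>\<alpha>. g \<alpha> - fsum a F \<alpha>)"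
    unfolding eventually_finite_subsets_at_top by (intro exI[of _ "{\<gamma>}"]) auto
  then have "cmod ((\<integral>\<alpha>. g \<alpha> * \<alpha> \<gamma> \<partial>m) - a \<gamma>) \<le> 0"
    by (rule tendsto_lowerbound[OF lim]) simp
  then show ?thesis by simp
qed

lemma fsum_linear: "fsum (\<lambda>\<gamma>. c * a \<gamma> + b \<gamma>) F \<alpha> = c * fsum a F \<alpha> + fsum b F \<alpha>"
  by (simp add: fsum_def sum_distrib_left sum.distrib[symmetric] distrib_right mult.assoc)

lemma fourier_transform_linear:
  assumes f: "is_fourier_transform m a f" and g: "is_fourier_transform m b g"
  shows "is_fourier_transform m (\<lambda>\<gamma>. c * a \<gamma> + b \<gamma>) (\<lambda>\<alpha>. c * f \<alpha> + g \<alpha>)"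
proof -
  have L: "f \<in> L2 m" "g \<in> L2 m" using f g by (auto simp: fourier_transform_iff)
  have "((\<lambda>F. cmod c * L2_norm m (\<lambda>\<alpha>. f \<alpha> - fsum a F \<alpha>) + L2_norm m (\<lambda>\<alpha>. g \<alpha> - fsum b F \<alpha>))
      \<longlongrightarrow> cmod c * 0 + 0) (finite_subsets_at_top UNIV)"
    using f g by (intro tendsto_intros) (auto simp: fourier_transform_iff)
  then have lim: "((\<lambda>F. cmod c * L2_norm m (\<lambda>\<alpha>. f \<alpha> - fsum a F \<alpha>) + L2_norm m (\<lambda>\<alpha>. g \<alpha> - fsum b F \<alpha>))
      \<longlongrightarrow> 0) (finite_subsets_at_top UNIV)" by simp
  have "L2_norm m (\<lambda>\<alpha>. (c * f \<alpha> + g \<alpha>) - fsum (\<lambda>\<gamma>. c * a \<gamma> + b \<gamma>) F \<alpha>)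
      \<le> cmod c * L2_norm m (\<lambda>\<alpha>. f \<alpha> - fsum a F \<alpha>) + L2_norm m (\<lambda>\<alpha>. g \<alpha> - fsum b F \<alpha>)" for F
  proof -
    have "(\<lambda>\<alpha>. (c * f \<alpha> + g \<alpha>) - fsum (\<lambda>\<gamma>. c * a \<gamma> + b \<gamma>) F \<alpha>)
      = (\<lambda>\<alpha>. c * (f \<alpha> - fsum a F \<alpha>) + (g \<alpha> - fsum b F \<alpha>))"
      unfolding fsum_linear by (rule ext) (simp add: algebra_simps)
    then show ?thesis
      using L2_norm_triangle[OF L2_scale[OF L2_diff[OF L(1) fsum_L2], of c a F] L2_diff[OF L(2) fsum_L2, of b F]]
      by (simp add: L2_norm_scale)
  qed
  then have "((\<lambda>F. L2_norm m (\<lambda>\<alpha>. (c * f \<alpha> + g \<alpha>) - fsum (\<lambda>\<gamma>. c * a \<gamma> + b \<gamma>) F \<alpha>)) \<longlongrightarrow> 0)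
      (finite_subsets_at_top UNIV)"
    by (intro Lim_null_comparison[OF _ lim] always_eventually) auto
  then show ?thesis
    using L by (simp add: fourier_transform_iff L2_add L2_scale)
qed

lemma char_mult_L2:
  assumes "g \<in> L2 m" shows "(\<lambda>\<alpha>. \<alpha> \<gamma> * g \<alpha>) \<in> L2 m" "L2_norm m (\<lambda>\<alpha>. \<alpha> \<gamma> * g \<alpha>) = L2_norm m g"
proof -
  have [measurable]: "g \<in> borel_measurable m" using assms by (simp add: L2_def)
  have eq: "(cmod (\<alpha> \<gamma> * g \<alpha>))\<^sup>2 = (cmod (g \<alpha>))\<^sup>2" if "\<alpha> \<in> space m" for \<alpha>
    using that by (simp add: norm_mult dual_groupD)
  have "integrable m (\<lambda>\<alpha>. (cmod (\<alpha> \<gamma> * g \<alpha>))\<^sup>2)"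
    by (rule Bochner_Integration.integrable_cong[OF refl eq, THEN iffD2]) (use assms in \<open>auto simp: L2_def\<close>)
  then show "(\<lambda>\<alpha>. \<alpha> \<gamma> * g \<alpha>) \<in> L2 m" by (simp add: L2_def)
  show "L2_norm m (\<lambda>\<alpha>. \<alpha> \<gamma> * g \<alpha>) = L2_norm m g"
    unfolding L2_norm_def by (intro arg_cong[where f = sqrt] Bochner_Integration.integral_cong refl eq)
qed

text \<open>Multiplication by a character preserves norms and matches partial sums of the shifted
  sequence over \<open>F\<close> with those of \<open>a\<close> over a translate of
  \<open>F\<close>. Translation preserves the filter of finite subsets.\<close>

lemma fourier_transform_shift:
  assumes ft: "is_fourier_transform m a g"
  shows "is_fourier_transform m (\<lambda>\<delta>. a (\<delta> + \<gamma>)) (\<lambda>\<alpha>. \<alpha> \<gamma> * g \<alpha>)"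
proof -
  have g: "g \<in> L2 m" and lim: "((\<lambda>F. L2_norm m (\<lambda>\<alpha>. g \<alpha> - fsum a F \<alpha>)) \<longlongrightarrow> 0) (finite_subsets_at_top UNIV)"
    using ft by (auto simp: fourier_transform_iff)
  have eq: "L2_norm m (\<lambda>\<alpha>. \<alpha> \<gamma> * g \<alpha> - fsum (\<lambda>\<delta>. a (\<delta> + \<gamma>)) F \<alpha>)
      = L2_norm m (\<lambda>\<alpha>. g \<alpha> - fsum a ((\<lambda>\<delta>. \<delta> + \<gamma>) ` F) \<alpha>)" for F
  proof -
    have "fsum (\<lambda>\<delta>. a (\<delta> + \<gamma>)) F \<alpha> = \<alpha> \<gamma> * fsum a ((\<lambda>\<delta>. \<delta> + \<gamma>) ` F) \<alpha>" if "\<alpha> \<in> dual_group" for \<alpha>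
    proof -
      have "\<alpha> \<gamma> * (cnj (\<alpha> \<gamma>) * z) = z" for z
        using dual_groupD(5)[OF that] by (simp flip: mult.assoc)
      then show ?thesis
        unfolding fsum_def using that
        by (subst sum.reindex) (auto simp: inj_on_def sum_distrib_left dual_groupD mult_ac simp del: minus_add_distrib
          intro!: sum.cong)
    qed
    then have "L2_norm m (\<lambda>\<alpha>. \<alpha> \<gamma> * g \<alpha> - fsum (\<lambda>\<delta>. a (\<delta> + \<gamma>)) F \<alpha>)
      = L2_norm m (\<lambda>\<alpha>. \<alpha> \<gamma> * (g \<alpha> - fsum a ((\<lambda>\<delta>. \<delta> + \<gamma>) ` F) \<alpha>))"
      unfolding L2_norm_def by (intro arg_cong[where f=sqrt] Bochner_Integration.integral_cong) (auto simp: right_diff_distrib)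
    then show ?thesis using char_mult_L2(2)[OF L2_diff[OF g fsum_L2]] by simp
  qed
  have "filterlim (image (\<lambda>\<delta>. \<delta> + \<gamma>)) (finite_subsets_at_top UNIV) (finite_subsets_at_top UNIV)"
    using filtermap_image_finite_subsets_at_top[of "\<lambda>\<delta>. \<delta> + \<gamma>" UNIV]
    by (simp add: filterlim_def inj_on_def surj_plus_right)
  from filterlim_compose[OF lim this] show ?thesis
    unfolding fourier_transform_iff eq using char_mult_L2(1)[OF g] by simp
qed

lemma nsq_fsum:
  assumes "finite F" shows "nsq m (fsum a F) = (\<Sum>\<gamma>\<in>F. ennreal ((cmod (a \<gamma>))\<^sup>2))"
  by (simp add: nsq_eq_norm[OF fsum_L2] norm_fsum[OF assms] sum_ennreal)

lemma fsum_diff: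
  assumes "finite F" "G \<subseteq> F" shows "fsum a F \<alpha> - fsum a G \<alpha> = fsum a (F - G) \<alpha>"
  unfolding fsum_def by (rule sum_diff[OF assms, symmetric])

text \<open>\<open>fast\<close> makes the increments along the exhaustion small enough for
  convergence almost everywhere, so \<open>lim\<close> defines the function pointwise. Fatou then
  bounds its distance to every finite partial sum, giving convergence along all finite subsets and
  not merely along \<open>F\<close>.\<close>

lemma fourier_transform_limit:
  assumes sq: "(\<lambda>\<gamma>. (cmod (c \<gamma>))\<^sup>2) summable_on UNIV"
    and F: "incseq F" "\<And>n. finite (F n)" "(\<Union>n. F n) = UNIV"
    and fast: "(\<Sum>n. ennreal (2 ^ n) * (\<Sum>\<gamma>\<in>F (Suc n) - F n. ennreal ((cmod (c \<gamma>))\<^sup>2))) < \<infinity>"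
  shows "is_fourier_transform m c (\<lambda>\<alpha>. lim (\<lambda>n. fsum c (F n) \<alpha>))"
proof -
  define g where "g \<alpha> = lim (\<lambda>n. fsum c (F n) \<alpha>)" for \<alpha>
  define T where "T = (\<Sum>\<^sub>\<infinity>\<gamma>\<in>UNIV. (cmod (c \<gamma>))\<^sup>2)"
  have [measurable]: "fsum c G \<in> borel_measurable m" for G by (rule L2_measurable[OF fsum_L2])
  have sub: "F n \<subseteq> F (Suc n)" for n using F(1) by (simp add: incseq_SucD)
  have [measurable]: "g \<in> borel_measurable m"
    unfolding g_def[abs_def] by (rule borel_measurable_lim_metric) simp
  have "(\<integral>\<^sup>+\<alpha>. (\<Sum>n. ennreal (2 ^ n * (cmod (fsum c (F (Suc n)) \<alpha> - fsum c (F n) \<alpha>))\<^sup>2)) \<partial>m)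
    = (\<Sum>n. \<integral>\<^sup>+\<alpha>. ennreal (2 ^ n * (cmod (fsum c (F (Suc n)) \<alpha> - fsum c (F n) \<alpha>))\<^sup>2) \<partial>m)"
    by (rule nn_integral_suminf) simp
  also have "\<dots> = (\<Sum>n. ennreal (2 ^ n) * nsq m (fsum c (F (Suc n) - F n)))"
    unfolding fsum_diff[OF F(2) sub] nsq_def
    by (simp add: ennreal_mult nn_integral_cmult)
  also have "\<dots> < \<infinity>" using fast F(2) by (simp add: nsq_fsum)
  finally have "AE \<alpha> in m. (\<Sum>n. ennreal (2 ^ n * (cmod (fsum c (F (Suc n)) \<alpha> - fsum c (F n) \<alpha>))\<^sup>2)) \<noteq> \<infinity>"
    by (intro nn_integral_PInf_AE) auto
  then have conv: "AE \<alpha> in m. (\<lambda>n. fsum c (F n) \<alpha>) \<longlonglongrightarrow> g \<alpha>"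
  proof eventually_elim
    case (elim \<alpha>)
    then have "convergent (\<lambda>n. fsum c (F n) \<alpha>)"
      by (intro convergent_if_weighted_sq_summable) (simp add: less_top)
    then show ?case by (simp add: g_def convergent_LIMSEQ_iff)
  qed
  \<comment> \<open>Once \<open>F n\<close> contains \<open>G\<close>, the squared distance of the
    two partial sums is the sum over \<open>F n - G\<close>, at most what \<open>G\<close> leaves of
    the total \<open>T\<close>.\<close>
  have tail: "nsq m (\<lambda>\<alpha>. g \<alpha> - fsum c G \<alpha>) \<le> ennreal (T - (\<Sum>\<gamma>\<in>G. (cmod (c \<gamma>))\<^sup>2))" if G: "finite G" for G
  proof -
    obtain n0 where n0: "G \<subseteq> F n0"
    proof -
      have "\<forall>\<gamma>\<in>G. \<exists>n. \<gamma> \<in> F n" using F(3) by blast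
      then obtain n where n: "\<And>\<gamma>. \<gamma> \<in> G \<Longrightarrow> \<gamma> \<in> F (n \<gamma>)" by metis
      have "\<gamma> \<in> F (\<Sum>\<gamma>\<in>G. n \<gamma>)" if "\<gamma> \<in> G" for \<gamma>
        using n[OF that] incseqD[OF F(1), of "n \<gamma>" "\<Sum>\<gamma>\<in>G. n \<gamma>"] member_le_sum[OF that _ G, of n] by auto
      then show ?thesis using that by blast
    qed
    show ?thesis
      unfolding nsq_def
    proof (rule nn_integral_le_of_LIMSEQ[where f = "\<lambda>n \<alpha>. ennreal ((cmod (fsum c (F n) \<alpha> - fsum c G \<alpha>))\<^sup>2)"])
      show "AE \<alpha> in m. (\<lambda>n. ennreal ((cmod (fsum c (F n) \<alpha> - fsum c G \<alpha>))\<^sup>2))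
          \<longlonglongrightarrow> ennreal ((cmod (g \<alpha> - fsum c G \<alpha>))\<^sup>2)"
        using conv by eventually_elim (intro tendsto_ennrealI tendsto_intros)
      fix n assume "n0 \<le> n"
      then have GF: "G \<subseteq> F n" using n0 incseqD[OF F(1), of n0 n] by blast
      have "(\<integral>\<^sup>+\<alpha>. ennreal ((cmod (fsum c (F n) \<alpha> - fsum c G \<alpha>))\<^sup>2) \<partial>m) = nsq m (fsum c (F n - G))"
        unfolding fsum_diff[OF F(2) GF] nsq_def ..
      also have "\<dots> = ennreal (\<Sum>\<gamma>\<in>F n - G. (cmod (c \<gamma>))\<^sup>2)" using F(2) by (simp add: nsq_fsum sum_ennreal)
      also have "(\<Sum>\<gamma>\<in>F n - G. (cmod (c \<gamma>))\<^sup>2) = (\<Sum>\<gamma>\<in>F n. (cmod (c \<gamma>))\<^sup>2) - (\<Sum>\<gamma>\<in>G. (cmod (c \<gamma>))\<^sup>2)"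
        by (rule sum_diff[OF F(2) GF])
      also have "(\<Sum>\<gamma>\<in>F n. (cmod (c \<gamma>))\<^sup>2) \<le> T"
        unfolding T_def by (rule finite_sum_le_infsum[OF sq F(2)]) auto
      finally show "(\<integral>\<^sup>+\<alpha>. ennreal ((cmod (fsum c (F n) \<alpha> - fsum c G \<alpha>))\<^sup>2) \<partial>m)
          \<le> ennreal (T - (\<Sum>\<gamma>\<in>G. (cmod (c \<gamma>))\<^sup>2))" by (simp add: ennreal_leI)
    qed simp
  qed
  have "nsq m g < \<infinity>"
    using tail[of "{}"] by (simp add: fsum_def) (meson ennreal_less_top le_less_trans)
  then have g: "g \<in> L2 m" by (simp add: L2_iff)
  have "((\<lambda>G. \<Sum>\<gamma>\<in>G. (cmod (c \<gamma>))\<^sup>2) \<longlongrightarrow> T) (finite_subsets_at_top UNIV)"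
    using has_sum_infsum[OF sq] by (simp add: has_sum_def T_def)
  then have "((\<lambda>G. sqrt (T - (\<Sum>\<gamma>\<in>G. (cmod (c \<gamma>))\<^sup>2))) \<longlongrightarrow> sqrt (T - T)) (finite_subsets_at_top UNIV)"
    by (intro tendsto_intros)
  then have lim: "((\<lambda>G. sqrt (T - (\<Sum>\<gamma>\<in>G. (cmod (c \<gamma>))\<^sup>2))) \<longlongrightarrow> 0) (finite_subsets_at_top UNIV)" by simp
  have "norm (L2_norm m (\<lambda>\<alpha>. g \<alpha> - fsum c G \<alpha>)) \<le> sqrt (T - (\<Sum>\<gamma>\<in>G. (cmod (c \<gamma>))\<^sup>2))" if G: "finite G" for G
  proof -
    have "0 \<le> T - (\<Sum>\<gamma>\<in>G. (cmod (c \<gamma>))\<^sup>2)"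
      using finite_sum_le_infsum[OF sq G] by (simp add: T_def)
    then have "(L2_norm m (\<lambda>\<alpha>. g \<alpha> - fsum c G \<alpha>))\<^sup>2 \<le> T - (\<Sum>\<gamma>\<in>G. (cmod (c \<gamma>))\<^sup>2)"
      using tail[OF G] by (simp add: nsq_eq_norm[OF L2_diff[OF g fsum_L2]])
    then show ?thesis by (simp add: real_le_rsqrt)
  qed
  then have "((\<lambda>G. L2_norm m (\<lambda>\<alpha>. g \<alpha> - fsum c G \<alpha>)) \<longlongrightarrow> 0) (finite_subsets_at_top UNIV)"
    by (intro Lim_null_comparison[OF _ lim] eventually_finite_subsets_at_top_weakI) auto
  then show ?thesis
    using g unfolding fourier_transform_iff g_def by simp
qed

text \<open>The exhaustion by finite sets is chosen independently of \<open>x\<close>; this is what makes the limit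
  jointly measurable.\<close>

lemma fourier_transform_exists:
  assumes [measurable]: "\<And>\<gamma>. a \<gamma> \<in> borel_measurable N"
    and fin: "(\<integral>\<^sup>+\<gamma>. nsq N (a \<gamma>) \<partial>count_space UNIV) < \<infinity>"
  shows "\<exists>Z. (\<lambda>(\<alpha>, x). Z \<alpha> x) \<in> borel_measurable (m \<Otimes>\<^sub>M N) \<and>
    (AE x in N. is_fourier_transform m (\<lambda>\<gamma>. a \<gamma> x) (\<lambda>\<alpha>. Z \<alpha> x))"
proof -
  define E where "E n = {\<gamma>::'g. to_nat \<gamma> < n}" for n
  have E: "finite (E n)" for n
    unfolding E_def by (rule finite_imageD[of to_nat]) (auto intro: finite_subset[of _ "{..<n}"] simp: inj_on_def)
  have "(\<lambda>n. \<integral>\<^sup>+\<gamma>. nsq N (a \<gamma>) * indicator (- E n) \<gamma> \<partial>count_space UNIV)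
    \<longlonglongrightarrow> (\<integral>\<^sup>+\<gamma>. 0 \<partial>count_space (UNIV :: 'g set))"
  proof (rule nn_integral_dominated_convergence[where w = "\<lambda>\<gamma>. nsq N (a \<gamma>)"
        and u = "\<lambda>n \<gamma>. nsq N (a \<gamma>) * indicator (- E n) \<gamma>" and u' = "\<lambda>_. 0"])
    show "AE \<gamma> in count_space UNIV. (\<lambda>n. nsq N (a \<gamma>) * indicator (- E n) \<gamma>) \<longlonglongrightarrow> 0"
    proof (rule AE_I2)
      fix \<gamma> :: 'g
      have "nsq N (a \<gamma>) * indicator (- E n) \<gamma> = 0" if "to_nat \<gamma> < n" for n
        using that by (simp add: E_def)
      then show "(\<lambda>n. nsq N (a \<gamma>) * indicator (- E n) \<gamma>) \<longlonglongrightarrow> 0"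
        by (intro tendsto_eventually) (auto simp: eventually_sequentially intro!: exI[of _ "Suc (to_nat \<gamma>)"])
    qed
  qed (use fin in \<open>auto simp: indicator_def\<close>)
  then have ev: "\<forall>\<^sub>F n in sequentially. (\<integral>\<^sup>+\<gamma>. nsq N (a \<gamma>) * indicator (- E n) \<gamma> \<partial>count_space UNIV) < ennreal e"
    if "0 < e" for e using that by (simp add: order_tendsto_iff)
  \<comment> \<open>The rate \<open>(1/4) ^ n\<close> still leaves a summable
    \<open>(1/2) ^ n\<close> after multiplication by the weight \<open>2 ^ n\<close> of
    \<open>fourier_transform_limit\<close>.\<close>
  have "\<exists>r. (\<integral>\<^sup>+\<gamma>. nsq N (a \<gamma>) * indicator (- E r) \<gamma> \<partial>count_space UNIV) < ennreal ((1/4) ^ n)" for n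
    by (rule eventually_happens'[OF sequentially_bot ev]) simp
  then obtain r where r: "\<And>n. (\<integral>\<^sup>+\<gamma>. nsq N (a \<gamma>) * indicator (- E (r n)) \<gamma> \<partial>count_space UNIV) < ennreal ((1/4) ^ n)"
    by metis
  \<comment> \<open>The sum of the \<open>r k\<close> makes the sets increase and contain
    \<open>E (r n)\<close>; the extra \<open>n\<close> makes them exhaust the group even if
    \<open>r\<close> is eventually 0.\<close>
  define F where "F n = E (n + (\<Sum>k\<le>n. r k))" for n
  have incF: "incseq F"
    unfolding incseq_Suc_iff F_def E_def by auto
  have finF: "finite (F n)" for n by (simp add: F_def E)
  have UF: "(\<Union>n. F n) = UNIV"
  proof (intro equalityI subsetI UNIV_I)
    fix \<gamma> :: 'g
    have "\<gamma> \<in> F (Suc (to_nat \<gamma>))" by (simp add: F_def E_def)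
    then show "\<gamma> \<in> (\<Union>n. F n)" by blast
  qed
  have small: "(\<Sum>\<gamma>\<in>F (Suc n) - F n. nsq N (a \<gamma>)) \<le> ennreal ((1/4) ^ n)" for n
  proof -
    have "r n \<le> (\<Sum>k\<le>n. r k)" by (rule member_le_sum) auto
    then have sub: "E (r n) \<subseteq> F n" by (auto simp: F_def E_def)
    have "(\<Sum>\<gamma>\<in>F (Suc n) - F n. nsq N (a \<gamma>)) = (\<integral>\<^sup>+\<gamma>. nsq N (a \<gamma>) * indicator (F (Suc n) - F n) \<gamma> \<partial>count_space UNIV)"
      using finF by (subst nn_integral_count_space'[of "F (Suc n) - F n"]) auto
    also have "\<dots> \<le> (\<integral>\<^sup>+\<gamma>. nsq N (a \<gamma>) * indicator (- E (r n)) \<gamma> \<partial>count_space UNIV)"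
      using sub by (intro nn_integral_mono mult_left_mono) (auto simp: indicator_def)
    finally show ?thesis using r[of n] by simp
  qed
  define Z where "Z \<alpha> x = lim (\<lambda>n. fsum (\<lambda>\<gamma>. a \<gamma> x) (F n) \<alpha>)" for \<alpha> x
  have "(\<lambda>(\<alpha>, x). Z \<alpha> x) \<in> borel_measurable (m \<Otimes>\<^sub>M N)"
    unfolding Z_def split_beta'
    by (rule borel_measurable_lim_metric) (simp add: fsum_def)
  moreover have "AE x in N. is_fourier_transform m (\<lambda>\<gamma>. a \<gamma> x) (\<lambda>\<alpha>. Z \<alpha> x)"
  proof -
    have "(\<integral>\<^sup>+x. \<integral>\<^sup>+\<gamma>. ennreal ((cmod (a \<gamma> x))\<^sup>2) \<partial>count_space UNIV \<partial>N) < \<infinity>"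
      using fin unfolding nsq_def by (subst nn_integral_count_space_nn_integral) auto
    then have 1: "AE x in N. (\<integral>\<^sup>+\<gamma>. ennreal ((cmod (a \<gamma> x))\<^sup>2) \<partial>count_space UNIV) \<noteq> \<infinity>"
      by (intro nn_integral_PInf_AE borel_measurable_nn_integral_count_space) auto
    have "(\<integral>\<^sup>+x. (\<Sum>n. ennreal (2 ^ n) * (\<Sum>\<gamma>\<in>F (Suc n) - F n. ennreal ((cmod (a \<gamma> x))\<^sup>2))) \<partial>N)
      = (\<Sum>n. ennreal (2 ^ n) * (\<Sum>\<gamma>\<in>F (Suc n) - F n. nsq N (a \<gamma>)))"
      by (simp add: nn_integral_suminf nn_integral_cmult nn_integral_sum nsq_def del: sum_ennreal)
    also have "\<dots> \<le> (\<Sum>n. ennreal (2 ^ n) * ennreal ((1/4) ^ n))"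
      by (intro suminf_le mult_left_mono small) auto
    also have "\<dots> = (\<Sum>n. ennreal ((1/2) ^ n))"
      by (simp flip: ennreal_mult' power_mult_distrib)
    also have "\<dots> = ennreal (\<Sum>n. (1/2) ^ n)"
      by (rule suminf_ennreal2) (auto intro: summable_geometric)
    also have "\<dots> < \<infinity>" by simp
    finally have 2: "AE x in N. (\<Sum>n. ennreal (2 ^ n) * (\<Sum>\<gamma>\<in>F (Suc n) - F n. ennreal ((cmod (a \<gamma> x))\<^sup>2))) \<noteq> \<infinity>"
      by (intro nn_integral_PInf_AE) auto
    show ?thesis
      using 1 2
    proof eventually_elim
      case (elim x)
      have "(\<lambda>\<gamma>. (cmod (a \<gamma> x))\<^sup>2) summable_on UNIV"
        by (rule summable_on_if_nn_integral_finite) (use elim(1) in \<open>auto simp: less_top\<close>)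
      from fourier_transform_limit[OF this incF finF UF] elim(2) show ?case
        by (simp add: Z_def less_top)
    qed
  qed
  ultimately show ?thesis by blast
qed

text \<open>If the coefficients are square summable, their Fourier transform has the same
  coefficients as \<open>h\<close> and so equals \<open>h\<close> almost everywhere, and Parseval
  applies. If they are not, Bessel shows that \<open>h\<close> is not in L2, and both sides are
  infinite.\<close>

lemma plancherel_L1:
  assumes h: "integrable m h"
  shows "(\<integral>\<^sup>+\<gamma>. ennreal ((cmod (\<integral>\<alpha>. h \<alpha> * \<alpha> \<gamma> \<partial>m))\<^sup>2) \<partial>count_space UNIV) = nsq m h"
proof -
  define c where "c \<gamma> = (\<integral>\<alpha>. h \<alpha> * \<alpha> \<gamma> \<partial>m)" for \<gamma>
  define S where "S = (\<integral>\<^sup>+\<gamma>. ennreal ((cmod (c \<gamma>))\<^sup>2) \<partial>count_space UNIV)"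
  have [measurable]: "h \<in> borel_measurable m" using h by simp
  have "S = nsq m h"
  proof (cases "S < \<infinity>")
    case True
    \<comment> \<open>A one-point parameter space reduces the existence result for families to a
      single sequence.\<close>
    define N where "N = count_space {()}"
    have "nsq N (\<lambda>_. c \<gamma>) = ennreal ((cmod (c \<gamma>))\<^sup>2)" for \<gamma>
      by (simp add: nsq_def N_def nn_integral_count_space_finite)
    then have "(\<integral>\<^sup>+\<gamma>. nsq N (\<lambda>_. c \<gamma>) \<partial>count_space UNIV) < \<infinity>" using True by (simp add: S_def)
    then have "\<exists>Z. (\<lambda>(\<alpha>, x). Z \<alpha> x) \<in> borel_measurable (m \<Otimes>\<^sub>M N) \<and>
        (AE x in N. is_fourier_transform m (\<lambda>\<gamma>. c \<gamma>) (\<lambda>\<alpha>. Z \<alpha> x))"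
      by (intro fourier_transform_exists) simp
    then obtain Z where "AE x in N. is_fourier_transform m c (\<lambda>\<alpha>. Z \<alpha> x)" by blast
    then have "\<forall>x\<in>{()}. is_fourier_transform m c (\<lambda>\<alpha>. Z \<alpha> x)" unfolding N_def AE_count_space .
    then obtain g where g: "is_fourier_transform m c g" by blast
    have gL: "g \<in> L2 m" using g by (simp add: fourier_transform_iff)
    have i: "integrable m (\<lambda>\<alpha>. h \<alpha> * \<alpha> \<gamma>)" for \<gamma>
      using integrable_trig_mult[OF h trig_char[of 1 \<gamma>]] by simp
    have "AE \<alpha> in m. h \<alpha> - g \<alpha> = 0"
    proof (rule L1_uniqueness)
      show "integrable m (\<lambda>\<alpha>. h \<alpha> - g \<alpha>)" using h L2_integrable[OF gL] by simp
      show "(\<integral>\<alpha>. (h \<alpha> - g \<alpha>) * \<alpha> \<gamma> \<partial>m) = 0" for \<gamma>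
        using i L2_integrable_char[OF gL] fourier_transform_coeff[OF g]
        by (simp add: left_diff_distrib c_def)
    qed
    then have "nsq m h = nsq m g"
      unfolding nsq_def by (intro nn_integral_cong_AE) auto
    then show ?thesis using fourier_transform_parseval[OF g] by (simp add: S_def)
  next
    case False
    then have "S = \<infinity>" using top.not_eq_extremum[of S] by auto
    have "\<not> nsq m h < \<infinity>"
    proof
      assume "nsq m h < \<infinity>"
      then have hL: "h \<in> L2 m" by (simp add: L2_iff)
      have "S \<le> ennreal ((L2_norm m h)\<^sup>2)"
        unfolding S_def infsum_ennreal_eq_nn_integral[symmetric] nonneg_infsum_complete[OF zero_le]
      proof (rule SUP_least)
        fix F :: "'g set" assume "F \<in> {F. finite F \<and> F \<subseteq> UNIV}"
        then have "finite F" by simp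
        from bessel[OF hL this] show "(\<Sum>\<gamma>\<in>F. ennreal ((cmod (c \<gamma>))\<^sup>2)) \<le> ennreal ((L2_norm m h)\<^sup>2)"
          by (simp add: c_def sum_ennreal ennreal_leI)
      qed
      then show False using \<open>S = \<infinity>\<close> by (simp add: top_unique)
    qed
    then show ?thesis using \<open>S = \<infinity>\<close> top.not_eq_extremum[of "nsq m h"] by auto
  qed
  then show ?thesis by (simp add: S_def c_def)
qed

end

subsection \<open>The Zak transform\<close>

locale zak_setting = haar_dual m + M: sigma_finite_measure M
  for m :: "('g::{ab_group_add, countable} \<Rightarrow> complex) measure" and M :: "'x measure" +
  fixes \<sigma> :: "'g \<Rightarrow> 'x \<Rightarrow> 'x" and J :: "'g \<Rightarrow> 'x \<Rightarrow> real" and C :: "'x set"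
  assumes action: "measurable_action M \<sigma>"
    and jacobian: "is_jacobian M \<sigma> J"
    and tiling: "tiling_set M \<sigma> C"
begin

declare eval_measurable [measurable del]

abbreviation "rep \<equiv> action_rep \<sigma> J"
abbreviation "MC \<equiv> restrict_space M C"

section \<open>The action, its Jacobian and the representation\<close>

lemma action_measurable [measurable]: "\<sigma> \<gamma> \<in> measurable M M"
  using action by (simp add: measurable_action_def)

lemma action_in_space: "x \<in> space M \<Longrightarrow> \<sigma> \<gamma> x \<in> space M"
  using measurable_space[OF action_measurable] .

lemma action_add: "x \<in> space M \<Longrightarrow> \<sigma> \<gamma> (\<sigma> \<delta> x) = \<sigma> (\<gamma> + \<delta>) x"
  using action by (simp add: measurable_action_def)

lemma action_inverse [simp]: "x \<in> space M \<Longrightarrow> \<sigma> \<gamma> (\<sigma> (- \<gamma>) x) = x" "x \<in> space M \<Longrightarrow> \<sigma> (- \<gamma>) (\<sigma> \<gamma> x) = x"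
  using action by (simp_all add: measurable_action_def)

lemma jacobian_measurable [measurable]: "J \<gamma> \<in> borel_measurable M"
proof -
  have "(\<lambda>(\<gamma>, x). J \<gamma> x) \<in> borel_measurable (count_space UNIV \<Otimes>\<^sub>M M)"
    using jacobian by (simp add: is_jacobian_def)
  from measurable_Pair2[OF this, of \<gamma>] show ?thesis by simp
qed

lemma jacobian_pos: "x \<in> space M \<Longrightarrow> 0 < J \<gamma> x"
  using jacobian by (simp add: is_jacobian_def)

lemma C_sets [measurable]: "C \<in> sets M"
  using tiling by (simp add: tiling_set_def)

lemma image_action:
  assumes "E \<in> sets M" shows "\<sigma> \<gamma> ` E = \<sigma> (- \<gamma>) -` E \<inter> space M"
proof (intro equalityI subsetI)
  fix y assume "y \<in> \<sigma> \<gamma> ` E"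
  then obtain x where "x \<in> E" "y = \<sigma> \<gamma> x" "x \<in> space M" using sets.sets_into_space[OF assms] by auto
  then show "y \<in> \<sigma> (- \<gamma>) -` E \<inter> space M" by (auto simp: action_in_space)
next
  fix y assume "y \<in> \<sigma> (- \<gamma>) -` E \<inter> space M"
  then show "y \<in> \<sigma> \<gamma> ` E" by (intro image_eqI[of _ _ "\<sigma> (- \<gamma>) y"]) auto
qed

text \<open>This form yields change of variables. The sign flips because an image under
  \<open>\<sigma> \<gamma>\<close> is a preimage under \<open>\<sigma> (- \<gamma>)\<close>.\<close>

lemma distr_action: "distr M M (\<sigma> (- \<gamma>)) = density M (\<lambda>x. ennreal (J \<gamma> x))"
proof (rule measure_eqI)
  fix E assume "E \<in> sets (distr M M (\<sigma> (- \<gamma>)))"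
  then have E: "E \<in> sets M" by simp
  have "emeasure (distr M M (\<sigma> (- \<gamma>))) E = emeasure M (\<sigma> \<gamma> ` E)"
    using E by (simp add: emeasure_distr image_action)
  also have "\<dots> = (\<integral>\<^sup>+x\<in>E. ennreal (J \<gamma> x) \<partial>M)"
    using jacobian E by (simp add: is_jacobian_def)
  finally show "emeasure (distr M M (\<sigma> (- \<gamma>))) E = emeasure (density M (\<lambda>x. ennreal (J \<gamma> x))) E"
    using E by (simp add: emeasure_density)
qed simp

lemma nn_integral_action:
  assumes [measurable]: "f \<in> borel_measurable M"
  shows "(\<integral>\<^sup>+x. f (\<sigma> (- \<gamma>) x) \<partial>M) = (\<integral>\<^sup>+x. ennreal (J \<gamma> x) * f x \<partial>M)"
proof -
  have "(\<integral>\<^sup>+x. f (\<sigma> (- \<gamma>) x) \<partial>M) = (\<integral>\<^sup>+x. f x \<partial>distr M M (\<sigma> (- \<gamma>)))"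
    by (simp add: nn_integral_distr)
  then show ?thesis by (simp add: distr_action nn_integral_density)
qed

text \<open>The chain rule: both sides are densities of the push-forward by
  \<open>\<sigma> (- (\<gamma> + \<delta>))\<close>, and densities for a sigma-finite measure are
  unique almost everywhere. A Jacobian is determined only up to null sets, so no pointwise identity
  can be expected.\<close>

lemma jacobian_cocycle: "AE x in M. J (\<gamma> + \<delta>) x = J \<gamma> (\<sigma> \<delta> x) * J \<delta> x"
proof -
  have "density M (\<lambda>x. ennreal (J (\<gamma> + \<delta>) x)) = density M (\<lambda>x. ennreal (J \<delta> x) * ennreal (J \<gamma> (\<sigma> \<delta> x)))"
  proof (rule measure_eqI)
    fix E assume "E \<in> sets (density M (\<lambda>x. ennreal (J (\<gamma> + \<delta>) x)))"
    then have E [measurable]: "E \<in> sets M" by simp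
    have "emeasure (density M (\<lambda>x. ennreal (J (\<gamma> + \<delta>) x))) E = (\<integral>\<^sup>+x. indicator E (\<sigma> (- (\<gamma> + \<delta>)) x) \<partial>M)"
      by (subst nn_integral_action) (auto simp: emeasure_density)
    also have "\<dots> = (\<integral>\<^sup>+x. indicator E (\<sigma> (- \<delta>) (\<sigma> (- \<gamma>) x)) \<partial>M)"
      by (intro nn_integral_cong) (simp only: action_add minus_add)
    also have "\<dots> = (\<integral>\<^sup>+x. ennreal (J \<gamma> x) * indicator E (\<sigma> (- \<delta>) x) \<partial>M)"
      by (rule nn_integral_action[of "\<lambda>x. indicator E (\<sigma> (- \<delta>) x)"]) measurable
    also have "\<dots> = (\<integral>\<^sup>+x. (\<lambda>y. ennreal (J \<gamma> (\<sigma> \<delta> y)) * indicator E y) (\<sigma> (- \<delta>) x) \<partial>M)"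
      by (intro nn_integral_cong) simp
    also have "\<dots> = (\<integral>\<^sup>+x. ennreal (J \<delta> x) * (ennreal (J \<gamma> (\<sigma> \<delta> x)) * indicator E x) \<partial>M)"
      by (rule nn_integral_action) measurable
    also have "\<dots> = emeasure (density M (\<lambda>x. ennreal (J \<delta> x) * ennreal (J \<gamma> (\<sigma> \<delta> x)))) E"
      by (simp add: emeasure_density mult.assoc)
    finally show "emeasure (density M (\<lambda>x. ennreal (J (\<gamma> + \<delta>) x))) E = \<dots>" .
  qed simp
  then have "AE x in M. ennreal (J (\<gamma> + \<delta>) x) = ennreal (J \<delta> x) * ennreal (J \<gamma> (\<sigma> \<delta> x))"
    by (subst (asm) M.density_unique_iff) auto
  then show ?thesis
    using AE_space
  proof eventually_elim
    case (elim x)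
    then have "ennreal (J (\<gamma> + \<delta>) x) = ennreal (J \<gamma> (\<sigma> \<delta> x) * J \<delta> x)"
      by (simp add: ennreal_mult' jacobian_pos less_imp_le mult.commute)
    then show ?case using elim(2) jacobian_pos[OF elim(2)] jacobian_pos[OF action_in_space[OF elim(2)]]
      by (subst (asm) ennreal_inj) (auto intro!: less_imp_le)
  qed
qed

lemma rep_measurable:
  assumes [measurable]: "\<psi> \<in> borel_measurable M" shows "rep \<gamma> \<psi> \<in> borel_measurable M"
  unfolding action_rep_def[abs_def] by measurable

text \<open>Each \<open>\<delta>\<close> has its own null set from the cocycle identity.
  Countability of the group merges them, so that for almost every \<open>x\<close> the whole
  sequence in \<open>\<delta>\<close> is the shifted one.\<close>

lemma rep_rep: "AE x in M. \<forall>\<delta>. rep \<delta> (rep \<gamma> \<psi>) x = rep (\<delta> + \<gamma>) \<psi> x"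
  unfolding AE_all_countable
proof
  fix \<delta>
  show "AE x in M. rep \<delta> (rep \<gamma> \<psi>) x = rep (\<delta> + \<gamma>) \<psi> x"
    using jacobian_cocycle[of "- \<gamma>" "- \<delta>"] AE_space
  proof eventually_elim
    case (elim x)
    have "J (- (\<delta> + \<gamma>)) x = J (- \<gamma>) (\<sigma> (- \<delta>) x) * J (- \<delta>) x"
      using elim(1) by (simp add: add.commute)
    moreover have "\<sigma> (- \<gamma>) (\<sigma> (- \<delta>) x) = \<sigma> (- (\<delta> + \<gamma>)) x"
      using action_add[OF elim(2)] by (simp add: add.commute)
    ultimately show ?case
      by (simp only: action_rep_def real_sqrt_mult of_real_mult mult_ac)
  qed
qed

lemma cmod_rep_sq: "x \<in> space M \<Longrightarrow> (cmod (rep \<gamma> \<psi> x))\<^sup>2 = J (- \<gamma>) x * (cmod (\<psi> (\<sigma> (- \<gamma>) x)))\<^sup>2"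
  using jacobian_pos[of x "- \<gamma>"] by (simp add: action_rep_def norm_mult power_mult_distrib)

text \<open>Change of variables with a cutoff. Taking \<open>B\<close> to be the whole space shows
  that \<open>rep\<close> preserves norms, and taking \<open>B = C\<close> isolates the mass of
  \<open>\<psi>\<close> that is moved into the tile.\<close>

lemma nn_integral_rep:
  assumes [measurable]: "\<psi> \<in> borel_measurable M" "B \<in> sets M"
  shows "(\<integral>\<^sup>+x. ennreal ((cmod (rep \<gamma> \<psi> x))\<^sup>2) * indicator B x \<partial>M)
    = (\<integral>\<^sup>+x. ennreal ((cmod (\<psi> x))\<^sup>2) * indicator B (\<sigma> \<gamma> x) \<partial>M)"
proof -
  define f where "f x = ennreal ((cmod (\<psi> (\<sigma> (- \<gamma>) x)))\<^sup>2) * indicator B x" for x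
  have [measurable]: "f \<in> borel_measurable M" unfolding f_def[abs_def] by measurable
  have "(\<integral>\<^sup>+x. ennreal ((cmod (rep \<gamma> \<psi> x))\<^sup>2) * indicator B x \<partial>M) = (\<integral>\<^sup>+x. ennreal (J (- \<gamma>) x) * f x \<partial>M)"
    by (intro nn_integral_cong)
       (simp add: cmod_rep_sq f_def ennreal_mult' jacobian_pos less_imp_le mult.assoc)
  also have "\<dots> = (\<integral>\<^sup>+x. f (\<sigma> (- (- \<gamma>)) x) \<partial>M)" by (rule nn_integral_action[symmetric]) simp
  also have "\<dots> = (\<integral>\<^sup>+x. ennreal ((cmod (\<psi> x))\<^sup>2) * indicator B (\<sigma> \<gamma> x) \<partial>M)"
    by (intro nn_integral_cong) (simp add: f_def)
  finally show ?thesis .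
qed

lemma rep_L2: assumes "\<psi> \<in> L2 M" shows "rep \<gamma> \<psi> \<in> L2 M"
proof -
  have \<psi>: "\<psi> \<in> borel_measurable M" "nsq M \<psi> < \<infinity>" using assms by (auto simp: L2_iff)
  have "nsq M (rep \<gamma> \<psi>) = (\<integral>\<^sup>+x. ennreal ((cmod (rep \<gamma> \<psi> x))\<^sup>2) * indicator (space M) x \<partial>M)"
    unfolding nsq_def by (intro nn_integral_cong) simp
  also have "\<dots> = (\<integral>\<^sup>+x. ennreal ((cmod (\<psi> x))\<^sup>2) * indicator (space M) (\<sigma> \<gamma> x) \<partial>M)"
    by (rule nn_integral_rep[OF \<psi>(1)]) simp
  also have "\<dots> = nsq M \<psi>"
    unfolding nsq_def by (intro nn_integral_cong) (simp add: action_in_space)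
  finally show ?thesis using \<psi> by (simp add: L2_iff rep_measurable)
qed

text \<open>Countability collects the pairwise overlaps and the uncovered part into one null set.
  The condition is placed on \<open>\<sigma> \<delta> x\<close> because this is the form in which
  cutoffs to \<open>C\<close> come out of \<open>nn_integral_rep\<close>.\<close>

lemma tiling_AE: "AE x in M. \<exists>\<gamma>. \<forall>\<delta>. \<sigma> \<delta> x \<in> C \<longleftrightarrow> \<delta> = \<gamma>"
proof -
  have meas: "\<sigma> \<gamma> ` C \<in> sets M" for \<gamma> unfolding image_action[OF C_sets] by measurable
  have dis: "AE x in M. x \<notin> \<sigma> \<gamma> ` C \<inter> \<sigma> \<gamma>' ` C" if "\<gamma> \<noteq> \<gamma>'" for \<gamma> \<gamma>'
    using that tiling meas by (intro AE_not_in) (auto simp: tiling_set_def null_sets_def)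
  have 1: "AE x in M. \<forall>\<gamma> \<gamma>'. \<gamma> \<noteq> \<gamma>' \<longrightarrow> x \<notin> \<sigma> \<gamma> ` C \<inter> \<sigma> \<gamma>' ` C"
    unfolding AE_all_countable
  proof (intro allI)
    fix \<gamma> \<gamma>'
    show "AE x in M. \<gamma> \<noteq> \<gamma>' \<longrightarrow> x \<notin> \<sigma> \<gamma> ` C \<inter> \<sigma> \<gamma>' ` C"
      using dis[of \<gamma> \<gamma>'] by (cases "\<gamma> = \<gamma>'") simp_all
  qed
  have 2: "AE x in M. x \<notin> space M - (\<Union>\<gamma>. \<sigma> \<gamma> ` C)"
    using tiling meas by (intro AE_not_in) (auto simp: tiling_set_def null_sets_def)
  show ?thesis
    using 1 2 AE_space
  proof eventually_elim
    case (elim x)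
    have iff: "x \<in> \<sigma> (- \<delta>) ` C \<longleftrightarrow> \<sigma> \<delta> x \<in> C" for \<delta>
      unfolding image_action[OF C_sets] using elim(3) by simp
    obtain \<gamma> where \<gamma>: "x \<in> \<sigma> \<gamma> ` C" using elim(2,3) by blast
    have "\<sigma> \<delta> x \<in> C \<longleftrightarrow> \<delta> = - \<gamma>" for \<delta>
      using \<gamma> iff[of "- \<gamma>"] iff[of \<delta>] elim(1) by (metis IntI minus_minus)
    then show ?case by blast
  qed
qed

section \<open>Restriction to the tile\<close>

lemma sigma_finite_MC: "sigma_finite_measure MC"
  using M.sigma_finite_measure_axioms by (intro sigma_finite_measure_restrict_space) auto

sublocale P: pair_sigma_finite m MC
proof -
  interpret N: sigma_finite_measure MC by (rule sigma_finite_MC)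
  show "pair_sigma_finite m MC" ..
qed

lemma measurable_MC: "f \<in> borel_measurable M \<Longrightarrow> f \<in> borel_measurable MC"
  by (rule measurable_restrict_space1)

lemma AE_MC: "AE x in M. P x \<Longrightarrow> AE x in MC. P x"
  by (subst AE_restrict_space_iff) (auto elim: eventually_mono)

text \<open>Almost every \<open>x\<close> is moved into \<open>C\<close> by exactly one group
  element, so the sum over \<open>\<gamma>\<close> counts its mass once.\<close>

lemma nn_integral_tiling:
  assumes \<psi> [measurable]: "\<psi> \<in> borel_measurable M"
  shows "(\<integral>\<^sup>+\<gamma>. nsq MC (rep \<gamma> \<psi>) \<partial>count_space UNIV) = nsq M \<psi>"
proof -
  have "nsq MC (rep \<gamma> \<psi>) = (\<integral>\<^sup>+x. ennreal ((cmod (\<psi> x))\<^sup>2) * indicator C (\<sigma> \<gamma> x) \<partial>M)" for \<gamma>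
    unfolding nsq_def nn_integral_rep[OF \<psi> C_sets, symmetric]
    by (rule nn_integral_restrict_space) simp
  then have "(\<integral>\<^sup>+\<gamma>. nsq MC (rep \<gamma> \<psi>) \<partial>count_space UNIV)
    = (\<integral>\<^sup>+\<gamma>. \<integral>\<^sup>+x. ennreal ((cmod (\<psi> x))\<^sup>2) * indicator C (\<sigma> \<gamma> x) \<partial>M \<partial>count_space UNIV)" by simp
  also have "\<dots> = (\<integral>\<^sup>+x. \<integral>\<^sup>+\<gamma>. ennreal ((cmod (\<psi> x))\<^sup>2) * indicator C (\<sigma> \<gamma> x) \<partial>count_space UNIV \<partial>M)"
    by (rule nn_integral_count_space_nn_integral[symmetric]) auto
  also have "\<dots> = nsq M \<psi>"
    unfolding nsq_def
  proof (intro nn_integral_cong_AE, use tiling_AE in eventually_elim)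
    case (elim x)
    then obtain \<gamma>0 where "\<And>\<gamma>. \<sigma> \<gamma> x \<in> C \<longleftrightarrow> \<gamma> = \<gamma>0" by blast
    then have "indicator C (\<sigma> \<gamma> x) = (indicator {\<gamma>0} \<gamma> :: ennreal)" for \<gamma>
      by (simp add: indicator_def)
    then show ?case by (simp add: nn_integral_cmult)
  qed
  finally show ?thesis .
qed

text \<open>The property selected by \<open>SOME\<close> in \<open>zak_transform\<close>, turned
  into a relation. Sums, multiples and translates can then be given representatives with formulas
  valid at every \<open>\<alpha>\<close>, which the chosen functions need not satisfy.\<close>

definition zak_rel :: "('x \<Rightarrow> complex) \<Rightarrow> (('g \<Rightarrow> complex) \<Rightarrow> 'x \<Rightarrow> complex) \<Rightarrow> bool" where
  "zak_rel \<psi> Z \<longleftrightarrow> (\<lambda>(\<alpha>, x). Z \<alpha> x) \<in> L2 (m \<Otimes>\<^sub>M MC) \<and>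
      (AE x in MC. is_fourier_transform m (\<lambda>\<gamma>. rep \<gamma> \<psi> x) (\<lambda>\<alpha>. Z \<alpha> x))"

text \<open>By Tonelli the integral over \<open>\<alpha>\<close> is taken first: Parseval applies
  for almost every fixed \<open>x\<close>, and the tiling reassembles the norm of
  \<open>\<psi>\<close>. Only measurability of \<open>Z\<close> is assumed, so the identity also
  proves its square integrability.\<close>

lemma nsq_fourier:
  assumes \<psi> [measurable]: "\<psi> \<in> borel_measurable M"
    and Z [measurable]: "(\<lambda>(\<alpha>, x). Z \<alpha> x) \<in> borel_measurable (m \<Otimes>\<^sub>M MC)"
    and ft: "AE x in MC. is_fourier_transform m (\<lambda>\<gamma>. rep \<gamma> \<psi> x) (\<lambda>\<alpha>. Z \<alpha> x)"
  shows "nsq (m \<Otimes>\<^sub>M MC) (\<lambda>(\<alpha>, x). Z \<alpha> x) = nsq M \<psi>"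
proof -
  have [measurable]: "rep \<gamma> \<psi> \<in> borel_measurable MC" for \<gamma>
    by (rule measurable_MC[OF rep_measurable[OF \<psi>]])
  have "nsq (m \<Otimes>\<^sub>M MC) (\<lambda>(\<alpha>, x). Z \<alpha> x) = (\<integral>\<^sup>+x. nsq m (\<lambda>\<alpha>. Z \<alpha> x) \<partial>MC)"
    unfolding nsq_def by (subst P.nn_integral_snd[symmetric]) (auto simp: split_beta')
  also have "\<dots> = (\<integral>\<^sup>+x. \<integral>\<^sup>+\<gamma>. ennreal ((cmod (rep \<gamma> \<psi> x))\<^sup>2) \<partial>count_space UNIV \<partial>MC)"
    by (intro nn_integral_cong_AE, use ft in eventually_elim) (rule fourier_transform_parseval)
  also have "\<dots> = (\<integral>\<^sup>+\<gamma>. nsq MC (rep \<gamma> \<psi>) \<partial>count_space UNIV)"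
    unfolding nsq_def
    by (rule nn_integral_count_space_nn_integral)
       auto
  also have "\<dots> = nsq M \<psi>" by (rule nn_integral_tiling[OF \<psi>])
  finally show ?thesis .
qed

lemma zak_exists:
  assumes \<psi>: "\<psi> \<in> L2 M" shows "\<exists>Z. zak_rel \<psi> Z"
proof -
  have \<psi>': "\<psi> \<in> borel_measurable M" "nsq M \<psi> < \<infinity>" using \<psi> by (auto simp: L2_iff)
  have "\<exists>Z. (\<lambda>(\<alpha>, x). Z \<alpha> x) \<in> borel_measurable (m \<Otimes>\<^sub>M MC) \<and>
    (AE x in MC. is_fourier_transform m (\<lambda>\<gamma>. rep \<gamma> \<psi> x) (\<lambda>\<alpha>. Z \<alpha> x))"
    by (rule fourier_transform_exists)
       (use \<psi>' in \<open>auto simp: nn_integral_tiling intro: measurable_MC rep_measurable\<close>)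
  then obtain Z where Z: "(\<lambda>(\<alpha>, x). Z \<alpha> x) \<in> borel_measurable (m \<Otimes>\<^sub>M MC)"
    "AE x in MC. is_fourier_transform m (\<lambda>\<gamma>. rep \<gamma> \<psi> x) (\<lambda>\<alpha>. Z \<alpha> x)" by blast
  then have "zak_rel \<psi> Z"
    using nsq_fourier[OF \<psi>'(1) Z] \<psi>'(2) by (simp add: zak_rel_def L2_iff)
  then show ?thesis by blast
qed

lemma zak_rel_zak_transform:
  assumes "\<psi> \<in> L2 M" shows "zak_rel \<psi> (zak_transform M m \<sigma> J C \<psi>)"
  using someI_ex[OF zak_exists[OF assms]] unfolding zak_transform_def zak_rel_def .

lemma zak_rel_norm:
  assumes "\<psi> \<in> L2 M" "zak_rel \<psi> Z"
  shows "L2_norm (m \<Otimes>\<^sub>M MC) (\<lambda>(\<alpha>, x). Z \<alpha> x) = L2_norm M \<psi>"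
proof -
  have "ennreal ((L2_norm (m \<Otimes>\<^sub>M MC) (\<lambda>(\<alpha>, x). Z \<alpha> x))\<^sup>2) = ennreal ((L2_norm M \<psi>)\<^sup>2)"
    using nsq_fourier[of \<psi> Z] assms nsq_eq_norm[of \<psi> M] nsq_eq_norm[of "\<lambda>(\<alpha>, x). Z \<alpha> x" "m \<Otimes>\<^sub>M MC"]
    by (auto simp: zak_rel_def L2_iff)
  then show ?thesis by (subst (asm) ennreal_inj) (auto simp: power2_eq_iff_nonneg)
qed

section \<open>Linearity, translations and inner products under the Zak transform\<close>

lemma rep_linear: "rep \<gamma> (\<lambda>x. c * \<psi> x + \<phi> x) y = c * rep \<gamma> \<psi> y + rep \<gamma> \<phi> y"
  by (simp add: action_rep_def algebra_simps)

lemma zak_rel_linear: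
  assumes Z: "zak_rel \<psi> Z" and W: "zak_rel \<phi> W"
  shows "zak_rel (\<lambda>x. c * \<psi> x + \<phi> x) (\<lambda>\<alpha> x. c * Z \<alpha> x + W \<alpha> x)"
proof -
  have "(\<lambda>p. c * (case p of (\<alpha>, x) \<Rightarrow> Z \<alpha> x) + (case p of (\<alpha>, x) \<Rightarrow> W \<alpha> x)) \<in> L2 (m \<Otimes>\<^sub>M MC)"
    using Z W by (intro L2_add L2_scale) (auto simp: zak_rel_def)
  moreover have "AE x in MC. is_fourier_transform m (\<lambda>\<gamma>. rep \<gamma> (\<lambda>x. c * \<psi> x + \<phi> x) x) (\<lambda>\<alpha>. c * Z \<alpha> x + W \<alpha> x)"
    unfolding rep_linear
    using Z[unfolded zak_rel_def, THEN conjunct2] W[unfolded zak_rel_def, THEN conjunct2]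
    by eventually_elim (rule fourier_transform_linear)
  ultimately show ?thesis by (simp add: zak_rel_def split_beta')
qed

lemma zak_rel_zero: "zak_rel (\<lambda>x. 0) (\<lambda>\<alpha> x. 0)"
proof -
  have "is_fourier_transform m (\<lambda>\<gamma>. 0) (\<lambda>\<alpha>. 0)"
    by (simp add: fourier_transform_iff fsum_def)
  then show ?thesis by (simp add: zak_rel_def action_rep_def split_beta')
qed

text \<open>At almost every \<open>x\<close> translation shifts the coefficient sequence, and a
  shift is multiplication by a character value.\<close>

lemma zak_rel_rep:
  assumes Z: "zak_rel \<psi> Z" shows "zak_rel (rep \<gamma> \<psi>) (\<lambda>\<alpha> x. \<alpha> \<gamma> * Z \<alpha> x)"
proof -
  have L: "(\<lambda>p. Z (fst p) (snd p)) \<in> L2 (m \<Otimes>\<^sub>M MC)" using Z by (simp add: zak_rel_def split_beta')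
  have [measurable]: "(\<lambda>p. Z (fst p) (snd p)) \<in> borel_measurable (m \<Otimes>\<^sub>M MC)" using L by (rule L2_measurable)
  have [measurable]: "(\<lambda>p. fst p \<gamma>) \<in> borel_measurable (m \<Otimes>\<^sub>M MC)"
    by (rule measurable_compose[OF measurable_fst eval_measurable])
  have "nsq (m \<Otimes>\<^sub>M MC) (\<lambda>p. fst p \<gamma> * Z (fst p) (snd p)) = nsq (m \<Otimes>\<^sub>M MC) (\<lambda>p. Z (fst p) (snd p))"
    unfolding nsq_def by (intro nn_integral_cong) (auto simp: space_pair_measure norm_mult dual_groupD)
  then have "(\<lambda>p. fst p \<gamma> * Z (fst p) (snd p)) \<in> L2 (m \<Otimes>\<^sub>M MC)" using L by (simp add: L2_iff)
  moreover have "AE x in MC. is_fourier_transform m (\<lambda>\<delta>. rep \<delta> (rep \<gamma> \<psi>) x) (\<lambda>\<alpha>. \<alpha> \<gamma> * Z \<alpha> x)"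
    using Z[unfolded zak_rel_def, THEN conjunct2] AE_MC[OF rep_rep[of \<gamma> \<psi>]]
  proof eventually_elim
    case (elim x)
    from fourier_transform_shift[OF elim(1), of \<gamma>] elim(2) show ?case by simp
  qed
  ultimately show ?thesis by (simp add: zak_rel_def split_beta')
qed

text \<open>Linearity and the norm identity give equal inner products by polarization, and Fubini
  splits the one on the product. The fiberwise inner product comes out integrable, not square
  integrable, hence the need for \<open>plancherel_L1\<close>.\<close>

lemma zak_rel_inner:
  assumes f: "f \<in> L2 M" "zak_rel f W" and g: "g \<in> L2 M" "zak_rel g W'"
  shows "L2_inner M f g = (\<integral>\<alpha>. L2_inner MC (W \<alpha>) (W' \<alpha>) \<partial>m)"
    and "integrable m (\<lambda>\<alpha>. L2_inner MC (W \<alpha>) (W' \<alpha>))"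
proof -
  define w where "w = (\<lambda>(\<alpha>, x). W \<alpha> x)"
  define w' where "w' = (\<lambda>(\<alpha>, x). W' \<alpha> x)"
  have w: "w \<in> L2 (m \<Otimes>\<^sub>M MC)" "w' \<in> L2 (m \<Otimes>\<^sub>M MC)"
    using f g by (auto simp: zak_rel_def w_def w'_def)
  have n: "L2_norm M (\<lambda>x. f x + c * g x) = L2_norm (m \<Otimes>\<^sub>M MC) (\<lambda>p. w p + c * w' p)" for c
    using zak_rel_norm[OF _ zak_rel_linear[OF g(2) f(2), of c]] L2_add[OF f(1) L2_scale[OF g(1), of c]]
    by (simp add: add.commute split_beta' w_def w'_def)
  have "4 * L2_inner M f g = 4 * L2_inner (m \<Otimes>\<^sub>M MC) w w'"
    unfolding L2_inner_polarization[OF f(1) g(1)] L2_inner_polarization[OF w] n n[of 1, simplified] ..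
  then have "L2_inner M f g = L2_inner (m \<Otimes>\<^sub>M MC) w w'" by simp
  also have "\<dots> = (\<integral>\<alpha>. L2_inner MC (W \<alpha>) (W' \<alpha>) \<partial>m)"
    using P.integral_fst'[OF L2_integrable_inner[OF w]] by (simp add: L2_inner_def w_def w'_def)
  finally show "L2_inner M f g = (\<integral>\<alpha>. L2_inner MC (W \<alpha>) (W' \<alpha>) \<partial>m)" .
  show "integrable m (\<lambda>\<alpha>. L2_inner MC (W \<alpha>) (W' \<alpha>))"
    using P.integrable_fst'[OF L2_integrable_inner[OF w]] by (simp add: L2_inner_def w_def w'_def)
qed

lemma sum_inner_rep:
  assumes f: "f \<in> L2 M" "zak_rel f W" and g: "g \<in> L2 M" "zak_rel g W'"
  shows "(\<integral>\<^sup>+\<gamma>. ennreal ((cmod (L2_inner M f (rep \<gamma> g)))\<^sup>2) \<partial>count_space UNIV)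
    = (\<integral>\<^sup>+\<alpha>. ennreal ((cmod (L2_inner MC (W \<alpha>) (W' \<alpha>)))\<^sup>2) \<partial>m)"
proof -
  define h where "h \<alpha> = L2_inner MC (W \<alpha>) (W' \<alpha>)" for \<alpha>
  have h: "integrable m h" unfolding h_def[abs_def] by (rule zak_rel_inner(2)[OF f g])
  have "L2_inner M f (rep \<gamma> g) = (\<integral>\<alpha>. h \<alpha> * \<alpha> (- \<gamma>) \<partial>m)" for \<gamma>
  proof -
    have "L2_inner M f (rep \<gamma> g) = (\<integral>\<alpha>. L2_inner MC (W \<alpha>) (\<lambda>x. \<alpha> \<gamma> * W' \<alpha> x) \<partial>m)"
      by (rule zak_rel_inner(1)[OF f rep_L2[OF g(1)] zak_rel_rep[OF g(2)]])
    also have "\<dots> = (\<integral>\<alpha>. h \<alpha> * \<alpha> (- \<gamma>) \<partial>m)"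
    proof (rule Bochner_Integration.integral_cong[OF refl])
      fix \<alpha> assume "\<alpha> \<in> space m"
      then have \<alpha>: "\<alpha> (- \<gamma>) = cnj (\<alpha> \<gamma>)" by (simp add: dual_groupD)
      have "L2_inner MC (W \<alpha>) (\<lambda>x. \<alpha> \<gamma> * W' \<alpha> x) = (\<integral>x. cnj (\<alpha> \<gamma>) * (W \<alpha> x * cnj (W' \<alpha> x)) \<partial>MC)"
        unfolding L2_inner_def by (intro Bochner_Integration.integral_cong) (auto simp: mult_ac)
      then show "L2_inner MC (W \<alpha>) (\<lambda>x. \<alpha> \<gamma> * W' \<alpha> x) = h \<alpha> * \<alpha> (- \<gamma>)"
        by (simp add: \<alpha> h_def L2_inner_def mult.commute)
    qed
    finally show ?thesis .
  qed
  then have "(\<integral>\<^sup>+\<gamma>. ennreal ((cmod (L2_inner M f (rep \<gamma> g)))\<^sup>2) \<partial>count_space UNIV)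
    = (\<integral>\<^sup>+\<gamma>. ennreal ((cmod (\<integral>\<alpha>. h \<alpha> * \<alpha> (- \<gamma>) \<partial>m))\<^sup>2) \<partial>count_space UNIV)" by simp
  \<comment> \<open>The character leaves the second slot conjugated, as a value at
    \<open>- \<gamma>\<close>; negation permutes the group and leaves the sum unchanged.\<close>
  also have "\<dots> = (\<integral>\<^sup>+\<gamma>. ennreal ((cmod (\<integral>\<alpha>. h \<alpha> * \<alpha> \<gamma> \<partial>m))\<^sup>2) \<partial>count_space UNIV)"
    by (rule nn_integral_bij_count_space[of uminus UNIV UNIV "\<lambda>\<gamma>. ennreal ((cmod (\<integral>\<alpha>. h \<alpha> * \<alpha> \<gamma> \<partial>m))\<^sup>2)"])
       (rule bij_uminus)
  also have "\<dots> = nsq m h" by (rule plancherel_L1[OF h])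
  finally show ?thesis by (simp add: nsq_def h_def)
qed

end

subsection \<open>Frame sums and approximation\<close>

text \<open>Written as an integral over a counting measure, so that Tonelli can exchange it with
  integration over the dual group.\<close>

definition frame_sum :: "'a measure \<Rightarrow> 'i set \<Rightarrow> ('i \<Rightarrow> 'a \<Rightarrow> complex) \<Rightarrow> ('a \<Rightarrow> complex) \<Rightarrow> ennreal" where
  "frame_sum M I F f = (\<integral>\<^sup>+i. ennreal ((cmod (L2_inner M f (F i)))\<^sup>2) \<partial>count_space I)"

lemma L2_closed_span_L2: "f \<in> L2_closed_span M S \<Longrightarrow> f \<in> L2 M"
  by (simp add: L2_closed_span_def)

lemma L2_frame_iff:
  "L2_frame M (L2_closed_span M S) I F A B \<longleftrightarrow>
    countable I \<and> 0 < A \<and> A \<le> B \<and> (\<forall>i\<in>I. F i \<in> L2_closed_span M S) \<and>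
    (\<forall>f\<in>L2_closed_span M S. ennreal A * nsq M f \<le> frame_sum M I F f \<and> frame_sum M I F f \<le> ennreal B * nsq M f)"
  unfolding L2_frame_def frame_sum_def infsum_ennreal_eq_nn_integral
  by (intro conj_cong ball_cong refl) (simp_all add: nsq_eq_norm[OF L2_closed_span_L2] ennreal_mult')

text \<open>A formal combination is a list of coefficients and indices, so one list can be evaluated
  both on the functions and on all their fibers. Lists over a countable set form a countable
  set.\<close>

primrec lcomb :: "('i \<Rightarrow> 'a \<Rightarrow> complex) \<Rightarrow> (complex \<times> 'i) list \<Rightarrow> 'a \<Rightarrow> complex" where
  "lcomb F [] = (\<lambda>x. 0)"
| "lcomb F (p # ps) = (\<lambda>x. fst p * F (snd p) x + lcomb F ps x)"

lemma lcomb_cspan: "ps \<in> lists (D \<times> I) \<Longrightarrow> lcomb F ps \<in> cspan (F ` I)"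
proof (induction ps)
  case Nil
  show ?case using cspan_zero[of "F ` I"] by (simp add: zero_fun_def)
next
  case (Cons p ps)
  then have "F (snd p) \<in> F ` I" "lcomb F ps \<in> cspan (F ` I)" by auto
  then have "(\<lambda>x. fst p * F (snd p) x) + lcomb F ps \<in> cspan (F ` I)"
    using cspan_add[OF cspan_scale[OF cspan_base]] by blast
  then show ?case by (simp add: plus_fun_def)
qed

text \<open>Induction along the span, replacing one coefficient at a time by a nearby element of
  \<open>D\<close>. Membership in \<open>L2\<close> is carried along for the triangle
  inequality.\<close>

lemma lcomb_dense:
  assumes F: "F ` I \<subseteq> L2 M"
    and D: "\<And>X. open X \<Longrightarrow> X \<noteq> {} \<Longrightarrow> \<exists>d\<in>D. d \<in> X"
    and v: "v \<in> cspan (F ` I)" and e: "0 < e"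
  shows "\<exists>ps\<in>lists (D \<times> I). L2_norm M (\<lambda>x. v x - lcomb F ps x) < e"
proof -
  have "v \<in> L2 M \<and> (\<forall>e>0. \<exists>ps\<in>lists (D \<times> I). L2_norm M (\<lambda>x. v x - lcomb F ps x) < e)"
    using v
  proof (induction rule: cspan_induct_alt)
    case base
    then show ?case by (auto simp: zero_fun_def intro!: bexI[of _ "[]"])
  next
    case (step c w y)
    then obtain i where i: "i \<in> I" "w = F i" by auto
    then have w: "F i \<in> L2 M" using F by auto
    have cs: "lcomb F ps \<in> L2 M" if "ps \<in> lists (D \<times> I)" for ps
      using lcomb_cspan[OF that, of F] cspan_subset_L2[OF F] by auto
    have "y \<in> L2 M" using step.IH by simp
    show ?case
    proof (intro conjI allI impI)
      show "(\<lambda>x. c * w x) + y \<in> L2 M"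
        using L2_add[OF L2_scale[OF w, of c] \<open>y \<in> L2 M\<close>] by (simp add: i plus_fun_def)
      fix e :: real assume e: "0 < e"
      \<comment> \<open>This radius keeps the error from the new coefficient at
        \<open>e / 2\<close>; the \<open>+ 1\<close> avoids division by 0 when \<open>F i\<close>
        has norm 0.\<close>
      define r where "r = e / (2 * (L2_norm M (F i) + 1))"
      have r: "0 < r" using e by (auto simp: r_def intro!: divide_pos_pos add_nonneg_pos)
      obtain d where d: "d \<in> D" "cmod (c - d) < r"
        using D[of "ball c r"] r by (auto simp: dist_norm)
      obtain ps where ps: "ps \<in> lists (D \<times> I)" "L2_norm M (\<lambda>x. y x - lcomb F ps x) < e / 2"
        using step.IH e by (metis half_gt_zero)
      have "L2_norm M (\<lambda>x. (c - d) * F i x + (y x - lcomb F ps x))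
        \<le> cmod (c - d) * L2_norm M (F i) + L2_norm M (\<lambda>x. y x - lcomb F ps x)"
        using L2_norm_triangle[OF L2_scale[OF w] L2_diff[OF \<open>y \<in> L2 M\<close> cs[OF ps(1)]], of "c - d"]
        by (simp add: L2_norm_scale)
      also have "cmod (c - d) * L2_norm M (F i) \<le> r * (L2_norm M (F i) + 1)"
        using d(2) r by (intro mult_mono) auto
      also have "\<dots> = e / 2"
        using L2_norm_nonneg[of M "F i"] by (simp add: r_def field_simps add_nonneg_eq_0_iff)
      finally have "L2_norm M (\<lambda>x. (c * w x + y x) - lcomb F ((d, i) # ps) x) < e"
        using ps(2) by (simp add: i algebra_simps)
      then show "\<exists>ps\<in>lists (D \<times> I). L2_norm M (\<lambda>x. ((\<lambda>x. c * w x) + y) x - lcomb F ps x) < e"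
        using d(1) i ps(1) by (intro bexI[of _ "(d, i) # ps"]) (auto simp: plus_fun_def)
    qed
  qed
  then show ?thesis using e by blast
qed

text \<open>The upper bound passes to the closure through finite partial sums. Continuity of the
  full frame sum is not given in advance; for the lower bound it is replaced by the upper bound
  applied to the difference between \<open>f\<close> and its approximant.\<close>

lemma frame_bounds_closure:
  assumes F: "F ` I \<subseteq> L2 M"
    and D: "\<And>X. open X \<Longrightarrow> X \<noteq> {} \<Longrightarrow> \<exists>d\<in>D. d \<in> X"
    and AB: "0 < A" "A \<le> B"
    and lower: "\<And>ps. ps \<in> lists (D \<times> I) \<Longrightarrow> ennreal A * nsq M (lcomb F ps) \<le> frame_sum M I F (lcomb F ps)"
    and upper: "\<And>ps. ps \<in> lists (D \<times> I) \<Longrightarrow> frame_sum M I F (lcomb F ps) \<le> ennreal B * nsq M (lcomb F ps)"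
    and f: "f \<in> L2_closed_span M (F ` I)"
  shows "ennreal A * nsq M f \<le> frame_sum M I F f" "frame_sum M I F f \<le> ennreal B * nsq M f"
proof -
  have cs: "lcomb F ps \<in> L2 M" if "ps \<in> lists (D \<times> I)" for ps
    using lcomb_cspan[OF that, of F] cspan_subset_L2[OF F] by auto
  have approx: "\<exists>ps. (\<forall>n. ps n \<in> lists (D \<times> I)) \<and> (\<lambda>n. L2_norm M (\<lambda>x. h x - lcomb F (ps n) x)) \<longlonglongrightarrow> 0"
    if h: "h \<in> L2_closed_span M (F ` I)" for h
  proof -
    have "\<exists>ps\<in>lists (D \<times> I). L2_norm M (\<lambda>x. h x - lcomb F ps x) < inverse (Suc n)" for n
    proof -
      have "0 < inverse (Suc n) / (2::real)" by simp
      then obtain g where g: "g \<in> cspan (F ` I)" "L2_norm M (\<lambda>x. h x - g x) < inverse (Suc n) / 2"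
        using h unfolding L2_closed_span_def by blast
      obtain ps where ps: "ps \<in> lists (D \<times> I)" "L2_norm M (\<lambda>x. g x - lcomb F ps x) < inverse (Suc n) / 2"
        using lcomb_dense[OF F D g(1), of "inverse (Suc n) / 2"] by auto
      have "L2_norm M (\<lambda>x. h x - lcomb F ps x) < inverse (Suc n)"
        using L2_norm_triangle_diff[OF L2_closed_span_L2[OF h] _ cs[OF ps(1)], of g] g ps(2)
          cspan_subset_L2[OF F] by auto
      then show ?thesis using ps(1) by blast
    qed
    then obtain ps where ps: "\<And>n. ps n \<in> lists (D \<times> I)"
      "\<And>n. L2_norm M (\<lambda>x. h x - lcomb F (ps n) x) < inverse (Suc n)" by metis
    have "(\<lambda>n. L2_norm M (\<lambda>x. h x - lcomb F (ps n) x)) \<longlonglongrightarrow> 0"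
      by (rule Lim_null_comparison[OF _ LIMSEQ_inverse_real_of_nat])
         (use ps(2) in \<open>auto intro!: always_eventually less_imp_le\<close>)
    then show ?thesis using ps(1) by blast
  qed
  have norm_lim: "(\<lambda>n. L2_norm M (lcomb F (ps n))) \<longlonglongrightarrow> L2_norm M h"
    if h: "h \<in> L2 M" and ps: "\<And>n. ps n \<in> lists (D \<times> I)"
      "(\<lambda>n. L2_norm M (\<lambda>x. h x - lcomb F (ps n) x)) \<longlonglongrightarrow> 0" for h ps
  proof -
    have "(\<lambda>n. L2_norm M (lcomb F (ps n)) - L2_norm M h) \<longlonglongrightarrow> 0"
      using L2_norm_diff_abs[OF h cs[OF ps(1)]]
      by (intro Lim_null_comparison[OF _ ps(2)] always_eventually) (auto simp: abs_minus_commute)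
    then show ?thesis by (simp only: Lim_null[symmetric])
  qed
  \<comment> \<open>Each finite partial sum is continuous in \<open>h\<close>. The bound is proved
    on the whole closed span because the approximation error, which need not be a combination, will
    be inserted for \<open>h\<close>.\<close>
  have up: "frame_sum M I F h \<le> ennreal (B * (L2_norm M h)\<^sup>2)" if h: "h \<in> L2_closed_span M (F ` I)" for h
    unfolding frame_sum_def infsum_ennreal_eq_nn_integral[symmetric] nonneg_infsum_complete[OF zero_le]
  proof (rule SUP_least)
    fix I0 assume I0: "I0 \<in> {I0. finite I0 \<and> I0 \<subseteq> I}"
    note hL = L2_closed_span_L2[OF h]
    obtain ps where ps: "\<And>n. ps n \<in> lists (D \<times> I)"
      "(\<lambda>n. L2_norm M (\<lambda>x. h x - lcomb F (ps n) x)) \<longlonglongrightarrow> 0" using approx[OF h] by blast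
    have inner: "(\<lambda>n. L2_inner M (lcomb F (ps n)) (F i)) \<longlonglongrightarrow> L2_inner M h (F i)" if "i \<in> I0" for i
    proof -
      have Fi: "F i \<in> L2 M" using that I0 F by auto
      have "(\<lambda>n. L2_norm M (\<lambda>x. h x - lcomb F (ps n) x) * L2_norm M (F i)) \<longlonglongrightarrow> 0 * L2_norm M (F i)"
        by (intro tendsto_intros ps(2))
      then have lim0: "(\<lambda>n. L2_norm M (\<lambda>x. h x - lcomb F (ps n) x) * L2_norm M (F i)) \<longlonglongrightarrow> 0" by simp
      have "(\<lambda>n. L2_inner M (lcomb F (ps n)) (F i) - L2_inner M h (F i)) \<longlonglongrightarrow> 0"
      proof (rule Lim_null_comparison[OF _ lim0], rule always_eventually, rule allI)
        fix n
        show "cmod (L2_inner M (lcomb F (ps n)) (F i) - L2_inner M h (F i))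
          \<le> L2_norm M (\<lambda>x. h x - lcomb F (ps n) x) * L2_norm M (F i)"
          using L2_inner_le[OF L2_diff[OF hL cs[OF ps(1)]] Fi, of n] L2_inner_diff_left[OF hL cs[OF ps(1)] Fi, of n]
          by (simp add: norm_minus_commute)
      qed
      then show ?thesis by (simp only: Lim_null[symmetric])
    qed
    have "(\<Sum>i\<in>I0. (cmod (L2_inner M h (F i)))\<^sup>2) \<le> B * (L2_norm M h)\<^sup>2"
    proof (rule LIMSEQ_le)
      show "(\<lambda>n. \<Sum>i\<in>I0. (cmod (L2_inner M (lcomb F (ps n)) (F i)))\<^sup>2) \<longlonglongrightarrow> (\<Sum>i\<in>I0. (cmod (L2_inner M h (F i)))\<^sup>2)"
        by (intro tendsto_intros inner)
      show "(\<lambda>n. B * (L2_norm M (lcomb F (ps n)))\<^sup>2) \<longlonglongrightarrow> B * (L2_norm M h)\<^sup>2"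
        by (intro tendsto_intros norm_lim hL ps)
      have "(\<Sum>i\<in>I0. (cmod (L2_inner M (lcomb F (ps n)) (F i)))\<^sup>2) \<le> B * (L2_norm M (lcomb F (ps n)))\<^sup>2" for n
      proof -
        have "ennreal (\<Sum>i\<in>I0. (cmod (L2_inner M (lcomb F (ps n)) (F i)))\<^sup>2)
          = (\<Sum>i\<in>I0. ennreal ((cmod (L2_inner M (lcomb F (ps n)) (F i)))\<^sup>2))" by simp
        also have "\<dots> \<le> frame_sum M I F (lcomb F (ps n))"
          unfolding frame_sum_def infsum_ennreal_eq_nn_integral[symmetric] nonneg_infsum_complete[OF zero_le]
          using I0 by (intro SUP_upper) auto
        also have "\<dots> \<le> ennreal (B * (L2_norm M (lcomb F (ps n)))\<^sup>2)"
          using upper[OF ps(1), of n] AB by (simp add: nsq_eq_norm[OF cs[OF ps(1)]] ennreal_mult')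
        finally show ?thesis using AB by (subst (asm) ennreal_le_iff) auto
      qed
      then show "\<exists>N. \<forall>n\<ge>N. (\<Sum>i\<in>I0. (cmod (L2_inner M (lcomb F (ps n)) (F i)))\<^sup>2) \<le> B * (L2_norm M (lcomb F (ps n)))\<^sup>2"
        by blast
    qed
    then show "(\<Sum>i\<in>I0. ennreal ((cmod (L2_inner M h (F i)))\<^sup>2)) \<le> ennreal (B * (L2_norm M h)\<^sup>2)"
      by (simp add: ennreal_leI)
  qed
  note fL = L2_closed_span_L2[OF f]
  show "frame_sum M I F f \<le> ennreal B * nsq M f"
    using up[OF f] AB by (simp add: nsq_eq_norm[OF fL] ennreal_mult')
  have "frame_sum M I F f < \<infinity>"
    by (rule le_less_trans[OF up[OF f]]) simp
  then obtain s where s: "0 \<le> s" "frame_sum M I F f = ennreal s" by (rule ennreal_finiteE)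
  obtain ps where ps: "\<And>n. ps n \<in> lists (D \<times> I)"
    "(\<lambda>n. L2_norm M (\<lambda>x. f x - lcomb F (ps n) x)) \<longlonglongrightarrow> 0" using approx[OF f] by blast
  \<comment> \<open>The weighted inequality splits the frame sum of an approximant into those of
    \<open>f\<close> and of the error. The error disappears as \<open>n\<close> grows, and only
    afterwards does \<open>t\<close> tend to 0.\<close>
  have bound: "A * (L2_norm M f)\<^sup>2 \<le> (1 + t) * s" if t: "0 < t" for t
  proof (rule LIMSEQ_le)
    show "(\<lambda>n. A * (L2_norm M (lcomb F (ps n)))\<^sup>2) \<longlonglongrightarrow> A * (L2_norm M f)\<^sup>2"
      by (intro tendsto_intros norm_lim fL ps)
    have "(\<lambda>n. (1 + t) * s + (1 + 1/t) * (B * (L2_norm M (\<lambda>x. f x - lcomb F (ps n) x))\<^sup>2))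
      \<longlonglongrightarrow> (1 + t) * s + (1 + 1/t) * (B * 0\<^sup>2)"
      by (intro tendsto_intros ps)
    then show "(\<lambda>n. (1 + t) * s + (1 + 1/t) * (B * (L2_norm M (\<lambda>x. f x - lcomb F (ps n) x))\<^sup>2)) \<longlonglongrightarrow> (1 + t) * s"
      by simp
    have "A * (L2_norm M (lcomb F (ps n)))\<^sup>2 \<le> (1 + t) * s + (1 + 1/t) * (B * (L2_norm M (\<lambda>x. f x - lcomb F (ps n) x))\<^sup>2)" for n
    proof -
      define l where "l = lcomb F (ps n)"
      define d where "d = (\<lambda>x. f x - l x)"
      have lL: "l \<in> L2 M" unfolding l_def by (rule cs[OF ps(1)])
      have lspan: "l \<in> cspan (F ` I)" unfolding l_def by (rule lcomb_cspan[OF ps(1)])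
      have dspan: "d \<in> L2_closed_span M (F ` I)"
        unfolding L2_closed_span_def
      proof (intro CollectI conjI allI impI)
        show "d \<in> L2 M" unfolding d_def by (rule L2_diff[OF fL lL])
        fix e :: real assume "0 < e"
        then obtain g where g: "g \<in> cspan (F ` I)" "L2_norm M (\<lambda>x. f x - g x) < e"
          using f unfolding L2_closed_span_def by blast
        have "g - l \<in> cspan (F ` I)" by (rule cspan_diff[OF g(1) lspan])
        moreover have "L2_norm M (\<lambda>x. d x - (g - l) x) < e" using g(2) by (simp add: d_def)
        ultimately show "\<exists>g\<in>cspan (F ` I). L2_norm M (\<lambda>x. d x - g x) < e" by blast
      qed
      have pw: "(cmod (L2_inner M l (F i)))\<^sup>2
        \<le> (1 + t) * (cmod (L2_inner M f (F i)))\<^sup>2 + (1 + 1/t) * (cmod (L2_inner M d (F i)))\<^sup>2" if "i \<in> I" for i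
      proof -
        have "L2_inner M l (F i) = L2_inner M f (F i) + - L2_inner M d (F i)"
          unfolding d_def using that F by (subst L2_inner_diff_left[OF fL lL]) auto
        then show ?thesis using norm_add_sq_le_weighted[OF t, of "L2_inner M f (F i)" "- L2_inner M d (F i)"] by simp
      qed
      have "ennreal (A * (L2_norm M l)\<^sup>2) = ennreal A * nsq M l"
        using AB by (simp add: nsq_eq_norm[OF lL] ennreal_mult')
      also have "\<dots> \<le> frame_sum M I F l" unfolding l_def by (rule lower[OF ps(1)])
      also have "\<dots> \<le> (\<integral>\<^sup>+i. ennreal (1 + t) * ennreal ((cmod (L2_inner M f (F i)))\<^sup>2)
          + ennreal (1 + 1/t) * ennreal ((cmod (L2_inner M d (F i)))\<^sup>2) \<partial>count_space I)"
        unfolding frame_sum_def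
      proof (rule nn_integral_mono)
        fix i assume "i \<in> space (count_space I)"
        then have "i \<in> I" by simp
        have nn: "0 \<le> 1 + t" "0 \<le> 1 + 1/t" using t by auto
        show "ennreal ((cmod (L2_inner M l (F i)))\<^sup>2) \<le> ennreal (1 + t) * ennreal ((cmod (L2_inner M f (F i)))\<^sup>2)
          + ennreal (1 + 1/t) * ennreal ((cmod (L2_inner M d (F i)))\<^sup>2)"
          unfolding ennreal_mult'[OF nn(1), symmetric] ennreal_mult'[OF nn(2), symmetric]
          using ennreal_leI[OF pw[OF \<open>i \<in> I\<close>]] nn by (subst (asm) ennreal_plus) auto
      qed
      also have "\<dots> = ennreal (1 + t) * frame_sum M I F f + ennreal (1 + 1/t) * frame_sum M I F d"
        unfolding frame_sum_def by (simp add: nn_integral_add nn_integral_cmult)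
      also have "\<dots> \<le> ennreal (1 + t) * ennreal s + ennreal (1 + 1/t) * ennreal (B * (L2_norm M d)\<^sup>2)"
        using up[OF dspan] s(2) by (intro add_mono mult_left_mono) auto
      also have "\<dots> = ennreal ((1 + t) * s + (1 + 1/t) * (B * (L2_norm M d)\<^sup>2))"
        using t s(1) AB by (subst ennreal_plus) (auto simp: ennreal_mult' intro!: mult_nonneg_nonneg)
      finally show ?thesis
        unfolding l_def[symmetric] d_def[symmetric]
        by (subst (asm) ennreal_le_iff) (use t s(1) AB in \<open>auto intro!: add_nonneg_nonneg mult_nonneg_nonneg\<close>)
    qed
    then show "\<exists>N. \<forall>n\<ge>N. A * (L2_norm M (lcomb F (ps n)))\<^sup>2
      \<le> (1 + t) * s + (1 + 1/t) * (B * (L2_norm M (\<lambda>x. f x - lcomb F (ps n) x))\<^sup>2)" by blast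
  qed
  have "A * (L2_norm M f)\<^sup>2 \<le> s"
  proof (rule LIMSEQ_le_const)
    have "(\<lambda>n. (1 + inverse (real (Suc n))) * s) \<longlonglongrightarrow> (1 + 0) * s"
      by (intro tendsto_intros LIMSEQ_inverse_real_of_nat)
    then show "(\<lambda>n. (1 + inverse (real (Suc n))) * s) \<longlonglongrightarrow> s" by simp
    show "\<exists>N. \<forall>n\<ge>N. A * (L2_norm M f)\<^sup>2 \<le> (1 + inverse (real (Suc n))) * s"
      using bound[of "inverse (real (Suc _))"] by auto
  qed
  then show "ennreal A * nsq M f \<le> frame_sum M I F f"
    using AB by (simp add: nsq_eq_norm[OF fL] s(2) ennreal_leI flip: ennreal_mult')
qed

lemma frame_sum_scale: "frame_sum N I F (\<lambda>x. c * f x) = ennreal ((cmod c)\<^sup>2) * frame_sum N I F f"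
proof -
  have "L2_inner N (\<lambda>x. c * f x) g = c * L2_inner N f g" for g
    by (simp add: L2_inner_def mult.assoc)
  then show ?thesis
    unfolding frame_sum_def by (simp add: norm_mult power_mult_distrib ennreal_mult nn_integral_cmult)
qed

subsection \<open>Frames and their fibers\<close>

context zak_setting begin

abbreviation "zak \<equiv> zak_transform M m \<sigma> J C"

lemma zak_rel_fiber:
  assumes "zak_rel \<psi> Z"
  shows "AE \<alpha> in m. Z \<alpha> \<in> L2 MC" "(\<lambda>\<alpha>. nsq MC (Z \<alpha>)) \<in> borel_measurable m"
    and "\<psi> \<in> L2 M \<Longrightarrow> (\<integral>\<^sup>+\<alpha>. nsq MC (Z \<alpha>) \<partial>m) = nsq M \<psi>"
proof -
  have L: "(\<lambda>(\<alpha>, x). Z \<alpha> x) \<in> L2 (m \<Otimes>\<^sub>M MC)" using assms by (simp add: zak_rel_def)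
  have [measurable]: "(\<lambda>(\<alpha>, x). Z \<alpha> x) \<in> borel_measurable (m \<Otimes>\<^sub>M MC)" by (rule L2_measurable[OF L])
  show meas: "(\<lambda>\<alpha>. nsq MC (Z \<alpha>)) \<in> borel_measurable m" unfolding nsq_def by measurable
  have int: "(\<integral>\<^sup>+\<alpha>. nsq MC (Z \<alpha>) \<partial>m) = nsq (m \<Otimes>\<^sub>M MC) (\<lambda>(\<alpha>, x). Z \<alpha> x)"
    unfolding nsq_def by (subst P.M2.nn_integral_fst[symmetric]) (auto simp: split_beta')
  then have "AE \<alpha> in m. nsq MC (Z \<alpha>) \<noteq> \<infinity>"
    using L meas by (intro nn_integral_PInf_AE) (auto simp: L2_iff)
  then show "AE \<alpha> in m. Z \<alpha> \<in> L2 MC"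
    using AE_space
  proof eventually_elim
    case (elim \<alpha>)
    have "(\<lambda>x. Z \<alpha> x) \<in> borel_measurable MC"
      using measurable_Pair2[OF L2_measurable[OF L], of \<alpha>] elim(2) by simp
    then show ?case using elim(1) by (simp add: L2_iff less_top)
  qed
  show "(\<integral>\<^sup>+\<alpha>. nsq MC (Z \<alpha>) \<partial>m) = nsq M \<psi>" if "\<psi> \<in> L2 M"
    unfolding int using assms that by (intro nsq_fourier) (auto simp: zak_rel_def L2_iff)
qed

text \<open>A translate contributes the scalar \<open>\<alpha> \<gamma>\<close> in the fiber, which
  is absorbed into the coefficient. Since the representative is built along the combination,
  membership in the fiber span holds at every \<open>\<alpha>\<close>.\<close>

lemma invariant_space_span:
  assumes A: "\<A> \<subseteq> L2 M" and g: "g \<in> cspan {rep \<gamma> \<phi> |\<gamma> \<phi>. \<phi> \<in> \<A>}"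
  shows "\<exists>W. zak_rel g W \<and> (\<forall>\<alpha>. W \<alpha> \<in> cspan ((\<lambda>\<phi>. zak \<phi> \<alpha>) ` \<A>))"
  using g
proof (induction rule: cspan_induct_alt)
  case base
  have "(\<lambda>x. 0) \<in> cspan ((\<lambda>\<phi>. zak \<phi> \<alpha>) ` \<A>)" for \<alpha>
    using cspan_zero by (simp add: zero_fun_def)
  then show ?case using zak_rel_zero by (auto simp: zero_fun_def)
next
  case (step c w y)
  then obtain \<gamma> \<phi> W where \<phi>: "\<phi> \<in> \<A>" "w = rep \<gamma> \<phi>" and W: "zak_rel y W"
    "\<And>\<alpha>. W \<alpha> \<in> cspan ((\<lambda>\<phi>. zak \<phi> \<alpha>) ` \<A>)" by blast
  have "zak_rel \<phi> (zak \<phi>)" using \<phi> A by (intro zak_rel_zak_transform) auto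
  from zak_rel_linear[OF zak_rel_rep[OF this, of \<gamma>] W(1), of c]
  have "zak_rel ((\<lambda>x. c * w x) + y) (\<lambda>\<alpha> x. c * (\<alpha> \<gamma> * zak \<phi> \<alpha> x) + W \<alpha> x)"
    by (simp add: \<phi> plus_fun_def)
  moreover have "(\<lambda>x. c * (\<alpha> \<gamma> * zak \<phi> \<alpha> x) + W \<alpha> x) \<in> cspan ((\<lambda>\<phi>. zak \<phi> \<alpha>) ` \<A>)" for \<alpha>
  proof -
    have "zak \<phi> \<alpha> \<in> (\<lambda>\<phi>. zak \<phi> \<alpha>) ` \<A>" using \<phi> by auto
    from cspan_add[OF cspan_scale[OF cspan_base[OF this], of "c * \<alpha> \<gamma>"] W(2)[of \<alpha>]]
    show ?thesis by (simp add: plus_fun_def mult.assoc)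
  qed
  ultimately show ?case by blast
qed

lemma rep_set_L2: "\<A> \<subseteq> L2 M \<Longrightarrow> {rep \<gamma> \<phi> |\<gamma> \<phi>. \<phi> \<in> \<A>} \<subseteq> L2 M"
  using rep_L2 by blast

text \<open>Approximation at the rate \<open>(1/2) ^ n\<close> makes the squared fiber errors
  summable in the mean, hence summable for almost every \<open>\<alpha>\<close>. So the fiber errors
  tend to 0 there, without passing to a subsequence.\<close>

lemma fiber_in_range_function:
  assumes A: "\<A> \<subseteq> L2 M" and f: "f \<in> invariant_space M \<sigma> J \<A>" and W: "zak_rel f W"
  shows "AE \<alpha> in m. W \<alpha> \<in> range_function M m \<sigma> J C \<A> \<alpha>"
proof -
  have fL: "f \<in> L2 M" using f by (simp add: invariant_space_def L2_closed_span_def)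
  have "\<forall>n::nat. \<exists>g. g \<in> cspan {rep \<gamma> \<phi> |\<gamma> \<phi>. \<phi> \<in> \<A>} \<and> L2_norm M (\<lambda>x. f x - g x) < (1/2) ^ n"
  proof
    fix n :: nat
    have "0 < (1/2::real) ^ n" by simp
    then show "\<exists>g. g \<in> cspan {rep \<gamma> \<phi> |\<gamma> \<phi>. \<phi> \<in> \<A>} \<and> L2_norm M (\<lambda>x. f x - g x) < (1/2) ^ n"
      using f unfolding invariant_space_def L2_closed_span_def by blast
  qed
  from choice[OF this] obtain g where g: "\<And>n. g n \<in> cspan {rep \<gamma> \<phi> |\<gamma> \<phi>. \<phi> \<in> \<A>}"
    "\<And>n::nat. L2_norm M (\<lambda>x. f x - g n x) < (1/2) ^ n" by blast
  have gL: "g n \<in> L2 M" for n using g(1) cspan_subset_L2[OF rep_set_L2[OF A]] by auto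
  have "\<forall>n. \<exists>W. zak_rel (g n) W \<and> (\<forall>\<alpha>. W \<alpha> \<in> cspan ((\<lambda>\<phi>. zak \<phi> \<alpha>) ` \<A>))"
    by (intro allI invariant_space_span[OF A g(1)])
  from choice[OF this] obtain W' where W': "\<And>n. zak_rel (g n) (W' n)"
    "\<And>n \<alpha>. W' n \<alpha> \<in> cspan ((\<lambda>\<phi>. zak \<phi> \<alpha>) ` \<A>)" by blast
  define d where "d n \<alpha> x = W \<alpha> x - W' n \<alpha> x" for n \<alpha> x
  have d: "zak_rel (\<lambda>x. f x - g n x) (d n)" for n
    using zak_rel_linear[OF W'(1) W, of "-1" n] by (simp add: d_def[abs_def])
  have L: "(\<lambda>x. f x - g n x) \<in> L2 M" for n by (rule L2_diff[OF fL gL])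
  have [measurable]: "(\<lambda>\<alpha>. nsq MC (d n \<alpha>)) \<in> borel_measurable m" for n by (rule zak_rel_fiber(2)[OF d])
  have "(\<integral>\<^sup>+\<alpha>. (\<Sum>n. nsq MC (d n \<alpha>)) \<partial>m) = (\<Sum>n. nsq M (\<lambda>x. f x - g n x))"
    by (simp add: nn_integral_suminf zak_rel_fiber(3)[OF d L])
  also have "\<dots> \<le> (\<Sum>n. ennreal ((1/4) ^ n))"
  proof (rule suminf_le)
    fix n
    have "(L2_norm M (\<lambda>x. f x - g n x))\<^sup>2 \<le> ((1/2) ^ n)\<^sup>2"
      using g(2)[of n] by (intro power_mono) auto
    also have "\<dots> = (1/4::real) ^ n" 
      unfolding power_mult[symmetric] mult.commute[of n 2] unfolding power_mult by (simp add: power2_eq_square)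
    finally show "nsq M (\<lambda>x. f x - g n x) \<le> ennreal ((1/4) ^ n)"
      by (simp add: nsq_eq_norm[OF L] ennreal_leI)
  qed auto
  also have "\<dots> = ennreal (\<Sum>n. (1/4) ^ n)"
    by (rule suminf_ennreal2) (auto intro: summable_geometric)
  also have "\<dots> < \<infinity>" by simp
  finally have "AE \<alpha> in m. (\<Sum>n. nsq MC (d n \<alpha>)) \<noteq> \<infinity>"
    by (intro nn_integral_PInf_AE) auto
  moreover have "AE \<alpha> in m. \<forall>n. d n \<alpha> \<in> L2 MC"
    unfolding AE_all_countable by (intro allI zak_rel_fiber(1)[OF d])
  ultimately show ?thesis
    using zak_rel_fiber(1)[OF W]
  proof eventually_elim
    case (elim \<alpha>)
    have "summable (\<lambda>n. (L2_norm MC (d n \<alpha>))\<^sup>2)"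
      using elim(1,2) by (intro summable_suminf_not_top) (auto simp: nsq_eq_norm)
    then have "(\<lambda>n. sqrt ((L2_norm MC (d n \<alpha>))\<^sup>2)) \<longlonglongrightarrow> sqrt 0"
      by (intro tendsto_intros summable_LIMSEQ_zero)
    then have lim: "(\<lambda>n. L2_norm MC (d n \<alpha>)) \<longlonglongrightarrow> 0" by simp
    show ?case
      unfolding range_function_def L2_closed_span_def
    proof (intro CollectI conjI allI impI)
      show "W \<alpha> \<in> L2 MC" by (rule elim(3))
      fix e :: real assume "0 < e"
      then obtain n where "L2_norm MC (d n \<alpha>) < e"
        using order_tendstoD(2)[OF lim] by (auto simp: eventually_sequentially)
      then show "\<exists>h\<in>cspan ((\<lambda>\<phi>. zak \<phi> \<alpha>) ` \<A>). L2_norm MC (\<lambda>x. W \<alpha> x - h x) < e"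
        using W'(2)[of n \<alpha>] by (intro bexI[of _ "W' n \<alpha>"]) (auto simp: d_def[abs_def])
    qed
  qed
qed

lemma frame_sum_measurable:
  assumes A: "\<A> \<subseteq> L2 M" "countable \<A>" and f: "f \<in> L2 M" "zak_rel f W"
  shows "(\<lambda>\<alpha>. frame_sum MC \<A> (\<lambda>\<phi>. zak \<phi> \<alpha>) (W \<alpha>)) \<in> borel_measurable m"
  unfolding frame_sum_def
proof (rule borel_measurable_nn_integral_count_space[OF A(2)])
  fix \<phi> assume "\<phi> \<in> \<A>"
  then have "integrable m (\<lambda>\<alpha>. L2_inner MC (W \<alpha>) (zak \<phi> \<alpha>))"
    using A(1) f by (intro zak_rel_inner(2)[OF f _ zak_rel_zak_transform]) auto
  then have [measurable]: "(\<lambda>\<alpha>. L2_inner MC (W \<alpha>) (zak \<phi> \<alpha>)) \<in> borel_measurable m" by simp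
  show "(\<lambda>\<alpha>. ennreal ((cmod (L2_inner MC (W \<alpha>) (zak \<phi> \<alpha>)))\<^sup>2)) \<in> borel_measurable m" by measurable
qed

text \<open>Tonelli on both sides of \<open>sum_inner_rep\<close>: summing over the group first
  permits Plancherel for each \<open>\<phi>\<close>, and the sum over \<open>\<A>\<close> then moves
  inside the integral.\<close>

lemma frame_sum_fiber:
  assumes A: "\<A> \<subseteq> L2 M" "countable \<A>" and f: "f \<in> L2 M" "zak_rel f W"
  shows "frame_sum M (UNIV \<times> \<A>) (\<lambda>(\<gamma>, \<phi>). rep \<gamma> \<phi>) f
    = (\<integral>\<^sup>+\<alpha>. frame_sum MC \<A> (\<lambda>\<phi>. zak \<phi> \<alpha>) (W \<alpha>) \<partial>m)"
proof -
  have "frame_sum M (UNIV \<times> \<A>) (\<lambda>(\<gamma>, \<phi>). rep \<gamma> \<phi>) f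
    = (\<integral>\<^sup>+\<phi>. \<integral>\<^sup>+\<gamma>. ennreal ((cmod (L2_inner M f (rep \<gamma> \<phi>)))\<^sup>2) \<partial>count_space UNIV \<partial>count_space \<A>)"
    unfolding frame_sum_def by (subst nn_integral_count_space_Times) (use A in auto)
  also have "\<dots> = (\<integral>\<^sup>+\<phi>. \<integral>\<^sup>+\<alpha>. ennreal ((cmod (L2_inner MC (W \<alpha>) (zak \<phi> \<alpha>)))\<^sup>2) \<partial>m \<partial>count_space \<A>)"
    using A(1) by (intro nn_integral_cong sum_inner_rep[OF f] zak_rel_zak_transform) auto
  also have "\<dots> = (\<integral>\<^sup>+\<alpha>. \<integral>\<^sup>+\<phi>. ennreal ((cmod (L2_inner MC (W \<alpha>) (zak \<phi> \<alpha>)))\<^sup>2) \<partial>count_space \<A> \<partial>m)"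
  proof (rule nn_integral_count_space_nn_integral[OF A(2), symmetric])
    fix \<phi> assume "\<phi> \<in> \<A>"
    then have "integrable m (\<lambda>\<alpha>. L2_inner MC (W \<alpha>) (zak \<phi> \<alpha>))"
      using A(1) f by (intro zak_rel_inner(2)[OF f _ zak_rel_zak_transform]) auto
    then have [measurable]: "(\<lambda>\<alpha>. L2_inner MC (W \<alpha>) (zak \<phi> \<alpha>)) \<in> borel_measurable m" by simp
    show "(\<lambda>\<alpha>. ennreal ((cmod (L2_inner MC (W \<alpha>) (zak \<phi> \<alpha>)))\<^sup>2)) \<in> borel_measurable m" by measurable
  qed
  finally show ?thesis by (simp add: frame_sum_def)
qed

lemma zak_rel_lcomb:
  assumes A: "\<A> \<subseteq> L2 M" and ps: "ps \<in> lists (D \<times> \<A>)"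
  shows "zak_rel (lcomb (\<lambda>\<phi>. \<phi>) ps) (\<lambda>\<alpha>. lcomb (\<lambda>\<phi>. zak \<phi> \<alpha>) ps)"
  using ps
proof (induction ps)
  case Nil
  then show ?case using zak_rel_zero by simp
next
  case (Cons p ps)
  then have "zak_rel (snd p) (zak (snd p))" using A by (intro zak_rel_zak_transform) auto
  from zak_rel_linear[OF this Cons.IH] Cons.hyps show ?case by simp
qed

lemma rep_lcomb: "rep \<gamma> (lcomb F ps) = lcomb (\<lambda>i. rep \<gamma> (F i)) ps"
proof (induction ps)
  case Nil
  then show ?case by (simp add: action_rep_def fun_eq_iff)
next
  case (Cons p ps)
  then show ?case by (simp add: rep_linear fun_eq_iff)
qed

text \<open>A monomial \<open>c * \<alpha> \<gamma>\<close> is realized by \<open>c\<close> times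
  the translate by \<open>\<gamma>\<close>, and translation commutes with formal
  combinations.\<close>

lemma trig_times_lcomb:
  assumes A: "\<A> \<subseteq> L2 M" and ps: "ps \<in> lists (D \<times> \<A>)" and p: "p \<in> trig"
  shows "\<exists>g\<in>cspan {rep \<gamma> \<phi> |\<gamma> \<phi>. \<phi> \<in> \<A>}. zak_rel g (\<lambda>\<alpha> x. p \<alpha> * lcomb (\<lambda>\<phi>. zak \<phi> \<alpha>) ps x)"
  using p
proof (induction rule: trig.induct)
  case (trig_char c \<gamma>)
  define l where "l = lcomb (\<lambda>\<phi>. \<phi>) ps"
  have "rep \<gamma> l \<in> cspan ((\<lambda>\<phi>. rep \<gamma> \<phi>) ` \<A>)"
    unfolding l_def rep_lcomb by (rule lcomb_cspan[OF ps])
  also have "\<dots> \<subseteq> cspan {rep \<gamma> \<phi> |\<gamma> \<phi>. \<phi> \<in> \<A>}"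
    by (rule module.span_mono[OF module_fun]) auto
  finally have "(\<lambda>x. c * rep \<gamma> l x) \<in> cspan {rep \<gamma> \<phi> |\<gamma> \<phi>. \<phi> \<in> \<A>}" by (rule cspan_scale)
  moreover have "zak_rel (\<lambda>x. c * rep \<gamma> l x) (\<lambda>\<alpha> x. c * \<alpha> \<gamma> * lcomb (\<lambda>\<phi>. zak \<phi> \<alpha>) ps x)"
    using zak_rel_linear[OF zak_rel_rep[OF zak_rel_lcomb[OF A ps], of \<gamma>] zak_rel_zero, of c]
    by (simp add: l_def mult.assoc)
  ultimately show ?case by blast
next
  case (trig_add p q)
  then obtain g h where g: "g \<in> cspan {rep \<gamma> \<phi> |\<gamma> \<phi>. \<phi> \<in> \<A>}" "zak_rel g (\<lambda>\<alpha> x. p \<alpha> * lcomb (\<lambda>\<phi>. zak \<phi> \<alpha>) ps x)"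
    and h: "h \<in> cspan {rep \<gamma> \<phi> |\<gamma> \<phi>. \<phi> \<in> \<A>}" "zak_rel h (\<lambda>\<alpha> x. q \<alpha> * lcomb (\<lambda>\<phi>. zak \<phi> \<alpha>) ps x)" by blast
  have "zak_rel (g + h) (\<lambda>\<alpha> x. (p \<alpha> + q \<alpha>) * lcomb (\<lambda>\<phi>. zak \<phi> \<alpha>) ps x)"
    using zak_rel_linear[OF g(2) h(2), of 1] by (simp add: plus_fun_def distrib_right)
  then show ?case using cspan_add[OF g(1) h(1)] by blast
qed

section \<open>The two implications between the frame conditions\<close>

lemma frame_of_fibers:
  assumes A: "\<A> \<subseteq> L2 M" "countable \<A>" and AB: "0 < A" "A \<le> B"
    and fib: "AE \<alpha> in m. L2_frame MC (range_function M m \<sigma> J C \<A> \<alpha>) \<A> (\<lambda>\<phi>. zak \<phi> \<alpha>) A B"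
  shows "L2_frame M (invariant_space M \<sigma> J \<A>) (UNIV \<times> \<A>) (\<lambda>(\<gamma>, \<phi>). rep \<gamma> \<phi>) A B"
  unfolding invariant_space_def L2_frame_iff
proof (intro conjI ballI AB)
  show "countable ((UNIV :: 'g set) \<times> \<A>)" using A by auto
  fix i :: "'g \<times> ('x \<Rightarrow> complex)" assume "i \<in> UNIV \<times> \<A>"
  then have "(case i of (\<gamma>, \<phi>) \<Rightarrow> rep \<gamma> \<phi>) \<in> {rep \<gamma> \<phi> |\<gamma> \<phi>. \<phi> \<in> \<A>}" by auto
  then show "(case i of (\<gamma>, \<phi>) \<Rightarrow> rep \<gamma> \<phi>) \<in> L2_closed_span M {rep \<gamma> \<phi> |\<gamma> \<phi>. \<phi> \<in> \<A>}"
    by (rule subsetD[OF cspan_subset_closed_span[OF rep_set_L2[OF A(1)]] cspan_base])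
next
  fix f assume f: "f \<in> L2_closed_span M {rep \<gamma> \<phi> |\<gamma> \<phi>. \<phi> \<in> \<A>}"
  then have fL: "f \<in> L2 M" and fV: "f \<in> invariant_space M \<sigma> J \<A>"
    by (auto simp: invariant_space_def L2_closed_span_L2)
  obtain W where W: "zak_rel f W" using zak_exists[OF fL] by blast
  note int = zak_rel_fiber(3)[OF W fL]
  note [measurable] = zak_rel_fiber(2)[OF W] frame_sum_measurable[OF A fL W]
  have ineq: "AE \<alpha> in m. ennreal A * nsq MC (W \<alpha>) \<le> frame_sum MC \<A> (\<lambda>\<phi>. zak \<phi> \<alpha>) (W \<alpha>) \<and>
      frame_sum MC \<A> (\<lambda>\<phi>. zak \<phi> \<alpha>) (W \<alpha>) \<le> ennreal B * nsq MC (W \<alpha>)"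
    using fib fiber_in_range_function[OF A(1) fV W]
    by eventually_elim (simp add: range_function_def L2_frame_iff)
  have "ennreal A * nsq M f = (\<integral>\<^sup>+\<alpha>. ennreal A * nsq MC (W \<alpha>) \<partial>m)"
    by (simp add: nn_integral_cmult int)
  also have "\<dots> \<le> frame_sum M (UNIV \<times> \<A>) (\<lambda>(\<gamma>, \<phi>). rep \<gamma> \<phi>) f"
    unfolding frame_sum_fiber[OF A fL W] by (rule nn_integral_mono_AE) (use ineq in eventually_elim, simp)
  finally show "ennreal A * nsq M f \<le> frame_sum M (UNIV \<times> \<A>) (\<lambda>(\<gamma>, \<phi>). rep \<gamma> \<phi>) f" .
  have "frame_sum M (UNIV \<times> \<A>) (\<lambda>(\<gamma>, \<phi>). rep \<gamma> \<phi>) f \<le> (\<integral>\<^sup>+\<alpha>. ennreal B * nsq MC (W \<alpha>) \<partial>m)"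
    unfolding frame_sum_fiber[OF A fL W] by (rule nn_integral_mono_AE) (use ineq in eventually_elim, simp)
  also have "\<dots> = ennreal B * nsq M f" by (simp add: nn_integral_cmult int)
  finally show "frame_sum M (UNIV \<times> \<A>) (\<lambda>(\<gamma>, \<phi>). rep \<gamma> \<phi>) f \<le> ennreal B * nsq M f" .
qed

lemma fibers_of_frame:
  assumes A: "\<A> \<subseteq> L2 M" "countable \<A>" and AB: "0 < A" "A \<le> B"
    and frame: "L2_frame M (invariant_space M \<sigma> J \<A>) (UNIV \<times> \<A>) (\<lambda>(\<gamma>, \<phi>). rep \<gamma> \<phi>) A B"
  shows "AE \<alpha> in m. L2_frame MC (range_function M m \<sigma> J C \<A> \<alpha>) \<A> (\<lambda>\<phi>. zak \<phi> \<alpha>) A B"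
proof -
  obtain D :: "complex set" where D: "countable D" "\<And>X. open X \<Longrightarrow> X \<noteq> {} \<Longrightarrow> \<exists>d\<in>D. d \<in> X"
    using countable_dense_exists[where 'a=complex] by auto
  have comb: "AE \<alpha> in m. ennreal A * nsq MC (lcomb (\<lambda>\<phi>. zak \<phi> \<alpha>) ps) \<le> frame_sum MC \<A> (\<lambda>\<phi>. zak \<phi> \<alpha>) (lcomb (\<lambda>\<phi>. zak \<phi> \<alpha>) ps) \<and>
      frame_sum MC \<A> (\<lambda>\<phi>. zak \<phi> \<alpha>) (lcomb (\<lambda>\<phi>. zak \<phi> \<alpha>) ps) \<le> ennreal B * nsq MC (lcomb (\<lambda>\<phi>. zak \<phi> \<alpha>) ps)"
    if ps: "ps \<in> lists (D \<times> \<A>)" for ps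
  proof -
    define l where "l = lcomb (\<lambda>\<phi>. \<phi>) ps"
    \<comment> \<open>The list that defines \<open>l\<close> is evaluated on the fibers, so
      \<open>L\<close> represents the Zak transform of \<open>l\<close> and lies in the span of the
      fibers at every \<open>\<alpha>\<close>.\<close>
    define L where "L \<alpha> = lcomb (\<lambda>\<phi>. zak \<phi> \<alpha>) ps" for \<alpha>
    define u where "u \<alpha> = frame_sum MC \<A> (\<lambda>\<phi>. zak \<phi> \<alpha>) (L \<alpha>)" for \<alpha>
    define v where "v \<alpha> = nsq MC (L \<alpha>)" for \<alpha>
    have "l \<in> cspan ((\<lambda>\<phi>. \<phi>) ` \<A>)" unfolding l_def by (rule lcomb_cspan[OF ps])
    then have lL: "l \<in> L2 M" using cspan_subset_L2[OF A(1)] by auto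
    have lz: "zak_rel l L" unfolding l_def L_def[abs_def] by (rule zak_rel_lcomb[OF A(1) ps])
    have vm [measurable]: "v \<in> borel_measurable m" unfolding v_def[abs_def] by (rule zak_rel_fiber(2)[OF lz])
    have um [measurable]: "u \<in> borel_measurable m" unfolding u_def[abs_def] by (rule frame_sum_measurable[OF A lL lz])
    have main: "(\<integral>\<^sup>+\<alpha>. ennreal ((cmod (p \<alpha>))\<^sup>2) * (ennreal A * v \<alpha>) \<partial>m) \<le> (\<integral>\<^sup>+\<alpha>. ennreal ((cmod (p \<alpha>))\<^sup>2) * u \<alpha> \<partial>m)"
      "(\<integral>\<^sup>+\<alpha>. ennreal ((cmod (p \<alpha>))\<^sup>2) * u \<alpha> \<partial>m) \<le> (\<integral>\<^sup>+\<alpha>. ennreal ((cmod (p \<alpha>))\<^sup>2) * (ennreal B * v \<alpha>) \<partial>m)"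
      if p: "p \<in> trig" for p
    proof -
      have [measurable]: "p \<in> borel_measurable m" by (rule trig_measurable[OF p])
      obtain g where g: "g \<in> cspan {rep \<gamma> \<phi> |\<gamma> \<phi>. \<phi> \<in> \<A>}" "zak_rel g (\<lambda>\<alpha> x. p \<alpha> * L \<alpha> x)"
        using trig_times_lcomb[OF A(1) ps p] unfolding L_def by blast
      have gL: "g \<in> L2 M" using g(1) cspan_subset_L2[OF rep_set_L2[OF A(1)]] by auto
      have gV: "g \<in> L2_closed_span M {rep \<gamma> \<phi> |\<gamma> \<phi>. \<phi> \<in> \<A>}"
        by (rule subsetD[OF cspan_subset_closed_span[OF rep_set_L2[OF A(1)]] g(1)])
      have n: "nsq M g = (\<integral>\<^sup>+\<alpha>. ennreal ((cmod (p \<alpha>))\<^sup>2) * v \<alpha> \<partial>m)"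
        unfolding zak_rel_fiber(3)[OF g(2) gL, symmetric] v_def
      proof (intro nn_integral_cong_AE, use zak_rel_fiber(1)[OF lz] in eventually_elim)
        case (elim \<alpha>)
        then show ?case by (intro nsq_scale L2_measurable)
      qed
      have s: "frame_sum M (UNIV \<times> \<A>) (\<lambda>(\<gamma>, \<phi>). rep \<gamma> \<phi>) g = (\<integral>\<^sup>+\<alpha>. ennreal ((cmod (p \<alpha>))\<^sup>2) * u \<alpha> \<partial>m)"
        unfolding frame_sum_fiber[OF A gL g(2)] frame_sum_scale u_def ..
      have fr: "ennreal A * nsq M g \<le> frame_sum M (UNIV \<times> \<A>) (\<lambda>(\<gamma>, \<phi>). rep \<gamma> \<phi>) g"
        "frame_sum M (UNIV \<times> \<A>) (\<lambda>(\<gamma>, \<phi>). rep \<gamma> \<phi>) g \<le> ennreal B * nsq M g"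
        using frame gV unfolding invariant_space_def L2_frame_iff by auto
      have c: "(\<integral>\<^sup>+\<alpha>. ennreal ((cmod (p \<alpha>))\<^sup>2) * (ennreal c * v \<alpha>) \<partial>m) = ennreal c * nsq M g" for c
        unfolding n by (subst nn_integral_cmult[symmetric]) (auto simp: mult_ac)
      show "(\<integral>\<^sup>+\<alpha>. ennreal ((cmod (p \<alpha>))\<^sup>2) * (ennreal A * v \<alpha>) \<partial>m) \<le> (\<integral>\<^sup>+\<alpha>. ennreal ((cmod (p \<alpha>))\<^sup>2) * u \<alpha> \<partial>m)"
        unfolding c s[symmetric] by (rule fr(1))
      show "(\<integral>\<^sup>+\<alpha>. ennreal ((cmod (p \<alpha>))\<^sup>2) * u \<alpha> \<partial>m) \<le> (\<integral>\<^sup>+\<alpha>. ennreal ((cmod (p \<alpha>))\<^sup>2) * (ennreal B * v \<alpha>) \<partial>m)"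
        unfolding c s[symmetric] by (rule fr(2))
    qed
    have fv: "(\<integral>\<^sup>+\<alpha>. ennreal c * v \<alpha> \<partial>m) < \<infinity>" for c
      using zak_rel_fiber(3)[OF lz lL] lL by (simp add: nn_integral_cmult v_def[symmetric] L2_iff ennreal_mult_less_top)
    \<comment> \<open>The polynomial \<open>1 * \<alpha> 0\<close> is constantly 1 on
      \<open>dual_group\<close>. With it the upper inequality shows that \<open>u\<close> has finite
      integral, as \<open>trig_domination\<close> demands.\<close>
    have one: "(\<integral>\<^sup>+\<alpha>. ennreal ((cmod (1 * \<alpha> 0))\<^sup>2) * w \<alpha> \<partial>m) = (\<integral>\<^sup>+\<alpha>. w \<alpha> \<partial>m)" for w
      by (intro nn_integral_cong) (simp add: dual_groupD)
    have fu: "(\<integral>\<^sup>+\<alpha>. u \<alpha> \<partial>m) < \<infinity>"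
      using main(2)[OF trig_char[of 1 0]] unfolding one by (rule le_less_trans[OF _ fv])
    have "AE \<alpha> in m. ennreal A * v \<alpha> \<le> u \<alpha>"
      by (rule trig_domination[OF _ um fv fu main(1)]) auto
    moreover have "AE \<alpha> in m. u \<alpha> \<le> ennreal B * v \<alpha>"
      by (rule trig_domination[OF um _ fu fv main(2)]) auto
    ultimately show ?thesis
      by eventually_elim (simp add: u_def v_def L_def)
  qed
  \<comment> \<open>The null set obtained above depends on \<open>ps\<close>; countability yields
    one for all lists. Off it, each fiber is treated separately by
    \<open>frame_bounds_closure\<close>.\<close>
  have "countable (lists (D \<times> \<A>))" using D(1) A(2) by auto
  then have "AE \<alpha> in m. \<forall>ps\<in>lists (D \<times> \<A>). ennreal A * nsq MC (lcomb (\<lambda>\<phi>. zak \<phi> \<alpha>) ps) \<le> frame_sum MC \<A> (\<lambda>\<phi>. zak \<phi> \<alpha>) (lcomb (\<lambda>\<phi>. zak \<phi> \<alpha>) ps) \<and>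
      frame_sum MC \<A> (\<lambda>\<phi>. zak \<phi> \<alpha>) (lcomb (\<lambda>\<phi>. zak \<phi> \<alpha>) ps) \<le> ennreal B * nsq MC (lcomb (\<lambda>\<phi>. zak \<phi> \<alpha>) ps)"
    using comb by (subst AE_ball_countable) auto
  moreover have "AE \<alpha> in m. \<forall>\<phi>\<in>\<A>. zak \<phi> \<alpha> \<in> L2 MC"
    using A by (subst AE_ball_countable) (auto intro!: zak_rel_fiber(1) zak_rel_zak_transform)
  ultimately show ?thesis
  proof eventually_elim
    case (elim \<alpha>)
    have sub: "(\<lambda>\<phi>. zak \<phi> \<alpha>) ` \<A> \<subseteq> L2 MC" using elim(2) by auto
    show ?case
      unfolding range_function_def L2_frame_iff
    proof (intro conjI ballI A AB)
      fix \<phi> assume "\<phi> \<in> \<A>"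
      then have "zak \<phi> \<alpha> \<in> (\<lambda>\<phi>. zak \<phi> \<alpha>) ` \<A>" by auto
      then show "zak \<phi> \<alpha> \<in> L2_closed_span MC ((\<lambda>\<phi>. zak \<phi> \<alpha>) ` \<A>)"
        by (rule subsetD[OF cspan_subset_closed_span[OF sub] cspan_base])
    next
      fix f assume f: "f \<in> L2_closed_span MC ((\<lambda>\<phi>. zak \<phi> \<alpha>) ` \<A>)"
      show "ennreal A * nsq MC f \<le> frame_sum MC \<A> (\<lambda>\<phi>. zak \<phi> \<alpha>) f"
        by (rule frame_bounds_closure(1)[OF sub D(2) AB _ _ f]) (use elim(1) in auto)
      show "frame_sum MC \<A> (\<lambda>\<phi>. zak \<phi> \<alpha>) f \<le> ennreal B * nsq MC f"
        by (rule frame_bounds_closure(2)[OF sub D(2) AB _ _ f]) (use elim(1) in auto)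
    qed
  qed
qed

end

theorem theorem5p1:
  fixes M :: "'x measure"
    and m :: "('g::{ab_group_add, countable} \<Rightarrow> complex) measure"
    and \<sigma> :: "'g \<Rightarrow> 'x \<Rightarrow> 'x"
    and J :: "'g \<Rightarrow> 'x \<Rightarrow> real"
    and C :: "'x set"
    and \<A> :: "('x \<Rightarrow> complex) set"
    and A B :: real
  assumes "sigma_finite_measure M"
    and "L2_separable M"
    and "normalized_haar_dual m"
    and "measurable_action M \<sigma>"
    and "is_jacobian M \<sigma> J"
    and "tiling_set M \<sigma> C"
    and "\<A> \<subseteq> L2 M"
    and "countable \<A>"
    and "0 < A" and "A \<le> B"
  shows "L2_frame M (invariant_space M \<sigma> J \<A>) (UNIV \<times> \<A>) (\<lambda>(\<gamma>, \<phi>). action_rep \<sigma> J \<gamma> \<phi>) A B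
    \<longleftrightarrow> (AE \<alpha> in m. L2_frame (restrict_space M C) (range_function M m \<sigma> J C \<A> \<alpha>)
            \<A> (\<lambda>\<phi>. zak_transform M m \<sigma> J C \<phi> \<alpha>) A B)"
proof -
  interpret zak_setting m M \<sigma> J C
    using assms by (intro zak_setting.intro haar_dual.intro zak_setting_axioms.intro)
  show ?thesis
    using fibers_of_frame frame_of_fibers assms(7-10) by blast
qed

end
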